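(* Let $\alpha_0\in(0,\tfrac23)$ and $K\in[1,\infty)$. Then there exist $\alpha=\alpha(\alpha_0)>0$ and $T^*=T^*(\alpha,K)\in(0,\infty)$ such that for every $Y_0\in\mathcal C^{-\alpha_0}$ and $\underline Z\in\mathcal Z$ with $\|Y_0\|_{\mathcal C^{-\alpha_0}}+\sup_{0<t\le T^*}\|\underline Z_t\|_{\mathcal Z_\alpha}\le K$, the set $S^{T^*}(Y_0,\underline Z)$ is a singleton.
   Context: Let $\mathbb T^2=\mathbb R^2/\mathbb Z^2$; all functions and distributions are complex valued on $\mathbb T^2$. $B^\alpha_{p,q}$ denotes the (Littlewood–Paley) Besov space on $\mathbb T^2$, $\mathcal C^\alpha:=B^\alpha_{\infty,\infty}$, $B^\alpha_p:=B^\alpha_{p,\infty}$. Fix $\mu>0$, $\nu\in\mathbb C$ with $\operatorname{Re}\nu>0$, $\lambda\in\mathbb R$. Let $A:=(i+\mu)\Delta-1$ with semigroup $(e^{tA})_{t\ge0}$. For $\alpha_1>\alpha>0$, the product of $f\in\mathcal C^{\alpha_1}$ and $g\in\mathcal C^{-\alpha}$ is the continuous extension of pointwise multiplication (an element of $\mathcal C^{-\alpha}$). A quadruple $\underline Z=(Z,Z^2,|Z|^2,|Z|^2Z)$ consists of four distribution-valued paths; the symbols $Z^2,|Z|^2,|Z|^2Z$ are merely names of independent components, not functions of $Z$. Set $\|\underline Z_t\|_{\mathcal Z_\alpha}:=\max\{\|Z(t)\|_{\mathcal C^{-\alpha}},\,t^\alpha\|Z^2(t)\|_{\mathcal C^{-\alpha}},\,t^\alpha\||Z|^2(t)\|_{\mathcal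 C^{-\alpha}},\,t^\alpha\||Z|^2Z(t)\|_{\mathcal C^{-\alpha}}\}$. $\mathcal Z$ is the set of such $\underline Z$ with $Z\in C([0,\infty);\mathcal C^{-\alpha})$ and the other three components in $C((0,\infty);\mathcal C^{-\alpha})$ for every $\alpha>0$, and $\sup_{0<t\le T}\|\underline Z_t\|_{\mathcal Z_\alpha}<\infty$ for all $T,\alpha\in(0,\infty)$. Define $\Psi(Y,\underline Z):=(1+\lambda)(Z+Y)-\nu\big(|Y|^2Y+2Z|Y|^2+\bar ZY^2+2|Z|^2Y+Z^2\bar Y+|Z|^2Z\big)$ (bar = complex conjugation). Solutions: for $Y_0\in\mathcal C^{-\alpha_0}$, $\underline Z\in\mathcal Z$, $T>0$, a function $Y$ is a solution over $[0,T]$ if (i) there exist $\alpha_1>0$ and $\gamma\in(0,\tfrac13)$ with $Y\in C((0,T];\mathcal C^{\alpha_1})$ and $\sup_{0<t\le T}t^\gamma\|Y_t\|_{\mathcal C^{\alpha_1}}<\infty$, and (ii) $Y_t=e^{tA}Y_0+\int_0^te^{(t-s)A}\Psi(Y_s,\underline Z_s)\,ds$ for all $t\in(0,T]$. $S^T(Y_0,\underline Z)$ denotes the set of such solutions. *)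

theory Defs
  imports "HOL-Analysis.Analysis"
begin

text \<open>Distributions on the torus T^2 = R^2/Z^2 are represented by their Fourier
  coefficients, indexed by Z^2 = int * int:  f = sum_k f(k) e^{2 pi i k.x}.\<close>
type_synonym distr = "int \<times> int \<Rightarrow> complex"

coinductive smooth2 :: "(real \<times> real \<Rightarrow> real) \<Rightarrow> bool" where
  "(\<And>x. (f has_derivative (\<lambda>h. fst h * D1 x + snd h * D2 x)) (at x))
   \<Longrightarrow> smooth2 D1 \<Longrightarrow> smooth2 D2 \<Longrightarrow> smooth2 f"

text \<open>Dyadic partition of unity (Bahouri--Chemin--Danchin, Prop. 2.10).\<close>
definition dyadic_partition :: "(real \<times> real \<Rightarrow> real) \<Rightarrow> (real \<times> real \<Rightarrow> real) \<Rightarrow> bool" where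
  "dyadic_partition chi rho \<longleftrightarrow>
     smooth2 chi \<and> smooth2 rho \<and>
     (\<forall>\<xi>. 0 \<le> chi \<xi> \<and> chi \<xi> \<le> 1 \<and> 0 \<le> rho \<xi> \<and> rho \<xi> \<le> 1) \<and>
     (\<forall>\<xi>. chi \<xi> \<noteq> 0 \<longrightarrow> norm \<xi> \<le> 4/3) \<and>
     (\<forall>\<xi>. rho \<xi> \<noteq> 0 \<longrightarrow> 3/4 \<le> norm \<xi> \<and> norm \<xi> \<le> 8/3) \<and>
     (\<forall>\<xi>. (\<lambda>j::nat. rho ((1 / 2 ^ j) *\<^sub>R \<xi>)) sums (1 - chi \<xi>))"

definition freq :: "int \<times> int \<Rightarrow> real \<times> real" where
  "freq k = (of_int (fst k), of_int (snd k))"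

definition lp_weight :: "(real \<times> real \<Rightarrow> real) \<Rightarrow> (real \<times> real \<Rightarrow> real) \<Rightarrow> int \<Rightarrow> int \<times> int \<Rightarrow> real" where
  "lp_weight chi rho j k =
     (if j \<le> -1 then chi (freq k) else rho ((2 powr (- of_int j)) *\<^sub>R freq k))"

text \<open>A finite box of frequencies containing the support of the j-th multiplier.\<close>
definition lp_box :: "int \<Rightarrow> (int \<times> int) set" where
  "lp_box j = (let B = (\<lceil>3 * (2::real) powr of_int j\<rceil> :: int) in {-B..B} \<times> {-B..B})"

definition lp_block :: "(real \<times> real \<Rightarrow> real) \<Rightarrow> (real \<times> real \<Rightarrow> real) \<Rightarrow> int \<Rightarrow> distr \<Rightarrow> real \<times> real \<Rightarrow> complex" where
  "lp_block chi rho j f x =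
     (\<Sum>k\<in>lp_box j. of_real (lp_weight chi rho j k) * f k *
        cis (2 * pi * (fst (freq k) * fst x + snd (freq k) * snd x)))"

definition sup_norm :: "(real \<times> real \<Rightarrow> complex) \<Rightarrow> real" where
  "sup_norm g = (SUP x. norm (g x))"

definition besov_norm :: "(real \<times> real \<Rightarrow> real) \<Rightarrow> (real \<times> real \<Rightarrow> real) \<Rightarrow> real \<Rightarrow> distr \<Rightarrow> real" where
  "besov_norm chi rho \<alpha> f =
     (SUP j\<in>{-1..}. 2 powr (of_int j * \<alpha>) * sup_norm (lp_block chi rho j f))"

definition in_besov :: "(real \<times> real \<Rightarrow> real) \<Rightarrow> (real \<times> real \<Rightarrow> real) \<Rightarrow> real \<Rightarrow> distr \<Rightarrow> bool" where
  "in_besov chi rho \<alpha> f \<longleftrightarrow>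
     bdd_above ((\<lambda>j. 2 powr (of_int j * \<alpha>) * sup_norm (lp_block chi rho j f)) ` {-1..})"

definition dconj :: "distr \<Rightarrow> distr" where
  "dconj f k = cnj (f (- k))"

definition block_prod :: "(real \<times> real \<Rightarrow> real) \<Rightarrow> (real \<times> real \<Rightarrow> real) \<Rightarrow> int \<Rightarrow> int \<Rightarrow> distr \<Rightarrow> distr \<Rightarrow> distr" where
  "block_prod chi rho i j f g k =
     (\<Sum>m\<in>lp_box i. of_real (lp_weight chi rho i m) * f m *
                    (of_real (lp_weight chi rho j (k - m)) * g (k - m)))"

text \<open>Product of distributions as the limit of S_N f * S_N g = sum_{i,j<=N} Delta_i f Delta_j g
  (this is the continuous extension of the pointwise product for f in C^alpha1,
  g in C^-alpha, alpha1 > alpha > 0, and the pointwise product for functions).\<close>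
definition dprod :: "(real \<times> real \<Rightarrow> real) \<Rightarrow> (real \<times> real \<Rightarrow> real) \<Rightarrow> distr \<Rightarrow> distr \<Rightarrow> distr" where
  "dprod chi rho f g k =
     lim (\<lambda>N::nat. \<Sum>i\<in>{-1..int N}. \<Sum>j\<in>{-1..int N}. block_prod chi rho i j f g k)"

text \<open>Fourier symbol of e^{tA}, A = (i + mu) Laplacian - 1.\<close>
definition sg_symbol :: "real \<Rightarrow> real \<Rightarrow> int \<times> int \<Rightarrow> complex" where
  "sg_symbol \<mu> t k =
     exp (of_real t * (- (\<i> + of_real \<mu>) * of_real (4 * pi\<^sup>2 * (real_of_int (fst k) ^ 2 + real_of_int (snd k) ^ 2)) - 1))"

text \<open>The nonlinearity Psi(Y, Z, Z^2, |Z|^2, |Z|^2 Z).\<close>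
definition Psi :: "(real \<times> real \<Rightarrow> real) \<Rightarrow> (real \<times> real \<Rightarrow> real) \<Rightarrow> complex \<Rightarrow> real \<Rightarrow>
                   distr \<Rightarrow> distr \<Rightarrow> distr \<Rightarrow> distr \<Rightarrow> distr \<Rightarrow> distr" where
  "Psi chi rho \<nu> lam Y Z Z2 Zab Zab2 k =
     (let P = dprod chi rho; Yb = dconj Y; absY2 = P Y Yb in
       (1 + of_real lam) * (Z k + Y k)
       - \<nu> * (P absY2 Y k + 2 * P absY2 Z k + P (P Y Y) (dconj Z) k
              + 2 * P Y Zab k + P Yb Z2 k + Zab2 k))"

definition cont_besov :: "(real \<times> real \<Rightarrow> real) \<Rightarrow> (real \<times> real \<Rightarrow> real) \<Rightarrow> real \<Rightarrow> real set \<Rightarrow> (real \<Rightarrow> distr) \<Rightarrow> bool" where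
  "cont_besov chi rho \<alpha> S F \<longleftrightarrow>
     (\<forall>t\<in>S. in_besov chi rho \<alpha> (F t)) \<and>
     (\<forall>t\<in>S. \<forall>\<epsilon>>0. \<exists>\<delta>>0. \<forall>s\<in>S. \<bar>s - t\<bar> < \<delta> \<longrightarrow>
        besov_norm chi rho \<alpha> (\<lambda>k. F s k - F t k) < \<epsilon>)"

definition znorm :: "(real \<times> real \<Rightarrow> real) \<Rightarrow> (real \<times> real \<Rightarrow> real) \<Rightarrow> real \<Rightarrow>
                     (real \<Rightarrow> distr) \<Rightarrow> (real \<Rightarrow> distr) \<Rightarrow> (real \<Rightarrow> distr) \<Rightarrow> (real \<Rightarrow> distr) \<Rightarrow> real \<Rightarrow> real" where
  "znorm chi rho \<alpha> Z Z2 Zab Zab2 t =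
     max (besov_norm chi rho (-\<alpha>) (Z t))
       (max (t powr \<alpha> * besov_norm chi rho (-\<alpha>) (Z2 t))
          (max (t powr \<alpha> * besov_norm chi rho (-\<alpha>) (Zab t))
               (t powr \<alpha> * besov_norm chi rho (-\<alpha>) (Zab2 t))))"

definition in_Zset :: "(real \<times> real \<Rightarrow> real) \<Rightarrow> (real \<times> real \<Rightarrow> real) \<Rightarrow>
                     (real \<Rightarrow> distr) \<Rightarrow> (real \<Rightarrow> distr) \<Rightarrow> (real \<Rightarrow> distr) \<Rightarrow> (real \<Rightarrow> distr) \<Rightarrow> bool" where
  "in_Zset chi rho Z Z2 Zab Zab2 \<longleftrightarrow>
     (\<forall>\<alpha>>0. cont_besov chi rho (-\<alpha>) {0..} Z \<and> cont_besov chi rho (-\<alpha>) {0<..} Z2 \<and>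
            cont_besov chi rho (-\<alpha>) {0<..} Zab \<and> cont_besov chi rho (-\<alpha>) {0<..} Zab2) \<and>
     (\<forall>T>0. \<forall>\<alpha>>0. bdd_above (znorm chi rho \<alpha> Z Z2 Zab Zab2 ` {0<..T}))"

text \<open>Mild solutions over [0,T] (conditions (i) and (ii)); the mild formulation is
  imposed Fourier-coefficientwise.\<close>
definition is_solution :: "(real \<times> real \<Rightarrow> real) \<Rightarrow> (real \<times> real \<Rightarrow> real) \<Rightarrow> real \<Rightarrow> complex \<Rightarrow> real \<Rightarrow> real \<Rightarrow>
     distr \<Rightarrow> (real \<Rightarrow> distr) \<Rightarrow> (real \<Rightarrow> distr) \<Rightarrow> (real \<Rightarrow> distr) \<Rightarrow> (real \<Rightarrow> distr) \<Rightarrow> (real \<Rightarrow> distr) \<Rightarrow> bool" where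
  "is_solution chi rho \<mu> \<nu> lam T Y0 Z Z2 Zab Zab2 Y \<longleftrightarrow>
     (\<exists>\<alpha>1>0. \<exists>\<gamma>. 0 < \<gamma> \<and> \<gamma> < 1/3 \<and> cont_besov chi rho \<alpha>1 {0<..T} Y \<and>
        bdd_above ((\<lambda>t. t powr \<gamma> * besov_norm chi rho \<alpha>1 (Y t)) ` {0<..T})) \<and>
     (\<forall>t\<in>{0<..T}. \<forall>k.
        ((\<lambda>s. sg_symbol \<mu> (t - s) k * Psi chi rho \<nu> lam (Y s) (Z s) (Z2 s) (Zab s) (Zab2 s) k)
           has_integral (Y t k - sg_symbol \<mu> t k * Y0 k)) {0..t})"

text \<open>S^T(Y0, Z): solutions, as functions on (0,T] (extended by 0 outside).\<close>
definition sol_set :: "(real \<times> real \<Rightarrow> real) \<Rightarrow> (real \<times> real \<Rightarrow> real) \<Rightarrow> real \<Rightarrow> complex \<Rightarrow> real \<Rightarrow> real \<Rightarrow>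
     distr \<Rightarrow> (real \<Rightarrow> distr) \<Rightarrow> (real \<Rightarrow> distr) \<Rightarrow> (real \<Rightarrow> distr) \<Rightarrow> (real \<Rightarrow> distr) \<Rightarrow> (real \<Rightarrow> distr) set" where
  "sol_set chi rho \<mu> \<nu> lam T Y0 Z Z2 Zab Zab2 =
     {Y. is_solution chi rho \<mu> \<nu> lam T Y0 Z Z2 Zab Zab2 Y \<and> (\<forall>t. t \<notin> {0<..T} \<longrightarrow> Y t = (\<lambda>_. 0))}"

end

theory Submission
  imports Defs
begin

text \<open>The mild formulation is a fixed point problem in the space of paths bounded by
  \<open>t powr (- \<gamma>)\<close> in \<open>C\<^sup>a\<close>. With \<open>a = 1/3 - \<alpha>0 / 2\<close> and \<open>\<gamma> = (\<alpha>0 + a) / 2 < 1/3\<close> the path of the linear flow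
  lies in it, since the semigroup gains \<open>2 * \<theta>\<close> derivatives at the price of \<open>t powr (- \<theta>)\<close>. The cubic
  nonlinearity maps \<open>C\<^sup>a\<close> to \<open>C\<^sup>-\<^sup>\<alpha>\<close> with a singularity \<open>s powr (- 3 * \<gamma>)\<close>, and the Duhamel integral gains
  \<open>t powr (1 - \<eta>)\<close> with \<open>\<eta> = (a + \<alpha>) / 2 + 3 * \<gamma> < 1\<close>, so the map is a contraction for short times. The
  exponents of an arbitrary solution can be lowered until the same estimate applies to the difference
  of two solutions, on time steps whose length depends only on a priori bounds; this gives uniqueness
  without any restriction on the exponents.

  The Besov estimates rest on one multiplier bound: \<open>L\<^sup>1\<close> bounds for the kernels of the blocks of the
  semigroup, obtained from finitely many differences of the symbol.\<close>


section \<open>Trigonometric polynomials and Fourier multipliers\<close>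

text \<open>A block is a finite sum over frequencies: products and L^2 norms are computed exactly on
  a fine enough grid, and blocks commute with time integrals and with coefficientwise limits. This
  fits the mild equation, which is imposed coefficient by coefficient. The restriction
  \<open>\<alpha>0 < 2/3\<close> is the balance of the cubic term: smoothing from
  \<open>-\<alpha>0\<close> to a positive regularity costs \<open>\<gamma> > \<alpha>0 / 2\<close>,
  while integrability at time 0 asks for \<open>3 * \<gamma> < 1\<close>. The obstacle in uniqueness
  is that a competing solution may have other exponents and a norm of any size, so the contraction
  on \<open>(0, T]\<close> that gives existence says nothing about it; a large norm only shortens
  the time steps.\<close>

definition ch :: "int \<times> int \<Rightarrow> real \<times> real \<Rightarrow> complex" where
  "ch k x = cis (2 * pi * (of_int (fst k) * fst x + of_int (snd k) * snd x))"

definition fbox :: "int \<Rightarrow> (int \<times> int) set" where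
  "fbox D = {-D..D} \<times> {-D..D}"

definition gpt :: "nat \<Rightarrow> nat \<times> nat \<Rightarrow> real \<times> real" where
  "gpt M r = (real (fst r) / real M, real (snd r) / real M)"

abbreviation grid :: "nat \<Rightarrow> (nat \<times> nat) set" where
  "grid M \<equiv> {..<M} \<times> {..<M}"

section \<open>Characters and exact orthogonality on grids\<close>

lemma finite_fbox [simp]: "finite (fbox D)"
  by (simp add: fbox_def)

lemma norm_ch [simp]: "norm (ch k x) = 1"
  by (simp add: ch_def)

lemma ch_add: "ch (k + l) x = ch k x * ch l x"
  by (simp add: ch_def cis_mult algebra_simps)

lemma ch_add_right: "ch k (x + y) = ch k x * ch k y"
  by (simp add: ch_def cis_mult algebra_simps)

lemma cnj_ch: "cnj (ch k x) = ch (- k) x"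
  by (simp add: ch_def cis_cnj algebra_simps)

lemma ch_minus_right: "ch k (- x) = ch (- k) x"
  by (simp add: ch_def)

text \<open>The sum is geometric with a root of unity as ratio. The bound on \<open>k\<close>
  excludes aliasing: any multiple of \<open>M\<close> would also give
  \<open>of_nat M\<close>.\<close>

lemma sum_cis_grid:
  assumes "\<bar>k\<bar> < int M"
  shows "(\<Sum>r<M. cis (2 * pi * (of_int k * (real r / real M)))) = (if k = 0 then of_nat M else 0)"
proof (cases "k = 0")
  case False
  define z where "z = cis (2 * pi * of_int k / real M)"
  have M: "M > 0" using assms False by (cases M) auto
  have "z \<noteq> 1"
  proof
    assume "z = 1"
    hence "cos (2 * pi * of_int k / real M) = 1"
      by (metis cis.simps(1) one_complex.simps(1) z_def)
    then obtain n :: int where "2 * pi * of_int k / real M = of_int n * 2 * pi"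
      unfolding cos_one_2pi_int by auto
    hence "of_int k = (of_int n * real M :: real)" using M by (simp add: field_simps)
    hence "k = n * int M" by (metis of_int_eq_iff of_int_mult of_int_of_nat_eq)
    with assms False show False
      by (metis abs_mult abs_of_nat dvd_triv_right zdvd_not_zless abs_dvd_iff dvd_abs_iff zero_less_abs_iff)
  qed
  have "(\<Sum>r<M. cis (2 * pi * (of_int k * (real r / real M)))) = (\<Sum>r<M. z ^ r)"
    by (intro sum.cong) (auto simp: z_def Complex.DeMoivre mult_ac)
  also have "\<dots> = (z ^ M - 1) / (z - 1)"
    using \<open>z \<noteq> 1\<close> by (simp add: geometric_sum)
  also have "z ^ M = cis (2 * pi * of_int k)"
    using M by (simp add: z_def Complex.DeMoivre)
  also have "\<dots> = 1" by (simp add: cis_multiple_2pi)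
  finally show ?thesis using False by simp
qed simp

lemma sum_ch_grid:
  assumes "\<bar>fst k\<bar> < int M" "\<bar>snd k\<bar> < int M"
  shows "(\<Sum>r\<in>grid M. ch k (gpt M r)) = (if k = 0 then of_nat M ^ 2 else 0)"
proof -
  have "(\<Sum>r\<in>grid M. ch k (gpt M r)) =
     (\<Sum>r<M. \<Sum>s<M. cis (2 * pi * (of_int (fst k) * (real r / real M)))
        * cis (2 * pi * (of_int (snd k) * (real s / real M))))"
    by (subst sum.cartesian_product, intro sum.cong)
       (auto simp: ch_def gpt_def cis_mult algebra_simps)
  also have "\<dots> = (\<Sum>r<M. cis (2 * pi * (of_int (fst k) * (real r / real M))))
      * (\<Sum>s<M. cis (2 * pi * (of_int (snd k) * (real s / real M))))"
    by (simp add: sum_product)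
  also have "\<dots> = (if k = 0 then of_nat M ^ 2 else 0)"
    unfolding sum_cis_grid[OF assms(1)] sum_cis_grid[OF assms(2)]
    by (auto simp: power2_eq_square prod_eq_iff)
  finally show ?thesis .
qed

lemma fbox_diff:
  assumes "k \<in> fbox D" "l \<in> fbox D'" "int M > D + D'"
  shows "\<bar>fst (k - l)\<bar> < int M" "\<bar>snd (k - l)\<bar> < int M"
  using assms by (auto simp: fbox_def)

text \<open>Exact because frequency differences in the box are at most \<open>2 * D\<close> in each
  coordinate, so a grid with more points separates them.\<close>

lemma grid_parseval:
  assumes "int M > 2 * D"
  shows "(\<Sum>r\<in>grid M. (norm (\<Sum>k\<in>fbox D. b k * ch k (gpt M r)))\<^sup>2)
           = real M ^ 2 * (\<Sum>k\<in>fbox D. (norm (b k))\<^sup>2)"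
proof -
  have "complex_of_real (\<Sum>r\<in>grid M. (norm (\<Sum>k\<in>fbox D. b k * ch k (gpt M r)))\<^sup>2)
      = (\<Sum>r\<in>grid M. (\<Sum>k\<in>fbox D. b k * ch k (gpt M r)) * cnj (\<Sum>k\<in>fbox D. b k * ch k (gpt M r)))"
    by (simp only: of_real_sum complex_norm_square)
  also have "\<dots> = (\<Sum>r\<in>grid M. \<Sum>k\<in>fbox D. \<Sum>l\<in>fbox D. b k * cnj (b l) * ch (k - l) (gpt M r))"
    by (simp add: sum_product cnj_ch ch_add[of _ "- _", simplified] mult_ac)
  also have "\<dots> = (\<Sum>k\<in>fbox D. \<Sum>l\<in>fbox D. b k * cnj (b l) * (\<Sum>r\<in>grid M. ch (k - l) (gpt M r)))"
    by (simp add: sum_distrib_left sum.swap[of _ _ "grid M"])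
  also have "\<dots> = (\<Sum>k\<in>fbox D. \<Sum>l\<in>fbox D. if l = k then of_nat M ^ 2 * (b k * cnj (b k)) else 0)"
    using fbox_diff[of _ D _ D M] assms
    by (intro sum.cong refl) (subst sum_ch_grid, auto)
  also have "\<dots> = complex_of_real (real M ^ 2 * (\<Sum>k\<in>fbox D. (norm (b k))\<^sup>2))"
    by (simp add: sum_distrib_left flip: complex_norm_square)
  finally show ?thesis by (simp only: of_real_eq_iff)
qed

text \<open>A coefficient is the grid average of the polynomial against the conjugate character, so
  the sup bound carries over.\<close>

lemma trig_coeff_bound:
  assumes H: "\<And>x. norm (\<Sum>k\<in>fbox D. c k * ch k x) \<le> H" and l: "l \<in> fbox D"
  shows "norm (c l) \<le> H"
proof -
  define M where "M = nat (2 * \<bar>D\<bar> + 1)"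
  have M: "int M > D + D" "M > 0" by (auto simp: M_def)
  have "of_nat M ^ 2 * c l = (\<Sum>k\<in>fbox D. if k = l then of_nat M ^ 2 * c k else 0)"
    using l by simp
  also have "\<dots> = (\<Sum>k\<in>fbox D. c k * (\<Sum>r\<in>grid M. ch (k - l) (gpt M r)))"
    using fbox_diff[OF _ l M(1)] by (intro sum.cong refl) (subst sum_ch_grid, auto)
  also have "\<dots> = (\<Sum>r\<in>grid M. (\<Sum>k\<in>fbox D. c k * ch k (gpt M r)) * ch (- l) (gpt M r))"
    by (simp add: sum_distrib_left sum_distrib_right sum.swap[of _ _ "grid M"]
        ch_add[of _ "- _", simplified] mult_ac)
  finally have "norm (of_nat M ^ 2 * c l) \<le> (\<Sum>r\<in>grid M. H)"
    by (simp only:) (intro sum_norm_le, simp add: norm_mult H)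
  thus ?thesis using M by (simp add: norm_mult norm_power power2_eq_square)
qed

text \<open>A discrete form of Young's inequality: multiplying coefficients by \<open>a\<close>
  convolves with the kernel of \<open>a\<close>, and for \<open>M > D + E\<close> the convolution
  integral equals the grid average.\<close>

lemma convolution_bound:
  assumes H: "\<And>x. norm (\<Sum>k\<in>fbox D. c k * ch k x) \<le> H"
    and M: "int M > D + E" "M > 0"
    and a: "\<And>k. k \<notin> fbox E \<Longrightarrow> a k = 0"
  shows "norm (\<Sum>k\<in>fbox D. a k * c k * ch k x)
      \<le> H * (\<Sum>r\<in>grid M. norm (\<Sum>k\<in>fbox E. a k * ch k (gpt M r))) / real M ^ 2"
proof -
  have "(\<Sum>r\<in>grid M. (\<Sum>k\<in>fbox E. a k * ch k (gpt M r)) * (\<Sum>l\<in>fbox D. c l * ch l (x - gpt M r)))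
     = (\<Sum>r\<in>grid M. \<Sum>k\<in>fbox E. \<Sum>l\<in>fbox D. a k * c l * ch l x * ch (k - l) (gpt M r))"
    by (simp add: sum_product ch_add_right[of _ _ "- _", simplified] ch_minus_right
        ch_add[of _ "- _", simplified] mult_ac)
  also have "\<dots> = (\<Sum>l\<in>fbox D. \<Sum>k\<in>fbox E. a k * c l * ch l x * (\<Sum>r\<in>grid M. ch (k - l) (gpt M r)))"
    by (simp add: sum_distrib_left sum.swap[of _ _ "grid M"])
       (rule sum.swap)
  also have "\<dots> = (\<Sum>l\<in>fbox D. \<Sum>k\<in>fbox E. if k = l then of_nat M ^ 2 * (a l * c l * ch l x) else 0)"
    using fbox_diff[of _ E _ D M] M
    by (intro sum.cong refl) (subst sum_ch_grid, auto)
  also have "\<dots> = of_nat M ^ 2 * (\<Sum>l\<in>fbox D. a l * c l * ch l x)"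
    using a by (auto simp: sum_distrib_left intro!: sum.cong)
  finally have eq: "of_nat M ^ 2 * (\<Sum>l\<in>fbox D. a l * c l * ch l x) =
     (\<Sum>r\<in>grid M. (\<Sum>k\<in>fbox E. a k * ch k (gpt M r)) * (\<Sum>l\<in>fbox D. c l * ch l (x - gpt M r)))" ..
  have "real M ^ 2 * norm (\<Sum>l\<in>fbox D. a l * c l * ch l x)
      = norm (of_nat M ^ 2 * (\<Sum>l\<in>fbox D. a l * c l * ch l x))"
    by (simp add: norm_mult norm_power)
  also have "\<dots> \<le> (\<Sum>r\<in>grid M. norm (\<Sum>k\<in>fbox E. a k * ch k (gpt M r)) * H)"
    unfolding eq by (intro sum_norm_le) (simp add: norm_mult mult_left_mono H)
  finally show ?thesis using M by (simp add: field_simps sum_distrib_left)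
qed

section \<open>Summability of the inverse weight\<close>

lemma sum_inv_squares_le:
  fixes L :: nat assumes "L > 0"
  shows "(\<Sum>r<Suc n. (real L)\<^sup>2 / ((real L)\<^sup>2 + (real r)\<^sup>2)) \<le> 1 + 2 * real L - 2 * (real L)\<^sup>2 / (real L + real n)"
proof (induction n)
  case 0
  then show ?case using assms by (simp add: power2_eq_square)
next
  case (Suc n)
  define l where "l = real L"
  define s where "s = real n"
  have l: "l \<ge> 1" and s: "s \<ge> 0" using assms by (auto simp: l_def s_def)
  have "(l + (s+1))\<^sup>2 \<le> 2 * (l\<^sup>2 + (s+1)\<^sup>2)"
    using sum_squares_bound[of l "s+1"] by (simp add: power2_sum)
  \<comment> \<open>This comparison turns the summand into the telescoping difference
    \<open>2 * l^2 / (l + s) - 2 * l^2 / (l + s + 1)\<close>; the subtracted remainder in the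
    statement is what makes the induction close.\<close>
  hence "(l + s) * (l + s + 1) \<le> 2 * (l\<^sup>2 + (s+1)\<^sup>2)"
    using l s by (smt (verit) mult_right_mono power2_eq_square)
  hence "l\<^sup>2 / (l\<^sup>2 + (s+1)\<^sup>2) \<le> l\<^sup>2 * (2 / ((l + s) * (l + s + 1)))"
    using l s by (simp add: divide_simps mult_left_mono add_pos_nonneg)
  also have "\<dots> = 2 * l\<^sup>2 / (l + s) - 2 * l\<^sup>2 / (l + s + 1)"
    using l s by (simp add: field_simps)
  finally show ?case using Suc by (simp add: l_def s_def add_ac)
qed


text \<open>The chord has length \<open>2 * sin (pi * \<theta>)\<close>, and
  \<open>min \<theta> (1 - \<theta>)\<close> is the distance of \<open>\<theta>\<close> to the
  integers; the weak bound \<open>sin x \<ge> x / 2\<close> up to \<open>x = 8/5 > pi / 2\<close>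
  suffices.\<close>

lemma norm_cis_minus_1_ge:
  assumes "0 \<le> \<theta>" "\<theta> \<le> 1"
  shows "(min \<theta> (1 - \<theta>))\<^sup>2 \<le> (norm (cis (2 * pi * \<theta>) - 1))\<^sup>2"
proof -
  have half: "\<theta> \<le> 2 * sin (pi * \<theta>)" if "0 \<le> \<theta>" "\<theta> \<le> 1/2" for \<theta> :: real
  proof -
    define x where "x = pi * \<theta>"
    have "x \<le> pi * (1/2)" unfolding x_def using that by (intro mult_left_mono) auto
    hence "x \<le> 8/5" using pi_approx(2) by simp
    moreover have "0 \<le> x" using that by (simp add: x_def)
    ultimately have x: "0 \<le> x" "x \<le> 8/5" by auto
    have "\<bar>sin x - (\<Sum>m<3. sin_coeff m * x ^ m)\<bar> \<le> inverse (fact 3) * \<bar>x\<bar> ^ 3"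
      by (rule Maclaurin_sin_bound)
    hence "\<bar>sin x - x\<bar> * 6 \<le> x^3"
      using x by (simp add: numeral_eq_Suc sin_coeff_def)
    hence "(x - sin x) * 6 \<le> x^3" by (smt (verit))
    hence "sin x \<ge> x - x^3 / 6" by simp
    moreover have "x * x^2 \<le> x * 3"
      using x power_mono[of x "8/5" 2] by (intro mult_left_mono) (auto simp: power2_eq_square)
    ultimately have "sin x \<ge> x / 2"
      by (simp add: power3_eq_cube power2_eq_square)
    moreover have "x \<ge> \<theta>"
      using that pi_ge_two mult_right_mono[of 1 pi \<theta>] by (simp add: x_def)
    ultimately show ?thesis by (simp add: x_def)
  qed
  have "min \<theta> (1 - \<theta>) \<le> 2 * sin (pi * \<theta>)"
  proof (cases "\<theta> \<le> 1/2")
    case True thus ?thesis using half[of \<theta>] assms by simp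
  next
    case False
    have "sin (pi * (1 - \<theta>)) = sin (pi * \<theta>)" by (simp add: algebra_simps sin_diff)
    thus ?thesis using half[of "1 - \<theta>"] False assms by simp
  qed
  hence "(min \<theta> (1 - \<theta>))\<^sup>2 \<le> (2 * sin (pi * \<theta>))\<^sup>2"
    using assms by (intro power_mono) auto
  also have "\<dots> = (norm (cis (2 * pi * \<theta>) - 1))\<^sup>2"
  proof -
    define s where "s = sin (pi * \<theta>)"
    define c where "c = cos (pi * \<theta>)"
    have "(norm (cis (2 * (pi * \<theta>)) - 1))\<^sup>2 = (1 - 2 * s\<^sup>2 - 1)\<^sup>2 + (2 * s * c)\<^sup>2"
      unfolding cmod_power2 s_def c_def cos_double_sin[symmetric] sin_double[symmetric] by simp
    also have "\<dots> = 4 * s\<^sup>2 * (s\<^sup>2 + c\<^sup>2)" by algebra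
    also have "s\<^sup>2 + c\<^sup>2 = 1" by (simp add: s_def c_def)
    finally show ?thesis by (simp add: mult.assoc power_mult_distrib s_def)
  qed
  finally show ?thesis .
qed

text \<open>The factor \<open>cis (2 * pi * \<theta>) - 1\<close> stands in for the distance to 0 on
  the circle: multiplying a kernel by it is exactly a unit difference of its coefficients.
  \<open>N\<close> is the frequency scale.\<close>

definition wgt :: "nat \<Rightarrow> real \<Rightarrow> real" where
  "wgt N \<theta> = 1 + (real N)\<^sup>2 * (norm (cis (2 * pi * \<theta>) - 1))\<^sup>2"

lemma wgt_pos: "wgt N \<theta> > 0"
  unfolding wgt_def by (smt (verit) zero_le_mult_iff zero_le_power2)

text \<open>With \<open>N * L\<close> points, \<open>r\<close> grid steps contribute about
  \<open>(r / L)^2\<close> to the weight, so only about \<open>L\<close> terms near each end of the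
  period are of order one. The two ends are estimated by \<open>g r\<close> and
  \<open>g (M - r)\<close>.\<close>

lemma sum_inv_wgt_le:
  assumes "N > 0" "L > 0"
  shows "(\<Sum>r<N * L. 1 / wgt N (real r / real (N * L))) \<le> 6 * real L"
proof -
  define M where "M = N * L"
  define g where "g r = (real L)\<^sup>2 / ((real L)\<^sup>2 + (real r)\<^sup>2)" for r
  have M: "M > 0" using assms by (simp add: M_def)
  have g0: "g r \<ge> 0" for r by (simp add: g_def)
  have "1 / wgt N (real r / real M) \<le> g r + g (M - r)" if r: "r < M" for r
  proof -
    define \<theta> where "\<theta> = real r / real M"
    have \<theta>: "0 \<le> \<theta>" "\<theta> \<le> 1" using r by (auto simp: \<theta>_def)
    define q where "q = (if \<theta> \<le> 1 - \<theta> then r else M - r)"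
    have q: "min \<theta> (1 - \<theta>) = real q / real M"
      using r by (auto simp: q_def \<theta>_def field_simps of_nat_diff)
    have "(real N)\<^sup>2 * (min \<theta> (1 - \<theta>))\<^sup>2 = (real q / real L)\<^sup>2"
      using assms unfolding q by (simp add: M_def field_simps)
    hence "wgt N \<theta> \<ge> 1 + (real q / real L)\<^sup>2"
      using mult_left_mono[OF norm_cis_minus_1_ge[OF \<theta>], of "(real N)\<^sup>2"] by (simp add: wgt_def)
    hence "1 / wgt N \<theta> \<le> 1 / (1 + (real q / real L)\<^sup>2)"
      by (intro divide_left_mono) (auto simp: wgt_pos intro!: mult_pos_pos add_pos_nonneg)
    also have "\<dots> = g q" using assms by (simp add: g_def field_simps)
    also have "\<dots> \<le> g r + g (M - r)" using g0 by (auto simp: q_def)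
    finally show ?thesis by (simp add: \<theta>_def)
  qed
  hence "(\<Sum>r<M. 1 / wgt N (real r / real M)) \<le> (\<Sum>r<M. g r + g (M - r))"
    by (intro sum_mono) auto
  also have "\<dots> = (\<Sum>r<M. g r) + (\<Sum>r<M. g (M - r))" by (simp add: sum.distrib)
  also have "(\<Sum>r<M. g (M - r)) = (\<Sum>r\<in>{1..M}. g r)"
    by (intro sum.reindex_bij_witness[of _ "\<lambda>r. M - r" "\<lambda>r. M - r"]) auto
  also have "(\<Sum>r<M. g r) \<le> (\<Sum>r<Suc M. g r)" using g0 by simp
  also have "(\<Sum>r\<in>{1..M}. g r) \<le> (\<Sum>r<Suc M. g r)"
    using g0 by (intro sum_mono2) auto
  also have "(\<Sum>r<Suc M. g r) \<le> 3 * real L"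
  proof -
    have "0 \<le> 2 * (real L)\<^sup>2 / (real L + real M)" by simp
    moreover have "(\<Sum>r<Suc M. g r) \<le> 1 + 2 * real L - 2 * (real L)\<^sup>2 / (real L + real M)"
      unfolding g_def by (rule sum_inv_squares_le[OF assms(2)])
    ultimately show ?thesis using assms(2) by linarith
  qed
  finally show ?thesis by (simp add: M_def)
qed

section \<open>Weighted energy of a kernel and the multiplier bound\<close>

lemma sum_shift_fbox:
  fixes a :: "int \<times> int \<Rightarrow> complex"
  assumes a: "\<And>k. k \<notin> fbox E \<Longrightarrow> a k = 0" and d: "\<bar>fst d\<bar> \<le> 1" "\<bar>snd d\<bar> \<le> 1"
  shows "(\<Sum>k\<in>fbox (E + 1). a (k - d) * ch k x) = ch d x * (\<Sum>k\<in>fbox E. a k * ch k x)"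
proof -
  have "(\<Sum>k\<in>fbox (E + 1). a (k - d) * ch k x) = (\<Sum>k\<in>(\<lambda>k. k + d) ` fbox E. a (k - d) * ch k x)"
  proof (rule sum.mono_neutral_right)
    show "(\<lambda>k. k + d) ` fbox E \<subseteq> fbox (E + 1)"
      using d by (auto simp: fbox_def plus_prod_def)
    show "\<forall>i\<in>fbox (E + 1) - (\<lambda>k. k + d) ` fbox E. a (i - d) * ch i x = 0"
      using a by (metis DiffE add.commute diff_add_cancel image_iff mult_zero_left)
  qed simp
  also have "\<dots> = (\<Sum>k\<in>fbox E. a k * ch (k + d) x)"
    by (subst sum.reindex) (auto simp: inj_on_def)
  finally show ?thesis by (simp add: ch_add sum_distrib_left mult_ac)
qed

lemma card_fbox: "E \<ge> 0 \<Longrightarrow> real (card (fbox E)) = (2 * of_int E + 1)\<^sup>2"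
  by (simp add: fbox_def card_cartesian_product power2_eq_square)

text \<open>Expanding the product of the two weights gives four squares; by
  \<open>grid_parseval\<close> they are the energies of the symbol, of its two unit differences and
  of its mixed second difference. The box grows by one to hold the shifted supports.\<close>

lemma weighted_energy:
  fixes a :: "int \<times> int \<Rightarrow> complex"
  assumes a: "\<And>k. k \<notin> fbox E \<Longrightarrow> a k = 0" and E: "E \<ge> 0" and M: "int M > 2 * (E + 1)"
    and a0: "\<And>k. norm (a k) \<le> A"
    and a1: "\<And>k. real N * norm (a (k - (1,0)) - a k) \<le> A"
    and a2: "\<And>k. real N * norm (a (k - (0,1)) - a k) \<le> A"
    and a12: "\<And>k. (real N)\<^sup>2 * norm (a (k - (1,1)) - a (k - (1,0)) - a (k - (0,1)) + a k) \<le> A"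
  shows "(\<Sum>r\<in>grid M. wgt N (fst (gpt M r)) * wgt N (snd (gpt M r)) *
            (norm (\<Sum>k\<in>fbox E. a k * ch k (gpt M r)))\<^sup>2) \<le> (real M)\<^sup>2 * (2 * A * (2 * of_int E + 3))\<^sup>2"
proof -
  define F where "F = fbox (E + 1)"
  define K where "K y = (\<Sum>k\<in>fbox E. a k * ch k y)" for y
  define c where "c (i::nat) k = (if i = 0 then a k
      else if i = 1 then of_nat N * (a (k - (1,0)) - a k)
      else if i = 2 then of_nat N * (a (k - (0,1)) - a k)
      else (of_nat N)\<^sup>2 * (a (k - (1,1)) - a (k - (1,0)) - a (k - (0,1)) + a k))" for i k
  have K: "K y = (\<Sum>k\<in>F. a k * ch k y)" for y
    unfolding F_def K_def using a by (intro sum.mono_neutral_left) (auto simp: fbox_def)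
  have sh: "(\<Sum>k\<in>F. a (k - d) * ch k y) = ch d y * K y" if "\<bar>fst d\<bar> \<le> 1" "\<bar>snd d\<bar> \<le> 1" for d y
    unfolding F_def K_def by (rule sum_shift_fbox) (use a that in auto)
  have ch10: "ch (1,0) y = cis (2 * pi * fst y)" and ch01: "ch (0,1) y = cis (2 * pi * snd y)"
    and ch11: "ch (1,1) y = cis (2 * pi * fst y) * cis (2 * pi * snd y)" for y
    by (simp_all add: ch_def cis_mult algebra_simps)
  have c0: "(\<Sum>k\<in>F. c 0 k * ch k y) = K y" for y by (simp add: c_def K)
  have c1: "(\<Sum>k\<in>F. c 1 k * ch k y) = of_nat N * (cis (2 * pi * fst y) - 1) * K y" for y
    using sh[of "(1,0)" y]
    by (simp add: c_def ring_distribs sum.distrib sum_subtractf mult.assoc flip: sum_distrib_left)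
       (simp add: ch10 K algebra_simps)
  have c2: "(\<Sum>k\<in>F. c 2 k * ch k y) = of_nat N * (cis (2 * pi * snd y) - 1) * K y" for y
    using sh[of "(0,1)" y]
    by (simp add: c_def ring_distribs sum.distrib sum_subtractf mult.assoc flip: sum_distrib_left)
       (simp add: ch01 K algebra_simps)
  have c3: "(\<Sum>k\<in>F. c 3 k * ch k y)
      = (of_nat N)\<^sup>2 * (cis (2 * pi * fst y) - 1) * (cis (2 * pi * snd y) - 1) * K y" for y
    using sh[of "(0,1)" y] sh[of "(1,0)" y] sh[of "(1,1)" y]
    by (simp add: c_def ring_distribs sum.distrib sum_subtractf mult.assoc flip: sum_distrib_left)
       (simp add: ch01 ch10 ch11 K algebra_simps)
  have cA: "norm (c i k) \<le> A" for i k
    using a0[of k] a1[of k] a2[of k] a12[of k] by (simp add: c_def norm_mult norm_power)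
  have A: "A \<ge> 0" using order.trans[OF norm_ge_zero a0] .
  have "(\<Sum>r\<in>grid M. wgt N (fst (gpt M r)) * wgt N (snd (gpt M r)) * (norm (K (gpt M r)))\<^sup>2)
      = (\<Sum>r\<in>grid M. \<Sum>i<4. (norm (\<Sum>k\<in>F. c i k * ch k (gpt M r)))\<^sup>2)"
  proof (intro sum.cong refl)
    fix r
    have "(\<Sum>i<4. (norm (\<Sum>k\<in>F. c i k * ch k (gpt M r)))\<^sup>2)
       = (norm (\<Sum>k\<in>F. c 0 k * ch k (gpt M r)))\<^sup>2 + (norm (\<Sum>k\<in>F. c 1 k * ch k (gpt M r)))\<^sup>2
        + (norm (\<Sum>k\<in>F. c 2 k * ch k (gpt M r)))\<^sup>2 + (norm (\<Sum>k\<in>F. c 3 k * ch k (gpt M r)))\<^sup>2"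
      by (simp add: numeral_eq_Suc)
    also have "\<dots> = wgt N (fst (gpt M r)) * wgt N (snd (gpt M r)) * (norm (K (gpt M r)))\<^sup>2"
      unfolding c0 c1 c2 c3 wgt_def norm_mult norm_power norm_of_nat by algebra
    finally show "wgt N (fst (gpt M r)) * wgt N (snd (gpt M r)) * (norm (K (gpt M r)))\<^sup>2
       = (\<Sum>i<4. (norm (\<Sum>k\<in>F. c i k * ch k (gpt M r)))\<^sup>2)" ..
  qed
  also have "\<dots> = (\<Sum>i<4. \<Sum>r\<in>grid M. (norm (\<Sum>k\<in>F. c i k * ch k (gpt M r)))\<^sup>2)"
    by (rule sum.swap)
  also have "\<dots> = (\<Sum>i<4. real M ^ 2 * (\<Sum>k\<in>F. (norm (c i k))\<^sup>2))"
    unfolding F_def using M by (intro sum.cong refl grid_parseval)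
  also have "\<dots> \<le> (\<Sum>i<4::nat. real M ^ 2 * (\<Sum>k\<in>F. A\<^sup>2))"
    using cA by (intro sum_mono mult_left_mono power_mono) auto
  also have "\<dots> = (real M)\<^sup>2 * (2 * A * (2 * of_int E + 3))\<^sup>2"
    using E card_fbox[of "E+1"] by (simp add: F_def power2_eq_square algebra_simps)
  finally show ?thesis by (simp only: K_def)
qed

text \<open>By Cauchy--Schwarz, the \<open>L\<^sup>1\<close> norm of the kernel is controlled by its weighted
  \<open>L\<^sup>2\<close> norm, where multiplication by the weight amounts to taking differences of the symbol.
  All integrals are replaced by averages over a sufficiently fine grid.\<close>

lemma multiplier_bound:
  fixes a :: "int \<times> int \<Rightarrow> complex"
  assumes a: "\<And>k. k \<notin> fbox E \<Longrightarrow> a k = 0" and E: "E \<ge> 0" and N: "N > 0"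
    and a0: "\<And>k. norm (a k) \<le> A"
    and a1: "\<And>k. real N * norm (a (k - (1,0)) - a k) \<le> A"
    and a2: "\<And>k. real N * norm (a (k - (0,1)) - a k) \<le> A"
    and a12: "\<And>k. (real N)\<^sup>2 * norm (a (k - (1,1)) - a (k - (1,0)) - a (k - (0,1)) + a k) \<le> A"
    and H: "\<And>x. norm (\<Sum>k\<in>fbox D. c k * ch k x) \<le> H"
  shows "norm (\<Sum>k\<in>fbox D. a k * c k * ch k x) \<le> 12 * A * (2 * of_int E + 3) / real N * H"
proof -
  \<comment> \<open>\<open>M\<close> has to be a multiple of \<open>N\<close> for
    \<open>sum_inv_wgt_le\<close> and to exceed both aliasing thresholds, which \<open>L\<close>
    alone already does. \<open>L\<close> cancels in the end, since
    \<open>L / M = 1 / N\<close>.\<close>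
  define L where "L = nat (\<bar>D\<bar> + 2 * (E + 1) + 1)"
  define M where "M = N * L"
  have L: "int L > D + E" "int L > 2 * (E + 1)" "L > 0" using E by (auto simp: L_def)
  have "L \<le> M" using N by (simp add: M_def)
  hence M: "int M > D + E" "int M > 2 * (E + 1)" "M > 0" using L by auto
  have A: "A \<ge> 0" using order.trans[OF norm_ge_zero a0] .
  have H0: "H \<ge> 0" using order.trans[OF norm_ge_zero H] .
  define w where "w r = wgt N (fst (gpt M r)) * wgt N (snd (gpt M r))" for r
  define K where "K r = norm (\<Sum>k\<in>fbox E. a k * ch k (gpt M r))" for r
  have w: "w r > 0" for r by (simp add: w_def wgt_pos)
  have w1: "(\<Sum>r\<in>grid M. 1 / w r) \<le> (6 * real L)\<^sup>2"
  proof -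
    have "(\<Sum>r\<in>grid M. 1 / w r) = (\<Sum>r<M. 1 / wgt N (real r / real M))\<^sup>2"
      by (simp add: w_def gpt_def power2_eq_square sum_product sum.cartesian_product case_prod_beta)
    also have "\<dots> \<le> (6 * real L)\<^sup>2"
      using sum_inv_wgt_le[OF N L(3)] unfolding M_def
      by (intro power_mono sum_nonneg) (auto simp: less_imp_le[OF wgt_pos])
    finally show ?thesis .
  qed
  have w2: "(\<Sum>r\<in>grid M. w r * (K r)\<^sup>2) \<le> (real M)\<^sup>2 * (2 * A * (2 * of_int E + 3))\<^sup>2"
    unfolding w_def K_def by (rule weighted_energy) fact+
  have "(\<Sum>r\<in>grid M. K r)\<^sup>2 = (\<Sum>r\<in>grid M. (1 / sqrt (w r)) * (sqrt (w r) * K r))\<^sup>2"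
    using w by (simp add: less_imp_neq[symmetric])
  also have "\<dots> \<le> (\<Sum>r\<in>grid M. (1 / sqrt (w r))\<^sup>2) * (\<Sum>r\<in>grid M. (sqrt (w r) * K r)\<^sup>2)"
    by (rule Cauchy_Schwarz_ineq_sum)
  also have "\<dots> = (\<Sum>r\<in>grid M. 1 / w r) * (\<Sum>r\<in>grid M. w r * (K r)\<^sup>2)"
    using w by (simp add: power_mult_distrib power_divide less_imp_le)
  also have "\<dots> \<le> (6 * real L)\<^sup>2 * ((real M)\<^sup>2 * (2 * A * (2 * of_int E + 3))\<^sup>2)"
    using w by (intro mult_mono w1 w2 sum_nonneg) (auto simp: less_imp_le)
  also have "\<dots> = (6 * real L * real M * (2 * A * (2 * of_int E + 3)))\<^sup>2"
    by (simp add: power_mult_distrib)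
  finally have K1: "(\<Sum>r\<in>grid M. K r) \<le> 6 * real L * real M * (2 * A * (2 * of_int E + 3))"
    by (rule power2_le_imp_le) (use A E in auto)
  have "norm (\<Sum>k\<in>fbox D. a k * c k * ch k x) \<le> H * (\<Sum>r\<in>grid M. K r) / real M ^ 2"
    unfolding K_def by (rule convolution_bound) (use H M a in auto)
  also have "\<dots> \<le> H * (6 * real L * real M * (2 * A * (2 * of_int E + 3))) / real M ^ 2"
    using H0 K1 by (intro divide_right_mono mult_left_mono) auto
  also have "\<dots> = 12 * A * (2 * of_int E + 3) / real N * H"
    using N L by (simp add: M_def power2_eq_square field_simps)
  finally show ?thesis .
qed

section \<open>The heat multiplier on dyadic blocks\<close>

lemma smooth2_derivs:
  assumes "smooth2 f"
  obtains D1 D2 where "\<And>x. (f has_derivative (\<lambda>h. fst h * D1 x + snd h * D2 x)) (at x)"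
    "smooth2 D1" "smooth2 D2"
  using assms by (cases rule: smooth2.cases) auto

lemma derivs_vanish_outside:
  fixes f :: "real \<times> real \<Rightarrow> real"
  assumes f: "(f has_derivative (\<lambda>h. fst h * a + snd h * b)) (at x)"
    and S: "closed S" and z: "\<And>x. x \<notin> S \<Longrightarrow> f x = 0" and x: "x \<notin> S"
  shows "a = 0" "b = 0"
proof -
  have "((\<lambda>_. 0) has_derivative (\<lambda>_. 0)) (at x)" by simp
  hence "(f has_derivative (\<lambda>_. 0)) (at x)"
    by (rule has_derivative_transform_within_open[of _ _ _ _ "- S"]) (use S z x in auto)
  hence "(\<lambda>h. fst h * a + snd h * b) = (\<lambda>_. 0)"
    using f has_derivative_unique by blast
  from fun_cong[OF this, of "(1,0)"] fun_cong[OF this, of "(0,1)"]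
  show "a = 0" "b = 0" by simp_all
qed

lemma smooth2_bounded:
  assumes f: "smooth2 f" and S: "compact S" and z: "\<And>x. x \<notin> S \<Longrightarrow> f x = 0"
  shows "\<exists>B\<ge>0. \<forall>x. \<bar>f x\<bar> \<le> B"
proof -
  obtain D1 D2 where "\<And>x. (f has_derivative (\<lambda>h. fst h * D1 x + snd h * D2 x)) (at x)"
    using smooth2_derivs[OF f] by metis
  hence "continuous_on S f"
    by (meson continuous_at_imp_continuous_on has_derivative_continuous)
  hence "bounded (f ` S)" using S by (intro compact_imp_bounded compact_continuous_image)
  then obtain B where "\<And>x. x \<in> S \<Longrightarrow> \<bar>f x\<bar> \<le> B" by (auto simp: bounded_iff)
  hence "\<forall>x. \<bar>f x\<bar> \<le> max B 0" using z by (metis abs_zero max.cobounded2 max.coboundedI1)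
  thus ?thesis by (intro exI[of _ "max B 0"]) auto
qed

lemma partial_derivs:
  fixes f :: "real \<times> real \<Rightarrow> real"
  assumes "\<And>x. (f has_derivative (\<lambda>h. fst h * D1 x + snd h * D2 x)) (at x)"
  shows "((\<lambda>u. f (u, v)) has_real_derivative D1 (u, v)) (at u)"
    "((\<lambda>v. f (u, v)) has_real_derivative D2 (u, v)) (at v)"
proof -
  have "((\<lambda>u. (u, v)) has_derivative (\<lambda>h. (h, 0))) (at u)" by (intro derivative_intros)
  from diff_chain_at[OF this assms]
  show "((\<lambda>u. f (u, v)) has_real_derivative D1 (u, v)) (at u)"
    by (simp add: has_field_derivative_def o_def mult_commute_abs)
  have "((\<lambda>v. (u, v)) has_derivative (\<lambda>h. (0, h))) (at v)" by (intro derivative_intros)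
  from diff_chain_at[OF this assms]
  show "((\<lambda>v. f (u, v)) has_real_derivative D2 (u, v)) (at v)"
    by (simp add: has_field_derivative_def o_def mult_commute_abs)
qed

text \<open>Collects the derivatives that control first differences in each direction and the mixed
  second difference, with a common bound and vanishing off the same set.\<close>

lemma smooth2_partials:
  assumes f: "smooth2 f" and S: "compact S" and z: "\<And>x. x \<notin> S \<Longrightarrow> f x = 0"
  obtains f1 f2 f12 B where "B \<ge> 0"
    "\<And>u v. ((\<lambda>u. f (u, v)) has_real_derivative f1 (u, v)) (at u)"
    "\<And>u v. ((\<lambda>v. f (u, v)) has_real_derivative f2 (u, v)) (at v)"
    "\<And>u v. ((\<lambda>v. f1 (u, v)) has_real_derivative f12 (u, v)) (at v)"
    "\<And>x. \<bar>f x\<bar> \<le> B" "\<And>x. \<bar>f1 x\<bar> \<le> B" "\<And>x. \<bar>f2 x\<bar> \<le> B" "\<And>x. \<bar>f12 x\<bar> \<le> B"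
    "\<And>x. x \<notin> S \<Longrightarrow> f1 x = 0" "\<And>x. x \<notin> S \<Longrightarrow> f2 x = 0" "\<And>x. x \<notin> S \<Longrightarrow> f12 x = 0"
proof -
  obtain f1 f2 where d: "\<And>x. (f has_derivative (\<lambda>h. fst h * f1 x + snd h * f2 x)) (at x)"
    and s: "smooth2 f1" "smooth2 f2" using smooth2_derivs[OF f] by metis
  obtain f11 f12 where d1: "\<And>x. (f1 has_derivative (\<lambda>h. fst h * f11 x + snd h * f12 x)) (at x)"
    and s1: "smooth2 f12" using smooth2_derivs[OF s(1)] by metis
  note cl = compact_imp_closed[OF S]
  have z1: "f1 x = 0" "f2 x = 0" if "x \<notin> S" for x
    using derivs_vanish_outside[OF d cl z that] by auto
  have z12: "f12 x = 0" if "x \<notin> S" for x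
    using derivs_vanish_outside[OF d1 cl z1(1) that] by auto
  obtain B0 where B0: "B0 \<ge> 0" "\<And>x. \<bar>f x\<bar> \<le> B0" using smooth2_bounded[OF f S z] by auto
  obtain B1 where B1: "B1 \<ge> 0" "\<And>x. \<bar>f1 x\<bar> \<le> B1" using smooth2_bounded[OF s(1) S z1(1)] by auto
  obtain B2 where B2: "B2 \<ge> 0" "\<And>x. \<bar>f2 x\<bar> \<le> B2" using smooth2_bounded[OF s(2) S z1(2)] by auto
  obtain B3 where B3: "B3 \<ge> 0" "\<And>x. \<bar>f12 x\<bar> \<le> B3" using smooth2_bounded[OF s1 S z12] by auto
  show ?thesis
  proof (rule that[of "B0 + B1 + B2 + B3" f1 f2 f12])
    show "\<bar>f x\<bar> \<le> B0 + B1 + B2 + B3" "\<bar>f1 x\<bar> \<le> B0 + B1 + B2 + B3" 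
      "\<bar>f2 x\<bar> \<le> B0 + B1 + B2 + B3" "\<bar>f12 x\<bar> \<le> B0 + B1 + B2 + B3" for x
      using B0(1) B0(2)[of x] B1(1) B1(2)[of x] B2(1) B2(2)[of x] B3(1) B3(2)[of x] by linarith+
  qed (use B0 B1 B2 B3 z1 z12 partial_derivs[OF d] partial_derivs[OF d1] in auto)
qed

lemma vector_derivative_bound:
  fixes f :: "real \<Rightarrow> 'a::real_normed_vector"
  assumes "\<And>x. (f has_vector_derivative f' x) (at x)" "\<And>x. norm (f' x) \<le> B"
  shows "norm (f b - f a) \<le> B * \<bar>b - a\<bar>"
proof -
  have "norm (f b - f a) \<le> B * norm (b - a)"
  proof (rule differentiable_bound[of UNIV])
    fix x :: real
    show "(f has_derivative (\<lambda>h. h *\<^sub>R f' x)) (at x within UNIV)"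
      using assms(1)[of x] by (simp add: has_vector_derivative_def)
    show "onorm (\<lambda>h. h *\<^sub>R f' x) \<le> B"
      using assms(2)[of x] by (intro onorm_le) (simp add: mult.commute[of B] mult_left_mono)
  qed auto
  thus ?thesis by simp
qed

text \<open>From \<open>1 + y \<le> exp y\<close>, cubed. Of the three powers, two pay for the
  factors that the derivatives of the Gaussian produce and one is left as the decay
  \<open>1 / (1 + \<tau>)\<close>.\<close>

lemma cubic_exp_bound:
  fixes c :: real assumes "c > 0"
  shows "\<exists>Q>0. \<forall>x\<ge>0. (1 + x)^3 * exp (- (c * x)) \<le> Q"
proof (intro exI conjI allI impI)
  define q where "q = min 1 (c / 3)"
  have q: "0 < q" "q \<le> 1" "q \<le> c / 3" using assms by (auto simp: q_def)
  show "1 / q ^ 3 > 0" using q by simp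
  fix x :: real assume x: "x \<ge> 0"
  have "q * (1 + x) \<le> 1 + c / 3 * x" 
    using q x mult_right_mono[of q "c/3" x] by (simp add: distrib_left)
  also have "\<dots> \<le> exp (c / 3 * x)" by (rule exp_ge_add_one_self)
  finally have "(q * (1 + x)) ^ 3 \<le> exp (c / 3 * x) ^ 3"
    using q x by (intro power_mono) auto
  also have "\<dots> = exp (c * x)" by (simp flip: exp_of_nat_mult)
  finally have "q ^ 3 * (1 + x) ^ 3 \<le> exp (c * x)" by (simp only: power_mult_distrib)
  thus "(1 + x)^3 * exp (- (c * x)) \<le> 1 / q ^ 3"
    using q by (simp add: exp_minus divide_simps mult_ac)
qed

lemma gauss_derivative:
  fixes d :: complex
  shows "((\<lambda>u. exp (- (d * of_real (u\<^sup>2 + v\<^sup>2)))) has_vector_derivative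
     - (2 * d * of_real u) * exp (- (d * of_real (u\<^sup>2 + v\<^sup>2)))) (at u)"
proof -
  have "((\<lambda>z. exp (- (d * (z\<^sup>2 + of_real (v\<^sup>2))))) has_field_derivative
     - (2 * d * of_real u) * exp (- (d * of_real (u\<^sup>2 + v\<^sup>2)))) (at (of_real u))"
    by (auto intro!: derivative_eq_intros)
  from has_vector_derivative_real_field[OF this] show ?thesis by simp
qed

lemma of_real_mult_derivative:
  fixes g :: "real \<Rightarrow> complex"
  assumes "(f has_real_derivative f') (at x)" "(g has_vector_derivative g') (at x)"
  shows "((\<lambda>x. of_real (f x) * g x) has_vector_derivative (of_real f' * g x + of_real (f x) * g')) (at x)"
  using has_vector_derivative_scaleR[OF assms] by (simp add: scaleR_conv_of_real add.commute)

text \<open>Each derivative of the Gaussian brings a factor of size \<open>\<tau>\<close>, but on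
  the annulus \<open>norm x \<ge> 3/4\<close> its modulus is at most
  \<open>exp (- (Re c * (9/16) * \<tau>))\<close>, which absorbs them. The result is phrased by
  differences, the form in which \<open>multiplier_bound\<close> takes it.\<close>

lemma gauss_cutoff_bounds:
  fixes f :: "real \<times> real \<Rightarrow> real" and c :: complex
  assumes f: "smooth2 f" and supp: "\<And>x. f x \<noteq> 0 \<Longrightarrow> 3/4 \<le> norm x \<and> norm x \<le> 8/3"
    and c: "Re c > 0"
  obtains P where "P > 0"
    "\<And>\<tau> x m. \<tau> \<ge> 0 \<Longrightarrow> m = (\<lambda>x. of_real (f x) * exp (- (of_real \<tau> * c * of_real ((fst x)\<^sup>2 + (snd x)\<^sup>2)))) \<Longrightarrow>
       norm (m x) \<le> P / (1 + \<tau>) \<and>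
       (\<forall>h. norm (m (fst x + h, snd x) - m x) \<le> P / (1 + \<tau>) * \<bar>h\<bar> \<and>
            norm (m (fst x, snd x + h) - m x) \<le> P / (1 + \<tau>) * \<bar>h\<bar> \<and>
            norm (m (fst x + h, snd x + h) - m (fst x + h, snd x) - m (fst x, snd x + h) + m x)
               \<le> P / (1 + \<tau>) * \<bar>h\<bar>\<^sup>2)"
proof -
  define S where "S = {x :: real \<times> real. 3/4 \<le> norm x \<and> norm x \<le> 8/3}"
  have "S = cball 0 (8/3) - ball 0 (3/4)" by (auto simp: S_def)
  hence S: "compact S" by (simp add: compact_diff)
  have z: "x \<notin> S \<Longrightarrow> f x = 0" for x using supp[of x] by (auto simp: S_def)
  obtain f1 f2 f12 B where B: "B \<ge> 0"
    and d1: "\<And>u v. ((\<lambda>u. f (u, v)) has_real_derivative f1 (u, v)) (at u)"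
    and d2: "\<And>u v. ((\<lambda>v. f (u, v)) has_real_derivative f2 (u, v)) (at v)"
    and d12: "\<And>u v. ((\<lambda>v. f1 (u, v)) has_real_derivative f12 (u, v)) (at v)"
    and b: "\<And>x. \<bar>f x\<bar> \<le> B" and b1: "\<And>x. \<bar>f1 x\<bar> \<le> B" and b2: "\<And>x. \<bar>f2 x\<bar> \<le> B" and b12: "\<And>x. \<bar>f12 x\<bar> \<le> B"
    and z1: "\<And>x. x \<notin> S \<Longrightarrow> f1 x = 0" and z2: "\<And>x. x \<notin> S \<Longrightarrow> f2 x = 0" and z12: "\<And>x. x \<notin> S \<Longrightarrow> f12 x = 0"
    by (rule smooth2_partials[OF f S z], assumption) (rule that, assumption+)
  obtain Q where Q: "Q > 0" "\<And>x. x \<ge> 0 \<Longrightarrow> (1 + x)^3 * exp (- (Re c * (9/16) * x)) \<le> Q"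
    using cubic_exp_bound[of "Re c * (9/16)"] c by auto
  define c1 where "c1 = norm c + 1"
  have c1: "c1 \<ge> 1" "norm c \<le> c1" by (auto simp: c1_def)
  \<comment> \<open>The factor \<open>36 * c1^2\<close> comes from
    \<open>1 + q \<le> 6 * c1 * (1 + \<tau>)\<close>, where \<open>q\<close> below bounds the
    logarithmic derivative of the Gaussian on the annulus; \<open>B + 1\<close> keeps
    \<open>P\<close> positive when \<open>B = 0\<close>.\<close>
  define P where "P = (B + 1) * 36 * c1\<^sup>2 * Q"
  have P: "P > 0" using B Q c1 by (auto simp: P_def intro!: mult_pos_pos)
  show ?thesis
  proof (rule that[OF P])
    fix \<tau> :: real and x :: "real \<times> real" and m
    assume \<tau>: "\<tau> \<ge> 0"
    assume m: "m = (\<lambda>x. of_real (f x) * exp (- (of_real \<tau> * c * of_real ((fst x)\<^sup>2 + (snd x)\<^sup>2))))"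
    define d where "d = of_real \<tau> * c"
    define G where "G u v = exp (- (d * of_real (u\<^sup>2 + v\<^sup>2)))" for u v :: real
    define m1 where "m1 u v = of_real (f1 (u,v)) * G u v + of_real (f (u,v)) * (- (2 * d * of_real u) * G u v)" for u v
    define m2 where "m2 u v = of_real (f2 (u,v)) * G u v + of_real (f (u,v)) * (- (2 * d * of_real v) * G u v)" for u v
    define m12 where "m12 u v = (of_real (f12 (u,v)) * G u v + of_real (f1 (u,v)) * (- (2 * d * of_real v) * G u v))
       + (of_real (f2 (u,v)) * (- (2 * d * of_real u) * G u v)
         + of_real (f (u,v)) * (- (2 * d * of_real u) * (- (2 * d * of_real v) * G u v)))" for u v
    have mG: "m (u,v) = of_real (f (u,v)) * G u v" for u v by (simp add: m G_def d_def)
    have G1: "((\<lambda>u. G u v) has_vector_derivative - (2 * d * of_real u) * G u v) (at u)" for u v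
      unfolding G_def by (rule gauss_derivative)
    have G2: "((\<lambda>v. G u v) has_vector_derivative - (2 * d * of_real v) * G u v) (at v)" for u v
      unfolding G_def by (subst (1 2) add.commute) (rule gauss_derivative)
    have D1: "((\<lambda>u. m (u,v)) has_vector_derivative m1 u v) (at u)" for u v
      unfolding mG m1_def by (rule of_real_mult_derivative[OF d1 G1])
    have D2: "((\<lambda>v. m (u,v)) has_vector_derivative m2 u v) (at v)" for u v
      unfolding mG m2_def by (rule of_real_mult_derivative[OF d2 G2])
    have D12: "((\<lambda>v. m1 u v) has_vector_derivative m12 u v) (at v)" for u v
      unfolding m1_def m12_def
      by (intro has_vector_derivative_add of_real_mult_derivative d12 d2 G2
           has_vector_derivative_mult_right)
    define R where "R = P / (1 + \<tau>)"
    have bounds: "norm (m (u,v)) \<le> R \<and> norm (m1 u v) \<le> R \<and> norm (m2 u v) \<le> R \<and> norm (m12 u v) \<le> R" for u v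
    proof (cases "(u,v) \<in> S")
      case False
      thus ?thesis using z[OF False] z1[OF False] z2[OF False] z12[OF False] P \<tau>
        by (simp add: mG m1_def m2_def m12_def R_def)
    next
      case True
      define g where "g = norm (G u v)"
      define e where "e = 1 + \<tau>"
      have n: "norm (u,v) = sqrt (u\<^sup>2 + v\<^sup>2)" by (simp add: norm_prod_def)
      have "(3/4)\<^sup>2 \<le> (norm (u,v))\<^sup>2" using True by (intro power_mono) (auto simp: S_def)
      hence uv: "9/16 \<le> u\<^sup>2 + v\<^sup>2" by (simp add: n power2_eq_square)
      have u: "\<bar>u\<bar> \<le> 8/3" and v: "\<bar>v\<bar> \<le> 8/3"
        using True norm_fst_le[of u v] norm_snd_le[of v u] unfolding S_def by auto
      have "g = exp (- (\<tau> * Re c * (u\<^sup>2 + v\<^sup>2)))" by (simp add: g_def G_def d_def mult.assoc)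
      also have "\<dots> \<le> exp (- (Re c * (9/16) * \<tau>))"
        using mult_left_mono[OF uv, of "\<tau> * Re c"] \<tau> c by (simp add: mult_ac)
      finally have g: "g \<le> exp (- (Re c * (9/16) * \<tau>))" .
      have g0: "g \<ge> 0" by (simp add: g_def)
      have e1: "e \<ge> 1" using \<tau> by (simp add: e_def)
      have nd: "norm (2 * d * of_real w) \<le> 16/3 * c1 * \<tau>" if "\<bar>w\<bar> \<le> 8/3" for w
      proof -
        have "norm (2 * d * of_real w) = 2 * \<tau> * (norm c * \<bar>w\<bar>)" using \<tau> by (simp add: d_def norm_mult)
        also have "\<dots> \<le> 2 * \<tau> * (c1 * (8/3))" using \<tau> that c1 by (intro mult_left_mono mult_mono) auto
        finally show ?thesis by (simp add: mult_ac)
      qed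
      define q where "q = 16/3 * c1 * \<tau>"
      have q: "q \<ge> 0" using c1 \<tau> by (simp add: q_def)
      have nu: "norm (2 * d * of_real u) \<le> q" and nv: "norm (2 * d * of_real v) \<le> q"
        using nd u v by (simp_all add: q_def)
      have "6 * c1 * e - (1 + q) = (6 * c1 - 1) + 2/3 * (c1 * \<tau>)"
        by (simp add: q_def e_def algebra_simps)
      moreover have "0 \<le> c1 * \<tau>" using c1 \<tau> by simp
      ultimately have "1 + q \<le> 6 * c1 * e" using c1 by linarith
      hence "(1 + q)\<^sup>2 \<le> (6 * c1 * e)\<^sup>2" using q by (intro power_mono) auto
      hence q2: "B * (1 + q)\<^sup>2 * g \<le> B * (6 * c1 * e)\<^sup>2 * g" using B g0 by (intro mult_right_mono mult_left_mono)
      also have "\<dots> \<le> (B + 1) * (36 * c1\<^sup>2) * (e\<^sup>2 * g)"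
        using g0 B c1 by (simp add: power_mult_distrib algebra_simps)
      also have "e\<^sup>2 * g \<le> Q / e"
      proof -
        have "e ^ 3 * g \<le> e ^ 3 * exp (- (Re c * (9/16) * \<tau>))" using g e1 by (intro mult_left_mono) auto
        also have "\<dots> \<le> Q" using Q(2)[OF \<tau>] by (simp add: e_def)
        finally show ?thesis using e1 by (simp add: field_simps power2_eq_square power3_eq_cube)
      qed
      hence "(B + 1) * (36 * c1\<^sup>2) * (e\<^sup>2 * g) \<le> (B + 1) * (36 * c1\<^sup>2) * (Q / e)"
        using B by (intro mult_left_mono) auto
      also have "\<dots> = R" by (simp add: R_def P_def e_def)
      finally have R: "B * (1 + q)\<^sup>2 * g \<le> R" .
      have q1: "1 \<le> (1 + q)\<^sup>2" "1 + q \<le> (1 + q)\<^sup>2" using q by (auto simp: power2_eq_square algebra_simps)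
      have R0: "B * g \<le> R" 
        using R mult_right_mono[OF mult_left_mono[OF q1(1) B] g0] by simp
      have R1: "B * (1 + q) * g \<le> R" 
        using R mult_right_mono[OF mult_left_mono[OF q1(2) B] g0] by simp
      have R1': "B * g + B * (q * g) \<le> R" using R1 by (simp add: algebra_simps)
      have R': "B * g + B * (q * g) + (B * (q * g) + B * (q * (q * g))) \<le> R"
        using R by (simp add: algebra_simps power2_eq_square)
      have t0: "norm (complex_of_real w * G u v) \<le> B * g" if "\<bar>w\<bar> \<le> B" for w
        using that g0 by (simp add: norm_mult mult_right_mono flip: g_def)
      have t1: "norm (complex_of_real w * (- y * G u v)) \<le> B * (q * g)" if "\<bar>w\<bar> \<le> B" "norm y \<le> q" for w y
        unfolding norm_mult norm_minus_cancel g_def[symmetric] norm_of_real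
        using that B q g0 by (intro mult_mono) auto
      have t2: "norm (complex_of_real w * (- y * (- y' * G u v))) \<le> B * (q * (q * g))"
        if "\<bar>w\<bar> \<le> B" "norm y \<le> q" "norm y' \<le> q" for w y y'
        unfolding norm_mult norm_minus_cancel g_def[symmetric] norm_of_real
        using that B q g0 by (intro mult_mono) auto
      have "norm (m (u,v)) \<le> R" unfolding mG using t0[OF b] R0 by (rule order.trans)
      moreover have "norm (m1 u v) \<le> R"
        unfolding m1_def using norm_triangle_mono[OF t0[OF b1] t1[OF b nu]] R1'
        by (rule order.trans)
      moreover have "norm (m2 u v) \<le> R"
        unfolding m2_def using norm_triangle_mono[OF t0[OF b2] t1[OF b nv]] R1'
        by (rule order.trans)
      moreover have "norm (m12 u v) \<le> R"
        unfolding m12_def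
        using norm_triangle_mono[OF norm_triangle_mono[OF t0[OF b12] t1[OF b1 nv]]
            norm_triangle_mono[OF t1[OF b2 nu] t2[OF b nu nv]]] R'
        by (rule order.trans)
      ultimately show ?thesis by blast
    qed
    obtain u v where x: "x = (u, v)" by (cases x)
    have B1: "norm (m (u + h, v) - m (u, v)) \<le> R * \<bar>h\<bar>" for u v h
      using vector_derivative_bound[of "\<lambda>u. m (u,v)" "\<lambda>u. m1 u v" R "u + h" u] D1 bounds by auto
    have B2: "norm (m (u, v + h) - m (u, v)) \<le> R * \<bar>h\<bar>" for u v h
      using vector_derivative_bound[of "\<lambda>v. m (u,v)" "\<lambda>v. m2 u v" R "v + h" v] D2 bounds by auto
    have B3: "norm (m1 u (v + h) - m1 u v) \<le> R * \<bar>h\<bar>" for u v h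
      using vector_derivative_bound[of "\<lambda>v. m1 u v" "\<lambda>v. m12 u v" R "v + h" v] D12 bounds by auto
    \<comment> \<open>The difference in the second variable is differentiated in the first one, so
      \<open>B3\<close> supplies its derivative bound and each difference contributes one factor
      \<open>\<bar>h\<bar>\<close>.\<close>
    have B4: "norm ((m (u + h, v + h) - m (u + h, v)) - (m (u, v + h) - m (u, v))) \<le> R * \<bar>h\<bar> * \<bar>h\<bar>" for u v h
      using vector_derivative_bound[of "\<lambda>u. m (u, v + h) - m (u, v)" "\<lambda>u. m1 u (v + h) - m1 u v" "R * \<bar>h\<bar>" "u + h" u]
         has_vector_derivative_diff[OF D1 D1] B3 by auto
    have B5: "norm (m (u + h, v + h) - m (u + h, v) - m (u, v + h) + m (u, v)) \<le> R * \<bar>h\<bar>\<^sup>2" for u v h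
      using B4[of u h v] by (simp add: power2_eq_square mult.assoc algebra_simps)
    show "norm (m x) \<le> P / (1 + \<tau>) \<and>
       (\<forall>h. norm (m (fst x + h, snd x) - m x) \<le> P / (1 + \<tau>) * \<bar>h\<bar> \<and>
            norm (m (fst x, snd x + h) - m x) \<le> P / (1 + \<tau>) * \<bar>h\<bar> \<and>
            norm (m (fst x + h, snd x + h) - m (fst x + h, snd x) - m (fst x, snd x + h) + m x)
               \<le> P / (1 + \<tau>) * \<bar>h\<bar>\<^sup>2)"
      unfolding R_def[symmetric] x fst_conv snd_conv
      using bounds B1 B2 B5 by blast
  qed
qed

section \<open>Dyadic weights and the blocks of the semigroup\<close>

locale dyadic =
  fixes chi rho :: "real \<times> real \<Rightarrow> real"
  assumes partition: "dyadic_partition chi rho"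
begin

text \<open>Blocks are indexed by \<open>n = j + 1\<close>, so that index 0 is the low-frequency block.\<close>

definition wt :: "nat \<Rightarrow> int \<times> int \<Rightarrow> real" where
  "wt n = lp_weight chi rho (int n - 1)"

lemma wt_0: "wt 0 k = chi (freq k)"
  by (simp add: wt_def lp_weight_def)

lemma wt_Suc: "wt (Suc n) k = rho ((1 / 2 ^ n) *\<^sub>R freq k)"
  by (simp add: wt_def lp_weight_def powr_minus powr_realpow divide_inverse)

lemma partitionD:
  shows "0 \<le> chi x" "chi x \<le> 1" "0 \<le> rho x" "rho x \<le> 1"
    and "chi x \<noteq> 0 \<Longrightarrow> norm x \<le> 4/3" "rho x \<noteq> 0 \<Longrightarrow> 3/4 \<le> norm x" "rho x \<noteq> 0 \<Longrightarrow> norm x \<le> 8/3"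
    and "(\<lambda>j::nat. rho ((1 / 2 ^ j) *\<^sub>R x)) sums (1 - chi x)" "smooth2 rho"
  using partition unfolding dyadic_partition_def by blast+

lemma wt_nonneg: "0 \<le> wt n k" and wt_le_1: "wt n k \<le> 1"
  by (cases n; simp add: wt_0 wt_Suc partitionD)+

text \<open>The radius fits both cases: \<open>4/3\<close> for \<open>chi\<close> at index 0 and
  \<open>8/3 * 2 ^ (n - 1)\<close> for the annuli.\<close>

lemma wt_upper: "wt n k \<noteq> 0 \<Longrightarrow> norm (freq k) \<le> 4/3 * 2 ^ n"
proof (cases n)
  case 0
  thus "wt n k \<noteq> 0 \<Longrightarrow> ?thesis" using partitionD(5)[of "freq k"] by (simp add: wt_0)
next
  case (Suc m)
  assume "wt n k \<noteq> 0"
  hence "norm ((1 / 2 ^ m) *\<^sub>R freq k) \<le> 8/3"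
    unfolding Suc wt_Suc by (rule partitionD)
  thus ?thesis by (simp add: Suc field_simps)
qed

lemma wt_lower: "wt n k \<noteq> 0 \<Longrightarrow> n > 0 \<Longrightarrow> 3/8 * 2 ^ n \<le> norm (freq k)"
proof (cases n)
  case (Suc m)
  assume "wt n k \<noteq> 0"
  hence "3/4 \<le> norm ((1 / 2 ^ m) *\<^sub>R freq k)"
    unfolding Suc wt_Suc by (rule partitionD)
  thus ?thesis by (simp add: Suc field_simps)
qed simp

lemma wt_sums: "(\<lambda>n. wt n k) sums 1"
proof -
  have "(\<lambda>n. wt (Suc n) k) sums (1 - wt 0 k)"
    unfolding wt_0 wt_Suc by (rule partitionD)
  from sums_Suc[OF this] show ?thesis by simp
qed

lemma freq_abs_le: "\<bar>of_int (fst k)\<bar> \<le> norm (freq k)" "\<bar>of_int (snd k)\<bar> \<le> norm (freq k)"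
  using norm_fst_le[of "real_of_int (fst k)" "real_of_int (snd k)"]
    norm_snd_le[of "real_of_int (snd k)" "real_of_int (fst k)"] by (auto simp: freq_def)

lemma wt_fbox: 
  assumes "wt n k \<noteq> 0" "2 ^ Suc n \<le> D"
  shows "k \<in> fbox D"
proof -
  have "of_int \<bar>fst k\<bar> \<le> (4/3 * 2 ^ n :: real)" "of_int \<bar>snd k\<bar> \<le> (4/3 * 2 ^ n :: real)"
    using wt_upper[OF assms(1)] freq_abs_le[of k] by auto
  moreover have "(4/3 * 2 ^ n :: real) \<le> of_int (2 ^ Suc n)" by simp
  moreover have "real_of_int (2 ^ Suc n) \<le> of_int D" using assms(2) by (simp only: of_int_le_iff)
  ultimately have "of_int \<bar>fst k\<bar> \<le> (of_int D :: real)" "of_int \<bar>snd k\<bar> \<le> (of_int D :: real)" by linarith+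
  hence "\<bar>fst k\<bar> \<le> D" "\<bar>snd k\<bar> \<le> D" by (simp_all only: of_int_le_iff)
  thus ?thesis by (cases k) (auto simp: fbox_def)
qed

text \<open>The blocks of index at least 1 form a rescaled family of symbols, localised in an annulus
  on which the heat factor decays exponentially.\<close>

lemma multiplier_semigroup:
  assumes \<mu>: "\<mu> > 0"
  obtains C where "C > 0"
    "\<And>n t c D H x. 0 \<le> t \<Longrightarrow> t \<le> 1 \<Longrightarrow> (\<And>x. norm (\<Sum>k\<in>fbox D. c k * ch k x) \<le> H) \<Longrightarrow>
       norm (\<Sum>k\<in>fbox D. of_real (wt n k) * sg_symbol \<mu> t k * c k * ch k x) \<le> C / (1 + t * 4 ^ n) * H"
proof -
  define \<kappa> where "\<kappa> = of_real (4 * pi\<^sup>2) * (\<i> + of_real \<mu>)"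
  have \<kappa>: "Re \<kappa> > 0" using \<mu> by (simp add: \<kappa>_def)
  have rho: "smooth2 rho" "\<And>x. rho x \<noteq> 0 \<Longrightarrow> 3/4 \<le> norm x \<and> norm x \<le> 8/3"
    using partitionD by blast+
  obtain P where P: "P > 0" and bnd:
    "\<And>\<tau> x m. \<tau> \<ge> 0 \<Longrightarrow> m = (\<lambda>x. of_real (rho x) * exp (- (of_real \<tau> * \<kappa> * of_real ((fst x)\<^sup>2 + (snd x)\<^sup>2)))) \<Longrightarrow>
       norm (m x) \<le> P / (1 + \<tau>) \<and>
       (\<forall>h. norm (m (fst x + h, snd x) - m x) \<le> P / (1 + \<tau>) * \<bar>h\<bar> \<and>
            norm (m (fst x, snd x + h) - m x) \<le> P / (1 + \<tau>) * \<bar>h\<bar> \<and>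
            norm (m (fst x + h, snd x + h) - m (fst x + h, snd x) - m (fst x, snd x + h) + m x)
               \<le> P / (1 + \<tau>) * \<bar>h\<bar>\<^sup>2)"
    by (rule gauss_cutoff_bounds[OF rho \<kappa>], assumption) (rule that, assumption+)
  have sg: "sg_symbol \<mu> t k = of_real (exp (- t)) *
      exp (- (of_real t * \<kappa> * of_real ((of_int (fst k))\<^sup>2 + (of_int (snd k))\<^sup>2)))" for t k
    unfolding sg_symbol_def \<kappa>_def of_real_exp exp_add[symmetric]
    by (rule arg_cong[of _ _ exp]) (simp add: algebra_simps)
  have sg_le: "norm (sg_symbol \<mu> t k) \<le> 1" if "0 \<le> t" for t k
  proof -
    have "0 \<le> t * (Re \<kappa> * ((of_int (fst k))\<^sup>2 + (of_int (snd k))\<^sup>2))"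
      using \<kappa> that by (intro mult_nonneg_nonneg) auto
    thus ?thesis using that unfolding sg norm_mult norm_exp_eq_Re
      by (intro mult_le_one) (auto simp: mult.assoc)
  qed
  show ?thesis
  \<comment> \<open>The low block involves at most nine coefficients, each bounded by
    \<open>H\<close>, and \<open>1 + t \<le> 2\<close>, hence 18. For the others
    \<open>12 * (6 + 3 / N) \<le> 108\<close>, and \<open>t * 4 ^ n\<close> is four times the
    rescaled time, hence 432.\<close>
  proof (rule that[of "18 + 432 * P"])
    show "18 + 432 * P > 0" using P by simp
    fix n t c D H x
    assume t: "0 \<le> t" "t \<le> (1::real)" and H: "\<And>x. norm (\<Sum>k\<in>fbox D. c k * ch k x) \<le> H"
    have H0: "H \<ge> 0" using order.trans[OF norm_ge_zero H] .
    show "norm (\<Sum>k\<in>fbox D. of_real (wt n k) * sg_symbol \<mu> t k * c k * ch k x) \<le> (18 + 432 * P) / (1 + t * 4 ^ n) * H"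
    proof (cases n)
      case 0
      have k1: "k \<in> fbox 1" if "wt 0 k \<noteq> 0" for k
      proof -
        have "norm (freq k) < 2" using wt_upper[OF that] by simp
        hence "real_of_int \<bar>fst k\<bar> < 2" "real_of_int \<bar>snd k\<bar> < 2"
          using freq_abs_le[of k] by auto
        thus ?thesis by (cases k) (auto simp: fbox_def)
      qed
      have "norm (\<Sum>k\<in>fbox D. of_real (wt 0 k) * sg_symbol \<mu> t k * c k * ch k x)
        \<le> (\<Sum>k\<in>fbox D. if k \<in> fbox 1 then H else 0)"
      proof (intro sum_norm_le)
        fix k assume k: "k \<in> fbox D"
        have "norm (of_real (wt 0 k) * sg_symbol \<mu> t k * c k * ch k x) \<le> 1 * 1 * H * 1"
          unfolding norm_mult using wt_nonneg[of 0 k] wt_le_1[of 0 k] sg_le[OF t(1), of k]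
            trig_coeff_bound[OF H k] H0
          by (intro mult_mono) auto
        thus "norm (of_real (wt 0 k) * sg_symbol \<mu> t k * c k * ch k x) \<le> (if k \<in> fbox 1 then H else 0)"
          using k1[of k] by auto
      qed
      also have "\<dots> = real (card (fbox D \<inter> fbox 1)) * H" by (simp add: sum.If_cases)
      also have "\<dots> \<le> real (card (fbox 1)) * H"
        using H0 by (intro mult_right_mono) (auto intro: card_mono)
      also have "\<dots> = 9 * H" by (simp add: card_fbox)
      also have "\<dots> \<le> (18 + 432 * P) / (1 + t) * H"
        using P t H0 by (intro mult_right_mono) (auto simp: field_simps)
      finally show ?thesis by (simp add: 0)
    next
      case (Suc m)
      define N :: nat where "N = 2 ^ m"
      have N: "N > 0" by (simp add: N_def)
      \<comment> \<open>In the variable \<open>y k = k / N\<close> the symbol is a fixed cut-off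
        times a Gaussian at time \<open>\<tau>\<close>, and unit steps in \<open>k\<close> become
        steps \<open>1 / N\<close>, which the powers of \<open>N\<close> in
        \<open>multiplier_bound\<close> compensate.\<close>
      define \<tau> where "\<tau> = t * (real N)\<^sup>2"
      have \<tau>: "\<tau> \<ge> 0" using t by (simp add: \<tau>_def)
      define M where "M = (\<lambda>x. of_real (rho x) * exp (- (of_real \<tau> * \<kappa> * of_real ((fst x)\<^sup>2 + (snd x)\<^sup>2))))"
      define y where "y k = (1 / real N) *\<^sub>R freq k" for k
      have yeq: "y k = (of_int (fst k) / real N, of_int (snd k) / real N)" for k
        by (simp add: y_def freq_def)
      define a where "a k = M (y k)" for k
      define A where "A = P / (1 + \<tau>)"
      have symb: "of_real (wt n k) * sg_symbol \<mu> t k = of_real (exp (- t)) * a k" for k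
      proof -
        have "t * ((of_int (fst k))\<^sup>2 + (of_int (snd k))\<^sup>2) = \<tau> * ((fst (y k))\<^sup>2 + (snd (y k))\<^sup>2)"
          using N by (simp add: yeq \<tau>_def field_simps)
        hence *: "of_real t * \<kappa> * of_real ((of_int (fst k))\<^sup>2 + (of_int (snd k))\<^sup>2)
           = of_real \<tau> * \<kappa> * of_real ((fst (y k))\<^sup>2 + (snd (y k))\<^sup>2)"
          by (metis (no_types, opaque_lifting) mult.assoc mult.commute of_real_mult)
        have "wt n k = rho (y k)" by (simp add: Suc wt_Suc y_def N_def)
        thus ?thesis unfolding sg a_def M_def * by (simp only: mult_ac)
      qed
      have h: "norm (a k) \<le> A" "norm (M (fst (y k) + h, snd (y k)) - a k) \<le> A * \<bar>h\<bar>"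
        "norm (M (fst (y k), snd (y k) + h) - a k) \<le> A * \<bar>h\<bar>"
        "norm (M (fst (y k) + h, snd (y k) + h) - M (fst (y k) + h, snd (y k)) - M (fst (y k), snd (y k) + h) + a k)
               \<le> A * \<bar>h\<bar>\<^sup>2" for k h
        using bnd[OF \<tau> M_def, of "y k"] unfolding A_def a_def by blast+
      have sh: "a (k - (1,0)) = M (fst (y k) + (- 1 / real N), snd (y k))"
        "a (k - (0,1)) = M (fst (y k), snd (y k) + (- 1 / real N))"
        "a (k - (1,1)) = M (fst (y k) + (- 1 / real N), snd (y k) + (- 1 / real N))" for k
        by (simp_all add: a_def yeq diff_divide_distrib)
      have "norm (\<Sum>k\<in>fbox D. a k * c k * ch k x) \<le> 12 * A * (2 * of_int (3 * int N) + 3) / real N * H"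
      proof (rule multiplier_bound[OF _ _ N _ _ _ _ H])
        fix k
        show "norm (a k) \<le> A" by (rule h)
        show "real N * norm (a (k - (1,0)) - a k) \<le> A"
          using h(2)[of k "- 1 / real N"] N by (simp add: sh field_simps)
        show "real N * norm (a (k - (0,1)) - a k) \<le> A"
          using h(3)[of k "- 1 / real N"] N by (simp add: sh field_simps)
        show "(real N)\<^sup>2 * norm (a (k - (1,1)) - a (k - (1,0)) - a (k - (0,1)) + a k) \<le> A"
          using h(4)[of k "- 1 / real N"] N unfolding sh by (simp add: field_simps)
        assume k: "k \<notin> fbox (3 * int N)"
        have "wt n k = 0"
        proof (rule ccontr)
          assume w: "wt n k \<noteq> 0"
          have "4/3 * 2 ^ n \<le> 3 * real N" by (simp add: Suc N_def)
          with wt_upper[OF w] have "norm (freq k) \<le> 3 * real N" by (rule order.trans)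
          hence "real_of_int \<bar>fst k\<bar> \<le> real_of_int (3 * int N)" "real_of_int \<bar>snd k\<bar> \<le> real_of_int (3 * int N)"
            using freq_abs_le[of k] by auto
          hence "\<bar>fst k\<bar> \<le> 3 * int N" "\<bar>snd k\<bar> \<le> 3 * int N" by (simp_all only: of_int_le_iff)
          thus False using k by (cases k) (auto simp: fbox_def)
        qed
        hence "of_real (exp (- t)) * a k = 0" using symb[of k] by simp
        thus "a k = 0" by simp
      qed auto
      also have "\<dots> = A * (12 * (6 + 3 / real N)) * H" using N by (simp add: field_simps)
      also have "\<dots> \<le> A * 108 * H"
        using N P \<tau> H0 by (intro mult_right_mono mult_left_mono) (auto simp: A_def field_simps)
      also have "\<dots> \<le> (18 + 432 * P) / (1 + t * 4 ^ n) * H"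
      proof (intro mult_right_mono H0)
        have "t * 4 ^ n = 4 * \<tau>"
          by (simp add: \<tau>_def N_def Suc power2_eq_square flip: power_mult_distrib)
        moreover have "P * 108 / (1 + \<tau>) \<le> (432 * P) / (1 + 4 * \<tau>)"
          using P \<tau> by (simp add: field_simps)
        moreover have "\<dots> \<le> (18 + 432 * P) / (1 + 4 * \<tau>)"
          using \<tau> by (intro divide_right_mono) auto
        ultimately show "A * 108 \<le> (18 + 432 * P) / (1 + t * 4 ^ n)" by (simp add: A_def)
      qed
      finally have *: "norm (\<Sum>k\<in>fbox D. a k * c k * ch k x) \<le> (18 + 432 * P) / (1 + t * 4 ^ n) * H" .
      have "(\<Sum>k\<in>fbox D. of_real (wt n k) * sg_symbol \<mu> t k * c k * ch k x)
         = of_real (exp (- t)) * (\<Sum>k\<in>fbox D. a k * c k * ch k x)"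
        by (simp add: symb sum_distrib_left mult.assoc)
      hence "norm (\<Sum>k\<in>fbox D. of_real (wt n k) * sg_symbol \<mu> t k * c k * ch k x)
          \<le> 1 * norm (\<Sum>k\<in>fbox D. a k * c k * ch k x)"
        using t by (simp only: norm_mult, intro mult_right_mono) auto
      thus ?thesis using * by simp
    qed
  qed
qed

end

section \<open>Norm bounds and smoothing\<close>

lemma two_powr_nat: "2 powr (- (a * real n)) = (2 powr (- a)) ^ n"
  by (simp add: powr_realpow[symmetric] powr_powr)

text \<open>Interpolates between the bounds \<open>1\<close> and \<open>1 / x\<close>; the parameter
  \<open>\<theta>\<close> becomes the amount of smoothing in \<open>bnd_semigroup\<close>.\<close>

lemma inverse_one_plus_le_powr:
  fixes x :: real assumes "x > 0" "0 \<le> \<theta>" "\<theta> \<le> 1"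
  shows "1 / (1 + x) \<le> x powr (- \<theta>)"
proof -
  have "x powr \<theta> \<le> 1 + x"
  proof (cases "x \<le> 1")
    case True
    hence "x powr \<theta> \<le> 1" using assms by (intro powr_le1) auto
    thus ?thesis using assms by simp
  next
    case False
    hence "x powr \<theta> \<le> x powr 1" using assms by (intro powr_mono) auto
    thus ?thesis using assms by simp
  qed
  thus ?thesis using assms by (simp add: powr_minus field_simps)
qed

text \<open>Truncated subtraction makes this \<open>{0, 1}\<close> for \<open>n = 0\<close>.\<close>

definition nbh :: "nat \<Rightarrow> nat set" where
  "nbh n = {n - 1..n + 1}"

lemma finite_nbh [simp]: "finite (nbh n)"
  by (simp add: nbh_def)

context dyadic
begin

definition blk :: "nat \<Rightarrow> distr \<Rightarrow> real \<times> real \<Rightarrow> complex" where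
  "blk n f = lp_block chi rho (int n - 1) f"

text \<open>A bound on the Besov norm, up to the factor \<open>2 powr a\<close> of the index shift, which implies
  membership in the space and thereby avoids the junk values of unbounded suprema.\<close>

definition bnd :: "real \<Rightarrow> real \<Rightarrow> distr \<Rightarrow> bool" where
  "bnd a C f \<longleftrightarrow> (\<forall>n x. norm (blk n f x) \<le> C * 2 powr (- (a * real n)))"

lemma finite_lp_box [simp]: "finite (lp_box j)"
  by (simp add: lp_box_def Let_def)

text \<open>\<open>3 * 2 powr (n - 1)\<close> exceeds \<open>4/3 * 2 ^ n\<close>, so
  \<open>lp_box\<close> cuts nothing off a block, and the box can be exchanged for any finite set
  that contains the support of the weight.\<close>

lemma lp_box_supp:
  assumes "wt n k \<noteq> 0" shows "k \<in> lp_box (int n - 1)"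
proof -
  define B :: int where "B = \<lceil>3 * (2::real) powr of_int (int n - 1)\<rceil>"
  have "4/3 * 2 ^ n \<le> 3 * (2::real) powr of_int (int n - 1)"
    by (simp add: powr_diff powr_realpow)
  also have "\<dots> \<le> of_int B" by (simp add: B_def)
  finally have "norm (freq k) \<le> of_int B" using wt_upper[OF assms] by linarith
  hence "real_of_int \<bar>fst k\<bar> \<le> of_int B" "real_of_int \<bar>snd k\<bar> \<le> of_int B"
    using freq_abs_le[of k] by auto
  hence "\<bar>fst k\<bar> \<le> B" "\<bar>snd k\<bar> \<le> B" by (simp_all only: of_int_le_iff)
  hence "k \<in> fbox B" by (cases k) (auto simp: fbox_def)
  thus ?thesis by (simp only: lp_box_def fbox_def B_def Let_def)
qed

lemma blk_lp_box: "blk n f x = (\<Sum>k\<in>lp_box (int n - 1). of_real (wt n k) * f k * ch k x)"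
  by (simp add: blk_def lp_block_def wt_def ch_def freq_def)

lemma blk_eq_on:
  assumes "finite S" "\<And>k. wt n k \<noteq> 0 \<Longrightarrow> k \<in> S"
  shows "blk n f x = (\<Sum>k\<in>S. of_real (wt n k) * f k * ch k x)"
  unfolding blk_lp_box using assms lp_box_supp
  by (intro sum.mono_neutral_cong) auto

lemma blk_eq: "2 ^ Suc n \<le> D \<Longrightarrow> blk n f x = (\<Sum>k\<in>fbox D. of_real (wt n k) * f k * ch k x)"
  by (intro blk_eq_on wt_fbox) auto

lemma blk_add: "blk n (\<lambda>k. f k + g k) x = blk n f x + blk n g x"
  by (simp add: blk_lp_box sum.distrib algebra_simps)

lemma blk_diff: "blk n (\<lambda>k. f k - g k) x = blk n f x - blk n g x"
  by (simp add: blk_lp_box sum_subtractf algebra_simps)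

lemma blk_scale: "blk n (\<lambda>k. c * f k) x = c * blk n f x"
  by (simp add: blk_lp_box sum_distrib_left mult_ac)

lemma blk_sum: "blk n (\<lambda>k. \<Sum>i\<in>I. f i k) x = (\<Sum>i\<in>I. blk n (f i) x)"
  by (simp add: blk_lp_box sum_distrib_left sum_distrib_right sum.swap[of _ I])

lemma bndD: "bnd a C f \<Longrightarrow> norm (blk n f x) \<le> C * 2 powr (- (a * real n))"
  unfolding bnd_def by blast

lemma bnd_nonneg: "bnd a C f \<Longrightarrow> C \<ge> 0"
  using order.trans[OF norm_ge_zero bndD[of a C f 0]] by simp

lemma bnd_zero: "C \<ge> 0 \<Longrightarrow> bnd a C (\<lambda>_. 0)"
  by (simp add: bnd_def blk_lp_box)

lemma bnd_mono: "bnd a C f \<Longrightarrow> C \<le> C' \<Longrightarrow> bnd a C' f"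
  unfolding bnd_def by (meson mult_right_mono order.trans powr_ge_zero)

lemma bnd_weaken:
  assumes f: "bnd a C f" and "b \<le> a" shows "bnd b C f"
  unfolding bnd_def
proof (intro allI)
  fix n x
  have "C * 2 powr (- (a * real n)) \<le> C * 2 powr (- (b * real n))"
    using assms(2) bnd_nonneg[OF f] by (intro mult_left_mono powr_mono) (auto intro: mult_right_mono)
  thus "norm (blk n f x) \<le> C * 2 powr (- (b * real n))" using bndD[OF f, of n x] by linarith
qed

lemma bnd_add: "bnd a C f \<Longrightarrow> bnd a C' g \<Longrightarrow> bnd a (C + C') (\<lambda>k. f k + g k)"
  unfolding bnd_def blk_add distrib_right by (meson norm_triangle_mono)

lemma bnd_diff: "bnd a C f \<Longrightarrow> bnd a C' g \<Longrightarrow> bnd a (C + C') (\<lambda>k. f k - g k)"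
  unfolding bnd_def blk_diff distrib_right
  by (meson add_mono norm_triangle_ineq4 order.trans)

lemma bnd_scale: "bnd a C f \<Longrightarrow> bnd a (norm c * C) (\<lambda>k. c * f k)"
  unfolding bnd_def blk_scale norm_mult mult.assoc by (meson mult_left_mono norm_ge_zero)

lemma ex_wt_nonzero: "\<exists>n. wt n k \<noteq> 0"
proof (rule ccontr)
  assume "\<nexists>n. wt n k \<noteq> 0"
  hence "(\<lambda>n. 0::real) sums 1" using wt_sums[of k] by simp
  thus False using sums_unique2[OF sums_zero] by fastforce
qed

text \<open>A frequency may be shared between blocks, so \<open>trig_coeff_bound\<close> controls
  the weighted coefficient only.\<close>

lemma blk_coeff_bound:
  assumes "\<And>x. norm (blk n f x) \<le> H" shows "wt n k * norm (f k) \<le> H"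
proof (cases "wt n k = 0")
  case True
  thus ?thesis using order.trans[OF norm_ge_zero assms] by simp
next
  case False
  have "k \<in> fbox (2 ^ Suc n)" by (rule wt_fbox[OF False]) simp
  hence "norm (of_real (wt n k) * f k) \<le> H"
    using assms by (intro trig_coeff_bound[where D = "2 ^ Suc n" and c = "\<lambda>k. of_real (wt n k) * f k"])
      (simp_all only: blk_eq[OF order.refl])
  thus ?thesis using wt_nonneg[of n k] by (simp add: norm_mult)
qed

text \<open>Some weight is positive at \<open>k\<close>. The constant depends on \<open>k\<close>
  and \<open>a\<close> only, so norm bounds turn into coefficientwise continuity and
  convergence.\<close>

lemma bnd_coeff: "\<exists>B\<ge>0. \<forall>C f. bnd a C f \<longrightarrow> norm (f k) \<le> B * C"
proof -
  obtain n where n: "wt n k \<noteq> 0" using ex_wt_nonzero by blast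
  hence pos: "wt n k > 0" using wt_nonneg[of n k] by simp
  have "norm (f k) \<le> 2 powr (- (a * real n)) / wt n k * C" if "bnd a C f" for C f
    using blk_coeff_bound[OF bndD[OF that], of n k] pos by (simp add: field_simps)
  thus ?thesis using pos by (intro exI[of _ "2 powr (- (a * real n)) / wt n k"]) auto
qed

lemma bnd_all_imp_zero:
  assumes "\<And>\<epsilon>. \<epsilon> > 0 \<Longrightarrow> bnd a \<epsilon> f" shows "f k = 0"
proof -
  obtain B where B: "B \<ge> 0" "\<And>C f. bnd a C f \<Longrightarrow> norm (f k) \<le> B * C" using bnd_coeff by metis
  have "norm (f k) \<le> 0 + e" if "e > 0" for e
  proof -
    have "bnd a (e / (B + 1)) f" using B(1) that by (intro assms) simp
    hence "norm (f k) \<le> B * (e / (B + 1))" by (rule B(2))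
    also have "\<dots> \<le> e" using B(1) that by (simp add: field_simps)
    finally show ?thesis by simp
  qed
  hence "norm (f k) \<le> 0" by (rule field_le_epsilon)
  thus ?thesis by simp
qed

lemma blk_tendsto:
  assumes "\<And>k. ((\<lambda>i. f i k) \<longlongrightarrow> g k) F"
  shows "((\<lambda>i. blk n (f i) x) \<longlongrightarrow> blk n g x) F"
  unfolding blk_lp_box by (intro tendsto_intros assms)

text \<open>A Fatou property: a block is a finite sum of coefficients, so it converges pointwise and
  its bound survives.\<close>

lemma bnd_limit:
  assumes f: "\<And>k. (\<lambda>i. f i k) \<longlonglongrightarrow> g k" and C: "\<And>i. i \<ge> i0 \<Longrightarrow> bnd a C (f i)"
  shows "bnd a C g"
  unfolding bnd_def
proof (intro allI)
  fix n x
  have "(\<lambda>i. norm (blk n (f i) x)) \<longlonglongrightarrow> norm (blk n g x)"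
    by (intro tendsto_norm blk_tendsto f)
  thus "norm (blk n g x) \<le> C * 2 powr (- (a * real n))"
    by (rule Lim_bounded[of _ _ i0]) (use C bndD in blast)
qed

lemma lp_block_bdd: "bdd_above (range (\<lambda>x. norm (lp_block chi rho j f x)))"
proof -
  have "norm (lp_block chi rho j f x) \<le> (\<Sum>k\<in>lp_box j. norm (of_real (lp_weight chi rho j k) * f k))" for x
    unfolding lp_block_def by (rule sum_norm_le) (simp add: norm_mult)
  thus ?thesis by (intro bdd_aboveI2)
qed

lemma sup_norm_nonneg: "0 \<le> sup_norm (lp_block chi rho j f)"
  unfolding sup_norm_def by (rule cSUP_upper2[OF lp_block_bdd UNIV_I]) simp

lemma besov_norm_nonneg:
  assumes "in_besov chi rho \<alpha> f" shows "0 \<le> besov_norm chi rho \<alpha> f"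
  using assms unfolding besov_norm_def in_besov_def
  by (intro cSUP_upper2[of _ _ "-1"]) (auto simp: sup_norm_nonneg)

lemma besov_bnd:
  assumes f: "in_besov chi rho \<alpha> f" and C: "besov_norm chi rho \<alpha> f \<le> C"
  shows "bnd \<alpha> (2 powr \<alpha> * C) f"
  unfolding bnd_def
proof (intro allI)
  fix n x
  define j where "j = int n - 1"
  have s: "norm (blk n f x) \<le> sup_norm (lp_block chi rho j f)"
    unfolding sup_norm_def blk_def j_def by (intro cSUP_upper lp_block_bdd) auto
  have "2 powr (of_int j * \<alpha>) * sup_norm (lp_block chi rho j f) \<le> besov_norm chi rho \<alpha> f"
    using f unfolding besov_norm_def in_besov_def
    by (intro cSUP_upper[of j "{-1..}" "\<lambda>j. 2 powr (of_int j * \<alpha>) * sup_norm (lp_block chi rho j f)"])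
       (auto simp: j_def)
  hence "2 powr (of_int j * \<alpha>) * sup_norm (lp_block chi rho j f) \<le> C" using C by linarith
  moreover have "2 powr (of_int j * \<alpha>) * norm (blk n f x)
      \<le> 2 powr (of_int j * \<alpha>) * sup_norm (lp_block chi rho j f)"
    by (rule mult_left_mono[OF s]) simp
  ultimately have "2 powr (of_int j * \<alpha>) * norm (blk n f x) \<le> C" by linarith
  hence "norm (blk n f x) \<le> C / 2 powr (of_int j * \<alpha>)" by (simp add: field_simps)
  also have "\<dots> = 2 powr \<alpha> * C * 2 powr (- (\<alpha> * real n))"
    by (simp add: j_def powr_diff powr_minus left_diff_distrib mult.commute field_simps)
  finally show "norm (blk n f x) \<le> 2 powr \<alpha> * C * 2 powr (- (\<alpha> * real n))" .
qed

lemma bnd_besov: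
  assumes f: "bnd \<alpha> C f"
  shows "in_besov chi rho \<alpha> f" "besov_norm chi rho \<alpha> f \<le> 2 powr (- \<alpha>) * C"
proof -
  have *: "2 powr (of_int j * \<alpha>) * sup_norm (lp_block chi rho j f) \<le> 2 powr (- \<alpha>) * C" if "j \<ge> -1" for j
  proof -
    define n where "n = nat (j + 1)"
    have j: "j = int n - 1" using that by (simp add: n_def)
    have "sup_norm (lp_block chi rho j f) \<le> C * 2 powr (- (\<alpha> * real n))"
      unfolding sup_norm_def using bndD[OF f, of n] by (intro cSUP_least) (auto simp: j blk_def)
    hence "2 powr (of_int j * \<alpha>) * sup_norm (lp_block chi rho j f)
       \<le> 2 powr (of_int j * \<alpha>) * (C * 2 powr (- (\<alpha> * real n)))" by (intro mult_left_mono) auto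
    also have "\<dots> = 2 powr (- \<alpha>) * C"
      by (simp add: j powr_diff powr_minus left_diff_distrib mult.commute field_simps)
    finally show ?thesis .
  qed
  thus "in_besov chi rho \<alpha> f" unfolding in_besov_def by (intro bdd_aboveI2) auto
  show "besov_norm chi rho \<alpha> f \<le> 2 powr (- \<alpha>) * C"
    unfolding besov_norm_def using * by (intro cSUP_least) auto
qed

section \<open>Overlap of neighbouring blocks\<close>

lemma wt_near:
  assumes "wt n k \<noteq> 0" "wt m l \<noteq> 0" "norm (freq k) = norm (freq l)"
  shows "m \<le> n + 1"
proof (cases "m = 0")
  case False
  hence "3/8 * 2 ^ m \<le> (4/3 * 2 ^ n :: real)"
    using wt_lower[OF assms(2)] wt_upper[OF assms(1)] assms(3) by simp
  hence "(2::real) ^ m < 2 ^ (n + 2)" by (simp add: power_add) (use zero_less_power[of "2::real" n] in linarith)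
  hence "m < n + 2" by (rule power_less_imp_less_exp[rotated]) simp
  thus ?thesis by simp
qed simp

text \<open>Weights with index outside \<open>nbh n\<close> vanish at such frequencies, so the
  partition of unity reduces to a finite sum. Asking only for equal lengths covers
  \<open>l = - k\<close>, as conjugation requires.\<close>

lemma local_partition:
  assumes "wt n k \<noteq> 0" "norm (freq k) = norm (freq l)"
  shows "(\<Sum>m\<in>nbh n. wt m l) = 1"
proof -
  have "wt m l = 0" if "m \<notin> nbh n" for m
    using wt_near[OF assms(1) _ assms(2), of m] wt_near[OF _ assms(1), of m l] assms(2) that by (fastforce simp: nbh_def)
  hence "(\<lambda>m. wt m l) sums (\<Sum>m\<in>nbh n. wt m l)" by (intro sums_finite) auto
  thus ?thesis using wt_sums sums_unique2 by blast
qed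

end

text \<open>Gives a name to the constant obtained in \<open>multiplier_semigroup\<close>, so that
  later constants can be written in terms of it.\<close>

locale dyadic_heat = dyadic +
  fixes \<mu> CM :: real
  assumes CM: "CM > 0"
    and multiplier: "\<And>n t c D H x. 0 \<le> t \<Longrightarrow> t \<le> 1 \<Longrightarrow> (\<And>x. norm (\<Sum>k\<in>fbox D. c k * ch k x) \<le> H) \<Longrightarrow>
       norm (\<Sum>k\<in>fbox D. of_real (wt n k) * sg_symbol \<mu> t k * c k * ch k x) \<le> CM / (1 + t * 4 ^ n) * H"
begin

lemma sg_symbol_0 [simp]: "sg_symbol \<mu> 0 k = 1"
  by (simp add: sg_symbol_def)

lemma multiplier_0:
  assumes "\<And>x. norm (\<Sum>k\<in>fbox D. c k * ch k x) \<le> H"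
  shows "norm (\<Sum>k\<in>fbox D. of_real (wt n k) * c k * ch k x) \<le> CM * H"
  using multiplier[where t = 0, OF _ _ assms, of n x] by simp

text \<open>On the support of block \<open>n\<close> the function is a sum of at most three
  neighbouring pieces, and the multiplier bound applies to each. The pieces are cut out by a general
  \<open>v\<close> because conjugation brings in the reflected weights.\<close>

lemma semigroup_localized:
  fixes v :: "nat \<Rightarrow> int \<times> int \<Rightarrow> real"
  assumes t: "0 \<le> t" "t \<le> 1"
    and v: "\<And>k. wt n k \<noteq> 0 \<Longrightarrow> (\<Sum>m\<in>nbh n. v m k) = 1"
    and H: "\<And>m x. m \<in> nbh n \<Longrightarrow> norm (\<Sum>k\<in>fbox D. (of_real (v m k) * f k) * ch k x) \<le> H"
  shows "norm (\<Sum>k\<in>fbox D. of_real (wt n k) * (sg_symbol \<mu> t k * f k) * ch k x) \<le> 3 * CM / (1 + t * 4 ^ n) * H"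
proof -
  have H0: "H \<ge> 0" using order.trans[OF norm_ge_zero H[of n]] by (simp add: nbh_def)
  have *: "of_real (wt n k) = of_real (wt n k) * (\<Sum>m\<in>nbh n. of_real (v m k) :: complex)" for k
    using v[of k] by (cases "wt n k = 0") (simp_all flip: of_real_sum)
  have "(\<Sum>k\<in>fbox D. of_real (wt n k) * (sg_symbol \<mu> t k * f k) * ch k x)
     = (\<Sum>m\<in>nbh n. \<Sum>k\<in>fbox D. of_real (wt n k) * sg_symbol \<mu> t k * (of_real (v m k) * f k) * ch k x)"
    by (subst *) (simp add: sum_distrib_left sum_distrib_right sum.swap[of _ _ "fbox D"] mult_ac)
  also have "norm \<dots> \<le> (\<Sum>m\<in>nbh n. CM / (1 + t * 4 ^ n) * H)"
    using H by (intro sum_norm_le multiplier t)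
  also have "\<dots> \<le> 3 * (CM / (1 + t * 4 ^ n) * H)"
  proof -
    have "real (card (nbh n)) \<le> 3" by (simp add: nbh_def)
    thus ?thesis using H0 CM t by (simp only: sum_constant, intro mult_right_mono) auto
  qed
  finally show ?thesis by simp
qed

lemma near_power:
  assumes "m \<in> nbh n" shows "2 powr (- (b * real m)) \<le> 2 powr \<bar>b\<bar> * 2 powr (- (b * real n))"
proof -
  have "\<bar>real n - real m\<bar> \<le> 1" using assms by (auto simp: nbh_def)
  hence "\<bar>b\<bar> * \<bar>real n - real m\<bar> \<le> \<bar>b\<bar> * 1" by (intro mult_left_mono) auto
  moreover have "b * (real n - real m) \<le> \<bar>b\<bar> * \<bar>real n - real m\<bar>"
    by (simp flip: abs_mult)
  ultimately have "- (b * real m) \<le> \<bar>b\<bar> + - (b * real n)"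
    by (simp add: right_diff_distrib)
  thus ?thesis unfolding powr_add[symmetric] by (intro powr_mono) auto
qed

lemma bnd_semigroup_blk:
  assumes f: "bnd b F f" and t: "0 \<le> t" "t \<le> 1"
  shows "norm (blk n (\<lambda>k. sg_symbol \<mu> t k * f k) x)
      \<le> 3 * CM * 2 powr \<bar>b\<bar> * F / (1 + t * 4 ^ n) * 2 powr (- (b * real n))"
proof -
  define D :: int where "D = 2 ^ Suc (n + 1)"
  have D: "2 ^ Suc m \<le> D" if "m \<le> n + 1" for m
    unfolding D_def using that by (intro power_increasing) auto
  have "norm (\<Sum>k\<in>fbox D. of_real (wt n k) * (sg_symbol \<mu> t k * f k) * ch k x)
     \<le> 3 * CM / (1 + t * 4 ^ n) * (F * (2 powr \<bar>b\<bar> * 2 powr (- (b * real n))))"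
  proof (rule semigroup_localized[OF t, of n wt])
    fix m x assume m: "m \<in> nbh n"
    have "norm (blk m f x) \<le> F * (2 powr \<bar>b\<bar> * 2 powr (- (b * real n)))"
      by (rule order.trans[OF bndD[OF f] mult_left_mono[OF near_power[OF m] bnd_nonneg[OF f]]])
    thus "norm (\<Sum>k\<in>fbox D. of_real (wt m k) * f k * ch k x) \<le> F * (2 powr \<bar>b\<bar> * 2 powr (- (b * real n)))"
      using m by (subst (asm) blk_eq[OF D]) (auto simp: nbh_def)
  qed (simp add: local_partition)
  thus ?thesis by (subst blk_eq[OF D]) (simp_all add: mult_ac)
qed

text \<open>Trades the factor \<open>1 / (1 + t * 4 ^ n)\<close> for
  \<open>(t * 4 ^ n) powr (- \<theta>)\<close>; the part in \<open>n\<close> is the decay of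
  \<open>2 * \<theta>\<close> derivatives.\<close>

lemma bnd_semigroup:
  assumes f: "bnd b F f" and t: "0 < t" "t \<le> 1" and \<theta>: "0 \<le> \<theta>" "\<theta> \<le> 1"
  shows "bnd (b + 2 * \<theta>) (3 * CM * 2 powr \<bar>b\<bar> * F * t powr (- \<theta>)) (\<lambda>k. sg_symbol \<mu> t k * f k)"
  unfolding bnd_def
proof (intro allI)
  fix n x
  have "1 / (1 + t * 4 ^ n) \<le> (t * 4 ^ n) powr (- \<theta>)"
    using t \<theta> by (intro inverse_one_plus_le_powr) auto
  also have "\<dots> = t powr (- \<theta>) * 2 powr (- (2 * \<theta> * real n))"
  proof -
    have "(4::real) ^ n = 2 powr (2 * real n)"
      by (simp add: powr_realpow[symmetric] powr_powr[symmetric])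
    thus ?thesis using t by (simp add: powr_mult powr_powr mult_ac)
  qed
  finally have "3 * CM * 2 powr \<bar>b\<bar> * F * 2 powr (- (b * real n)) * (1 / (1 + t * 4 ^ n))
      \<le> 3 * CM * 2 powr \<bar>b\<bar> * F * 2 powr (- (b * real n)) * (t powr (- \<theta>) * 2 powr (- (2 * \<theta> * real n)))"
    using CM bnd_nonneg[OF f] by (intro mult_left_mono) auto
  also have "\<dots> = 3 * CM * 2 powr \<bar>b\<bar> * F * t powr (- \<theta>) * 2 powr (- ((b + 2 * \<theta>) * real n))"
    by (simp add: powr_add[symmetric] algebra_simps)
  finally show "norm (blk n (\<lambda>k. sg_symbol \<mu> t k * f k) x)
     \<le> 3 * CM * 2 powr \<bar>b\<bar> * F * t powr (- \<theta>) * 2 powr (- ((b + 2 * \<theta>) * real n))"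
    using bnd_semigroup_blk[OF f less_imp_le[OF t(1)] t(2), of n x] by simp
qed

text \<open>\<open>chi\<close> and \<open>rho\<close> are not assumed even, so the conjugate of a
  block of \<open>f\<close> is \<open>dconj f\<close> cut by reflected weights. These pieces are cut
  again by \<open>wt n\<close>, through \<open>semigroup_localized\<close> at time 0.\<close>

lemma bnd_dconj:
  assumes f: "bnd b F f" shows "bnd b (3 * CM * 2 powr \<bar>b\<bar> * F) (dconj f)"
  unfolding bnd_def
proof (intro allI)
  fix n x
  define D :: int where "D = 2 ^ Suc (n + 1)"
  have D: "2 ^ Suc m \<le> D" if "m \<le> n + 1" for m
    unfolding D_def using that by (intro power_increasing) auto
  have fneg: "norm (freq (- k)) = norm (freq k)" for k
  proof -
    have "freq (- k) = - freq k" by (simp add: freq_def)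
    thus ?thesis by simp
  qed
  have "norm (\<Sum>k\<in>fbox D. of_real (wt n k) * (sg_symbol \<mu> 0 k * dconj f k) * ch k x)
     \<le> 3 * CM / (1 + 0 * 4 ^ n) * (F * (2 powr \<bar>b\<bar> * 2 powr (- (b * real n))))"
  proof (rule semigroup_localized[of 0 n "\<lambda>m k. wt m (- k)"])
    fix m x assume m: "m \<in> nbh n"
    have "norm (blk m f x) \<le> F * (2 powr \<bar>b\<bar> * 2 powr (- (b * real n)))"
      by (rule order.trans[OF bndD[OF f] mult_left_mono[OF near_power[OF m] bnd_nonneg[OF f]]])
    moreover have "(\<Sum>k\<in>fbox D. of_real (wt m (- k)) * dconj f k * ch k x) = cnj (blk m f x)"
    proof -
      have "(\<Sum>k\<in>fbox D. of_real (wt m (- k)) * dconj f k * ch k x)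
         = (\<Sum>k\<in>fbox D. of_real (wt m k) * cnj (f k) * ch (- k) x)"
        by (intro sum.reindex_bij_witness[of _ uminus uminus]) (auto simp: fbox_def dconj_def)
      thus ?thesis using m by (subst blk_eq[OF D]) (auto simp: cnj_ch nbh_def)
    qed
    ultimately show "norm (\<Sum>k\<in>fbox D. of_real (wt m (- k)) * dconj f k * ch k x)
       \<le> F * (2 powr \<bar>b\<bar> * 2 powr (- (b * real n)))"
      by simp
  qed (simp_all add: local_partition fneg)
  thus "norm (blk n (dconj f) x) \<le> 3 * CM * 2 powr \<bar>b\<bar> * F * 2 powr (- (b * real n))"
    by (subst blk_eq[OF D]) (simp_all add: mult_ac)
qed

end

section \<open>Products\<close>

lemma geometric_sum_le:
  fixes r :: real assumes "0 \<le> r" "r < 1" "finite A"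
  shows "(\<Sum>i\<in>A. r ^ i) \<le> 1 / (1 - r)"
  using assms sum_le_suminf[of "\<lambda>i. r ^ i" A] by (simp add: suminf_geometric)

text \<open>Frequency bookkeeping of a paraproduct decomposition: whether blocks \<open>n\<close>
  and \<open>m\<close> of the factors can reach block \<open>l\<close> of the product. In the first
  case the left factor is dominant or comparable, in the second the right factor and the output are
  at comparable frequencies.\<close>

definition interacts :: "nat \<Rightarrow> nat \<Rightarrow> nat \<Rightarrow> bool" where
  "interacts l n m \<longleftrightarrow> (m \<le> n + 3 \<and> l \<le> n + 5) \<or> (l \<le> m + 2 \<and> m \<le> l + 2)"

text \<open>\<open>y = 2 powr (- b)\<close> lies below or above 1 according to the sign of
  \<open>b\<close>; \<open>max 1 y\<close> treats both, and \<open>y \<noteq> 1\<close> excludes the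
  linear growth at \<open>b = 0\<close>.\<close>

lemma sum_inner_geometric:
  fixes y :: real assumes y: "y > 0" "y \<noteq> 1"
  obtains C where "C > 0" "\<And>n. (\<Sum>m<n + 4. y ^ m) \<le> C * max 1 y ^ n"
proof (cases "y < 1")
  case True
  have "(\<Sum>m<n + 4. y ^ m) \<le> 1 / (1 - y) * max 1 y ^ n" for n
    using geometric_sum_le[of y "{..<n + 4}"] True y by (simp add: max_def)
  thus ?thesis using True by (intro that[of "1 / (1 - y)"]) auto
next
  case False
  have "(\<Sum>m<n + 4. y ^ m) \<le> y ^ 4 / (y - 1) * max 1 y ^ n" for n
    using False y by (simp add: geometric_sum max_def power_add divide_right_mono mult.commute)
  thus ?thesis using False y by (intro that[of "y ^ 4 / (y - 1)"]) auto
qed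

text \<open>If the second factor has the higher frequency, the output frequency is comparable to it;
  otherwise the output frequency is at most comparable to that of the first factor, whose
  positive regularity pays for the sum.\<close>

lemma interaction_sum:
  fixes x y :: real
  assumes x: "0 < x" "x < 1" and y: "x \<le> y" "y \<noteq> 1" and xy: "x * y < 1"
  obtains C where "C > 0"
    "\<And>l N. (\<Sum>n<N. \<Sum>m<N. if interacts l n m then x ^ n * y ^ m else 0) \<le> C * y ^ l"
proof -
  have y0: "y > 0" using x y by simp
  define z where "z = max 1 y"
  \<comment> \<open>The decay in \<open>n\<close> that is left after the inner sum. For either sign
    of the regularity \<open>w \<le> y\<close>, which converts the tail \<open>w ^ l\<close> into
    the \<open>y ^ l\<close> of the claim.\<close>
  define w where "w = x * z"
  have w: "0 < w" "w < 1" "w \<le> y"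
    using x y xy by (auto simp: w_def z_def max_def)
  obtain C1 where C1: "C1 > 0" "\<And>n. (\<Sum>m<n + 4. y ^ m) \<le> C1 * z ^ n"
    by (rule sum_inner_geometric[OF y0 y(2)]) (rule that, assumption, simp only: z_def)
  define B where "B = max y (1 / y)"
  have B: "B \<ge> 1" using y0 by (cases "y \<ge> 1") (auto simp: B_def le_max_iff_disj)
  have yB: "y ^ m \<le> B\<^sup>2 * y ^ l" if "l \<le> m + 2" "m \<le> l + 2" for m l
  proof (cases "l \<le> m")
    case True
    define i where "i = m - l"
    have i: "m = l + i" "i \<le> 2" using True that by (auto simp: i_def)
    have "y ^ i \<le> B ^ i" using y0 by (intro power_mono) (auto simp: B_def)
    also have "\<dots> \<le> B\<^sup>2" using B i by (intro power_increasing) auto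
    finally show ?thesis using y0 by (simp add: i power_add)
  next
    case False
    define i where "i = l - m"
    have i: "l = m + i" "i \<le> 2" using False that by (auto simp: i_def)
    have "(1 / y) ^ i \<le> B ^ i" using y0 by (intro power_mono) (auto simp: B_def)
    also have "\<dots> \<le> B\<^sup>2" using B i by (intro power_increasing) auto
    finally have "1 \<le> B\<^sup>2 * y ^ i" using y0 by (simp add: field_simps)
    hence "y ^ m * 1 \<le> y ^ m * (B\<^sup>2 * y ^ i)" using y0 by (intro mult_left_mono) auto
    thus ?thesis by (simp add: i power_add mult_ac)
  qed
  \<comment> \<open>First term: the geometric tail over \<open>l \<le> n + 5\<close>, normalised by
    \<open>w ^ 5\<close>. Second term: at most five indices \<open>m\<close> lie within 2 of
    \<open>l\<close>, each with \<open>y ^ m \<le> B^2 * y ^ l\<close>.\<close>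
  define C where "C = C1 / (w ^ 5 * (1 - w)) + 1 / (1 - x) * (5 * B\<^sup>2)"
  show ?thesis
  proof (rule that[of C])
    have "C1 / (w ^ 5 * (1 - w)) > 0" using C1 w by simp
    moreover have "1 / (1 - x) * (5 * B\<^sup>2) > 0" using x B by simp
    ultimately show "C > 0" unfolding C_def by (rule add_pos_pos)
    fix l N :: nat
    have "(\<Sum>n<N. \<Sum>m<N. if interacts l n m then x ^ n * y ^ m else 0)
      \<le> (\<Sum>n<N. (if l \<le> n + 5 then x ^ n * (\<Sum>m<n + 4. y ^ m) else 0)
                + x ^ n * (5 * B\<^sup>2 * y ^ l))"
    proof (intro sum_mono)
      fix n
      have "(\<Sum>m<N. if interacts l n m then x ^ n * y ^ m else 0)
        \<le> (\<Sum>m<N. (if m < n + 4 \<and> l \<le> n + 5 then x ^ n * y ^ m else 0)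
                 + (if l \<le> m + 2 \<and> m \<le> l + 2 then x ^ n * (B\<^sup>2 * y ^ l) else 0))"
      proof (intro sum_mono)
        fix m
        have "0 \<le> x ^ n * y ^ m" "0 \<le> x ^ n * (B\<^sup>2 * y ^ l)" using x y0 by auto
        moreover have "l \<le> m + 2 \<and> m \<le> l + 2 \<Longrightarrow> x ^ n * y ^ m \<le> x ^ n * (B\<^sup>2 * y ^ l)"
          using x yB[of l m] by (intro mult_left_mono) auto
        ultimately show "(if interacts l n m then x ^ n * y ^ m else 0)
          \<le> (if m < n + 4 \<and> l \<le> n + 5 then x ^ n * y ^ m else 0)
                 + (if l \<le> m + 2 \<and> m \<le> l + 2 then x ^ n * (B\<^sup>2 * y ^ l) else 0)"
          by (auto simp: interacts_def)
      qed
      also have "\<dots> = (\<Sum>m<N. if m < n + 4 \<and> l \<le> n + 5 then x ^ n * y ^ m else 0)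
          + (\<Sum>m<N. if l \<le> m + 2 \<and> m \<le> l + 2 then x ^ n * (B\<^sup>2 * y ^ l) else 0)"
        by (rule sum.distrib)
      also have "(\<Sum>m<N. if m < n + 4 \<and> l \<le> n + 5 then x ^ n * y ^ m else 0)
          \<le> (if l \<le> n + 5 then x ^ n * (\<Sum>m<n + 4. y ^ m) else 0)"
      proof (cases "l \<le> n + 5")
        case True
        have "(\<Sum>m<N. if m < n + 4 \<and> l \<le> n + 5 then x ^ n * y ^ m else 0)
            = (\<Sum>m\<in>{..<N} \<inter> {..<n + 4}. x ^ n * y ^ m)"
          using True by (simp add: sum.If_cases lessThan_def)
        also have "\<dots> \<le> (\<Sum>m<n + 4. x ^ n * y ^ m)" using x y0 by (intro sum_mono2) auto
        finally show ?thesis using True by (simp only: sum_distrib_left if_True)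
      qed auto
      also have "(\<Sum>m<N. if l \<le> m + 2 \<and> m \<le> l + 2 then x ^ n * (B\<^sup>2 * y ^ l) else 0)
          \<le> x ^ n * (5 * B\<^sup>2 * y ^ l)"
      proof -
        have "(\<Sum>m<N. if l \<le> m + 2 \<and> m \<le> l + 2 then x ^ n * (B\<^sup>2 * y ^ l) else 0)
           = real (card ({..<N} \<inter> {m. l \<le> m + 2 \<and> m \<le> l + 2})) * (x ^ n * (B\<^sup>2 * y ^ l))"
          by (simp add: sum.If_cases)
        also have "card ({..<N} \<inter> {m. l \<le> m + 2 \<and> m \<le> l + 2}) \<le> card {l - 2..l + 2}"
          by (intro card_mono) auto
        also have "\<dots> \<le> 5" by simp
        finally show ?thesis using x y0 by (simp add: mult_right_mono mult.left_commute)
      qed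
      finally show "(\<Sum>m<N. if interacts l n m then x ^ n * y ^ m else 0)
        \<le> (if l \<le> n + 5 then x ^ n * (\<Sum>m<n + 4. y ^ m) else 0) + x ^ n * (5 * B\<^sup>2 * y ^ l)"
        by simp
    qed
    also have "\<dots> = (\<Sum>n<N. if l \<le> n + 5 then x ^ n * (\<Sum>m<n + 4. y ^ m) else 0)
        + (\<Sum>n<N. x ^ n) * (5 * B\<^sup>2 * y ^ l)"
      by (simp add: sum.distrib sum_distrib_right)
    also have "(\<Sum>n<N. x ^ n) * (5 * B\<^sup>2 * y ^ l) \<le> 1 / (1 - x) * (5 * B\<^sup>2 * y ^ l)"
      using x y0 by (intro mult_right_mono geometric_sum_le) auto
    also have "(\<Sum>n<N. if l \<le> n + 5 then x ^ n * (\<Sum>m<n + 4. y ^ m) else 0)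
       \<le> (\<Sum>n<N. if l \<le> n + 5 then C1 / w ^ 5 * w ^ (n + 5) else 0)"
    proof (intro sum_mono)
      fix n
      have "x ^ n * (\<Sum>m<n + 4. y ^ m) \<le> x ^ n * (C1 * z ^ n)"
        using C1 x by (intro mult_left_mono) auto
      also have "\<dots> = C1 / w ^ 5 * w ^ (n + 5)"
        using x w by (simp add: power_mult_distrib power_add) (simp add: w_def power_mult_distrib)
      finally show "(if l \<le> n + 5 then x ^ n * (\<Sum>m<n + 4. y ^ m) else 0)
        \<le> (if l \<le> n + 5 then C1 / w ^ 5 * w ^ (n + 5) else 0)" by simp
    qed
    also have "\<dots> = C1 / w ^ 5 * (\<Sum>n\<in>{n\<in>{..<N}. l \<le> n + 5}. w ^ (n + 5))"
      by (simp add: sum_distrib_left sum.If_cases Int_def)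
    also have "(\<Sum>n\<in>{n\<in>{..<N}. l \<le> n + 5}. w ^ (n + 5)) = (\<Sum>n\<in>{n\<in>{..<N}. l \<le> n + 5}. w ^ l * w ^ (n + 5 - l))"
      by (intro sum.cong) (auto simp flip: power_add)
    also have "\<dots> = w ^ l * (\<Sum>i\<in>(\<lambda>n. n + 5 - l) ` {n\<in>{..<N}. l \<le> n + 5}. w ^ i)"
      by (subst sum.reindex) (auto simp: inj_on_def sum_distrib_left)
    also have "\<dots> \<le> w ^ l * (1 / (1 - w))"
      using w by (intro mult_left_mono geometric_sum_le) auto
    also have "\<dots> \<le> y ^ l * (1 / (1 - w))"
      using w by (intro mult_right_mono power_mono) auto
    finally have "(\<Sum>n<N. \<Sum>m<N. if interacts l n m then x ^ n * y ^ m else 0)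
      \<le> C1 / w ^ 5 * (y ^ l * (1 / (1 - w))) + 1 / (1 - x) * (5 * B\<^sup>2 * y ^ l)"
      by this (use C1 w in \<open>auto intro!: mult_left_mono divide_right_mono\<close>)
    also have "\<dots> = C * y ^ l" by (simp add: C_def algebra_simps)
    finally show "(\<Sum>n<N. \<Sum>m<N. if interacts l n m then x ^ n * y ^ m else 0) \<le> C * y ^ l" .
  qed
qed

lemma filterlim_square_boxes:
  "filterlim (\<lambda>N. {..<N} \<times> {..<N :: nat}) (finite_subsets_at_top UNIV) sequentially"
  unfolding filterlim_finite_subsets_at_top
proof (intro allI impI)
  fix X :: "(nat \<times> nat) set" assume X: "finite X \<and> X \<subseteq> UNIV"
  have "finite (fst ` X \<union> snd ` X)" using X by simp
  then obtain M where M: "\<And>i. i \<in> fst ` X \<union> snd ` X \<Longrightarrow> i < M"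
    by (metis finite_nat_set_iff_bounded)
  have "X \<subseteq> {..<N} \<times> {..<N}" if "N \<ge> M" for N
    using M that by (force intro: less_le_trans)
  thus "\<forall>\<^sub>F N in sequentially. finite ({..<N} \<times> {..<N}) \<and> X \<subseteq> {..<N} \<times> {..<N} \<and> {..<N} \<times> {..<N} \<subseteq> UNIV"
    by (auto simp: eventually_sequentially intro!: exI[of _ M])
qed

text \<open>Squares eventually contain every finite set of indices, so bounded absolute sums over
  squares give unconditional summability, whose sum is the limit along squares.\<close>

lemma convergent_double_sum:
  fixes f :: "nat \<Rightarrow> nat \<Rightarrow> complex"
  assumes "\<And>N. (\<Sum>n<N. \<Sum>m<N. norm (f n m)) \<le> B"
  shows "convergent (\<lambda>N. \<Sum>n<N. \<Sum>m<N. f n m)"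
proof -
  define g where "g = (\<lambda>(n, m). f n m)"
  have "(\<lambda>p. norm (g p)) summable_on UNIV"
  proof (rule nonneg_bdd_above_summable_on)
    show "bdd_above (sum (\<lambda>p. norm (g p)) ` {F. F \<subseteq> UNIV \<and> finite F})"
    proof (intro bdd_aboveI2)
      fix F :: "(nat \<times> nat) set" assume F: "F \<in> {F. F \<subseteq> UNIV \<and> finite F}"
      hence "\<forall>\<^sub>F N in sequentially. F \<subseteq> {..<N} \<times> {..<N}"
        using filterlim_square_boxes unfolding filterlim_finite_subsets_at_top
        by (auto elim!: allE[of _ F] elim: eventually_mono)
      then obtain N where "F \<subseteq> {..<N} \<times> {..<N}" by (auto simp: eventually_sequentially)
      hence "(\<Sum>p\<in>F. norm (g p)) \<le> (\<Sum>p\<in>{..<N} \<times> {..<N}. norm (g p))" by (intro sum_mono2) auto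
      also have "\<dots> = (\<Sum>n<N. \<Sum>m<N. norm (f n m))"
        by (simp add: sum.cartesian_product g_def case_prod_beta)
      finally show "(\<Sum>p\<in>F. norm (g p)) \<le> B" using assms[of N] by linarith
    qed
  qed simp
  hence "g summable_on UNIV" by (rule abs_summable_summable)
  hence "(sum g \<longlongrightarrow> infsum g UNIV) (finite_subsets_at_top UNIV)"
    by (simp add: has_sum_infsum flip: has_sum_def)
  from filterlim_compose[OF this filterlim_square_boxes]
  have "(\<lambda>N. \<Sum>n<N. \<Sum>m<N. f n m) \<longlonglongrightarrow> infsum g UNIV"
    by (simp add: sum.cartesian_product g_def case_prod_beta)
  thus ?thesis by (rule convergentI)
qed

lemma freq_add: "freq (k + l) = freq k + freq l"
  by (simp add: freq_def)

section \<open>Products of blocks and their spectra\<close>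

context dyadic
begin

definition bp :: "nat \<Rightarrow> nat \<Rightarrow> distr \<Rightarrow> distr \<Rightarrow> distr" where
  "bp n m = block_prod chi rho (int n - 1) (int m - 1)"

definition psum :: "nat \<Rightarrow> distr \<Rightarrow> distr \<Rightarrow> distr" where
  "psum N f g k = (\<Sum>n<N. \<Sum>m<N. bp n m f g k)"

lemma bp_eq: "bp n m f g k = (\<Sum>p\<in>lp_box (int n - 1). of_real (wt n p) * f p * (of_real (wt m (k - p)) * g (k - p)))"
  by (simp add: bp_def block_prod_def wt_def)

text \<open>\<open>lim\<close> has an unspecified value on divergent sequences, so evaluating
  \<open>dprod\<close> requires a known limit. The block indices \<open>-1..N\<close> correspond to
  \<open>n < N + 2\<close>.\<close>

lemma dprod_eq_lim: "(\<lambda>N. psum N f g k) \<longlonglongrightarrow> L \<Longrightarrow> dprod chi rho f g k = L"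
proof -
  assume "(\<lambda>N. psum N f g k) \<longlonglongrightarrow> L"
  hence "(\<lambda>N. psum (N + 2) f g k) \<longlonglongrightarrow> L" by (rule LIMSEQ_ignore_initial_segment)
  moreover have "(\<Sum>i\<in>{-1..int N}. \<Sum>j\<in>{-1..int N}. block_prod chi rho i j f g k) = psum (N + 2) f g k" for N
  proof -
    have *: "(\<Sum>i\<in>{-1..int N}. F i) = (\<Sum>n<N + 2. F (int n - 1))" for F :: "int \<Rightarrow> complex"
      by (rule sum.reindex_bij_witness[of _ "\<lambda>n. int n - 1" "\<lambda>i. nat (i + 1)"]) auto
    show ?thesis by (simp only: * psum_def bp_def)
  qed
  ultimately show ?thesis unfolding dprod_def by (simp add: limI)
qed

text \<open>Blocks are trigonometric polynomials, so their product is one too, with the convolution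
  \<open>bp\<close> as coefficients; \<open>D\<close> is large enough for sums of frequencies from
  both supports.\<close>

lemma blk_mult:
  assumes D: "2 ^ Suc n + 2 ^ Suc m \<le> D"
  shows "blk n f x * blk m g x = (\<Sum>k\<in>fbox D. bp n m f g k * ch k x)"
proof -
  define S where "S = {p\<in>lp_box (int n - 1). wt n p \<noteq> 0}"
  have S: "finite S" by (simp add: S_def)
  have "blk n f x * blk m g x = (\<Sum>p\<in>S. of_real (wt n p) * f p * ch p x * blk m g x)"
    by (subst blk_eq_on[of S n]) (use S lp_box_supp in \<open>auto simp: S_def sum_distrib_right\<close>)
  also have "\<dots> = (\<Sum>p\<in>S. \<Sum>k\<in>fbox D. of_real (wt n p) * f p * (of_real (wt m (k - p)) * g (k - p)) * ch k x)"
  proof (intro sum.cong refl)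
    fix p assume p: "p \<in> S"
    have pD: "p \<in> fbox (2 ^ Suc n)" using p by (intro wt_fbox) (auto simp: S_def)
    have "blk m g x = (\<Sum>q\<in>(\<lambda>k. k - p) ` fbox D. of_real (wt m q) * g q * ch q x)"
    proof (rule blk_eq_on)
      fix q assume q: "wt m q \<noteq> 0"
      have "q \<in> fbox (2 ^ Suc m)" by (rule wt_fbox[OF q]) simp
      hence "q + p \<in> fbox D" using pD D by (cases p; cases q) (auto simp: fbox_def)
      thus "q \<in> (\<lambda>k. k - p) ` fbox D" by (intro image_eqI[of _ _ "q + p"]) auto
    qed simp
    also have "\<dots> = (\<Sum>k\<in>fbox D. of_real (wt m (k - p)) * g (k - p) * ch (k - p) x)"
      by (subst sum.reindex) (auto simp: inj_on_def)
    finally have "of_real (wt n p) * f p * ch p x * blk m g x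
       = (\<Sum>k\<in>fbox D. of_real (wt n p) * f p * (of_real (wt m (k - p)) * g (k - p)) * (ch p x * ch (k - p) x))"
      by (simp add: sum_distrib_left mult_ac)
    thus "of_real (wt n p) * f p * ch p x * blk m g x
       = (\<Sum>k\<in>fbox D. of_real (wt n p) * f p * (of_real (wt m (k - p)) * g (k - p)) * ch k x)"
      by (simp flip: ch_add)
  qed
  also have "\<dots> = (\<Sum>k\<in>fbox D. bp n m f g k * ch k x)"
  proof -
    have "bp n m f g k = (\<Sum>p\<in>S. of_real (wt n p) * f p * (of_real (wt m (k - p)) * g (k - p)))" for k
      unfolding bp_eq by (intro sum.mono_neutral_right) (auto simp: S_def)
    thus ?thesis by (simp add: sum_distrib_right sum.swap[of _ S])
  qed
  finally show ?thesis .
qed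

text \<open>From \<open>freq k = freq p + freq (k - p)\<close> by the triangle inequality. The
  factor \<open>32/9\<close> is the ratio of \<open>4/3\<close> in \<open>wt_upper\<close> to
  \<open>3/8\<close> in \<open>wt_lower\<close>, and the added 1 covers \<open>l = 0\<close>, for
  which \<open>wt_lower\<close> is silent.\<close>

lemma bp_interacts:
  assumes b: "bp n m f g k \<noteq> 0" and l: "wt l k \<noteq> 0"
  shows "interacts l n m"
proof -
  obtain p where p: "wt n p \<noteq> 0" "wt m (k - p) \<noteq> 0"
    using b unfolding bp_eq by (auto elim!: sum.not_neutral_contains_not_neutral)
  have k: "freq k = freq p + freq (k - p)" by (simp flip: freq_add)
  have up: "norm (freq k) \<le> 4/3 * 2 ^ n + 4/3 * 2 ^ m"
    unfolding k using norm_triangle_ineq[of "freq p" "freq (k - p)"] wt_upper[OF p(1)] wt_upper[OF p(2)] by linarith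
  have n0: "(0::real) < 2 ^ n" and m0: "(0::real) < 2 ^ m" by simp_all
  have l2: "2 ^ l \<le> 1 + 32/9 * (2 ^ n + 2 ^ m :: real)"
  proof (cases "l = 0")
    case False
    hence "3/8 * 2 ^ l \<le> norm (freq k)" using wt_lower[OF l] by simp
    with up have "3/8 * 2 ^ l \<le> 4/3 * 2 ^ n + 4/3 * (2::real) ^ m" by (rule order.trans[rotated])
    moreover have "X \<le> 1 + 32/9 * (u + v)" if "3/8 * X \<le> 4/3 * u + 4/3 * v" for X u v :: real
      using that by (simp add: field_simps)
    ultimately show ?thesis by blast
  qed (use n0 m0 in simp)
  show ?thesis
  proof (cases "m \<le> n + 3")
    case True
    hence "(2::real) ^ m \<le> 2 ^ (n + 3)" by (intro power_increasing) auto
    moreover have "(1::real) \<le> 2 ^ n" by simp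
    moreover have "X < u * 64" if "v \<le> u * 8" "1 \<le> u" "X \<le> 1 + 32/9 * (u + v)" for X u v :: real
      using that by (simp add: field_simps)
    ultimately have "2 ^ l < (2::real) ^ (n + 6)" using l2 unfolding power_add by simp
    hence "l < n + 6" by (rule power_less_imp_less_exp[rotated]) simp
    thus ?thesis using True by (simp add: interacts_def)
  next
    case False
    hence "(2::real) ^ (n + 4) \<le> 2 ^ m" by (intro power_increasing) auto
    hence nm: "(2::real) ^ n \<le> 2 ^ m / 16" by (simp add: power_add)
    have "norm (freq (k - p)) \<le> norm (freq k) + norm (freq p)"
      using k norm_triangle_ineq4[of "freq k" "freq p"] by simp
    hence "3/8 * 2 ^ m \<le> 4/3 * 2 ^ l + 4/3 * (2::real) ^ n"
      using wt_lower[OF p(2)] wt_upper[OF l] wt_upper[OF p(1)] False by simp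
    hence "(2::real) ^ m < 2 ^ (l + 3)" using nm by (simp add: power_add) (use m0 in linarith)
    hence 1: "m < l + 3" by (rule power_less_imp_less_exp[rotated]) simp
    have "X < v * 8" if "u \<le> v / 16" "1 \<le> v" "X \<le> 1 + 32/9 * (u + v)" for X u v :: real
      using that by (simp add: field_simps)
    from this[OF nm _ l2] have "2 ^ l < (2::real) ^ (m + 3)" by (simp add: power_add)
    hence "l < m + 3" by (rule power_less_imp_less_exp[rotated]) simp
    thus ?thesis using 1 by (simp add: interacts_def)
  qed
qed

end

context dyadic_heat
begin

text \<open>The product of two blocks is bounded pointwise, and cutting out block \<open>l\<close>
  costs \<open>CM\<close> by the multiplier bound at time 0; without interaction every coefficient
  vanishes.\<close>

lemma blk_bp_bound:
  assumes f: "bnd a F f" and g: "bnd b G g"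
  shows "norm (blk l (bp n m f g) x)
     \<le> CM * F * G * (if interacts l n m then (2 powr (- a)) ^ n * (2 powr (- b)) ^ m else 0)"
proof (cases "interacts l n m")
  case True
  define D :: int where "D = 2 ^ Suc n + 2 ^ Suc m + 2 ^ Suc l"
  have "norm (\<Sum>k\<in>fbox D. bp n m f g k * ch k x) \<le> (F * (2 powr (- a)) ^ n) * (G * (2 powr (- b)) ^ m)" for x
  proof -
    have "(\<Sum>k\<in>fbox D. bp n m f g k * ch k x) = blk n f x * blk m g x"
      by (rule blk_mult[symmetric]) (simp add: D_def)
    thus ?thesis using bndD[OF f, of n x] bndD[OF g, of m x] bnd_nonneg[OF f]
      unfolding norm_mult two_powr_nat by (simp add: norm_mult mult_mono)
  qed
  from multiplier_0[OF this, of l x]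
  have "norm (\<Sum>k\<in>fbox D. of_real (wt l k) * bp n m f g k * ch k x)
     \<le> CM * (F * (2 powr (- a)) ^ n * (G * (2 powr (- b)) ^ m))" .
  thus ?thesis using True by (subst blk_eq[of l D]) (simp_all add: D_def mult_ac)
next
  case False
  hence "of_real (wt l k) * bp n m f g k * ch k x = 0" for k using bp_interacts[of n m f g k l] by auto
  thus ?thesis using False by (simp only: blk_lp_box sum.neutral_const) simp
qed

text \<open>With \<open>x = 2 powr (- a)\<close> and \<open>y = 2 powr (- b)\<close> the hypotheses
  become those of \<open>interaction_sum\<close>: \<open>a + b > 0\<close> is
  \<open>x * y < 1\<close> and \<open>b \<noteq> 0\<close> is \<open>y \<noteq> 1\<close>.
  Convergence of the partial sums is part of the conclusion because linearity of
  \<open>dprod\<close> rests on it.\<close>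

lemma product_bound:
  assumes a: "a > 0" and b: "b \<le> a" "a + b > 0" "b \<noteq> 0"
  obtains C where "C > 0"
    "\<And>f g F G. bnd a F f \<Longrightarrow> bnd b G g \<Longrightarrow>
        bnd b (C * F * G) (dprod chi rho f g) \<and> (\<forall>k. (\<lambda>N. psum N f g k) \<longlonglongrightarrow> dprod chi rho f g k)"
proof -
  define x where "x = 2 powr (- a)"
  define y where "y = 2 powr (- b)"
  have x: "0 < x" "x < 1" using a by (auto simp: x_def powr_less_one)
  have y: "x \<le> y" "y \<noteq> 1" using b by (auto simp: x_def y_def)
  have xy: "x * y < 1" using b by (simp add: x_def y_def powr_add[symmetric] powr_less_one)
  obtain C where C: "C > 0"
    "\<And>l N. (\<Sum>n<N. \<Sum>m<N. if interacts l n m then x ^ n * y ^ m else 0) \<le> C * y ^ l"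
    by (rule interaction_sum[OF x y xy]) (rule that, assumption+)
  show ?thesis
  proof (rule that[of "CM * C"])
    show "CM * C > 0" using C CM by simp
    fix f g F G assume f: "bnd a F f" and g: "bnd b G g"
    note pos = CM bnd_nonneg[OF f] bnd_nonneg[OF g]
    have sums: "(\<Sum>n<N. \<Sum>m<N. CM * F * G * (if interacts l n m then x ^ n * y ^ m else 0)) \<le> CM * C * F * G * y ^ l" for l N
    proof -
      have "(\<Sum>n<N. \<Sum>m<N. CM * F * G * (if interacts l n m then x ^ n * y ^ m else 0))
         = CM * F * G * (\<Sum>n<N. \<Sum>m<N. if interacts l n m then x ^ n * y ^ m else 0)"
        by (simp only: sum_distrib_left)
      also have "\<dots> \<le> CM * F * G * (C * y ^ l)" using pos C by (intro mult_left_mono) auto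
      finally show ?thesis by (simp add: mult_ac)
    qed
    have lim: "(\<lambda>N. psum N f g k) \<longlonglongrightarrow> dprod chi rho f g k" for k
    proof -
      obtain l where l: "wt l k \<noteq> 0" using ex_wt_nonzero by blast
      hence w: "wt l k > 0" using wt_nonneg[of l k] by simp
      have "norm (bp n m f g k) \<le> CM * F * G * (if interacts l n m then x ^ n * y ^ m else 0) / wt l k" for n m
        using blk_coeff_bound[OF blk_bp_bound[OF f g], of l k n m] w
        unfolding x_def y_def pos_le_divide_eq[OF w] by (simp only: mult.commute)
      hence "(\<Sum>n<N. \<Sum>m<N. norm (bp n m f g k))
          \<le> (\<Sum>n<N. \<Sum>m<N. CM * F * G * (if interacts l n m then x ^ n * y ^ m else 0) / wt l k)" for N
        by (intro sum_mono)
      also have "\<dots> N \<le> CM * C * F * G * y ^ l / wt l k" for N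
        unfolding sum_divide_distrib[symmetric] using sums w by (intro divide_right_mono) auto
      finally have "convergent (\<lambda>N. psum N f g k)"
        unfolding psum_def by (rule convergent_double_sum)
      then obtain L where "(\<lambda>N. psum N f g k) \<longlonglongrightarrow> L" by (auto simp: convergent_def)
      thus ?thesis using dprod_eq_lim by metis
    qed
    moreover have "bnd b (CM * C * F * G) (dprod chi rho f g)"
    proof (rule bnd_limit[OF lim])
      fix N
      show "bnd b (CM * C * F * G) (psum N f g)"
        unfolding bnd_def
      proof (intro allI)
        fix l z
        have "norm (blk l (psum N f g) z) = norm (\<Sum>n<N. \<Sum>m<N. blk l (bp n m f g) z)"
          unfolding psum_def by (simp only: blk_sum)
        also have "\<dots> \<le> (\<Sum>n<N. \<Sum>m<N. CM * F * G * (if interacts l n m then x ^ n * y ^ m else 0))"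
          unfolding x_def y_def by (intro sum_norm_le blk_bp_bound[OF f g])
        also have "\<dots> \<le> CM * C * F * G * y ^ l" by (rule sums)
        finally show "norm (blk l (psum N f g) z) \<le> CM * C * F * G * 2 powr (- (b * real l))"
          by (simp add: y_def two_powr_nat)
      qed
    qed
    ultimately show "bnd b (CM * C * F * G) (dprod chi rho f g) \<and> (\<forall>k. (\<lambda>N. psum N f g k) \<longlonglongrightarrow> dprod chi rho f g k)"
      by blast
  qed
qed

section \<open>Bilinearity and Lipschitz bounds\<close>

lemma psum_diff_left: "psum N (\<lambda>k. f k - f' k) g k = psum N f g k - psum N f' g k"
  by (simp add: psum_def bp_eq algebra_simps sum_subtractf)

lemma psum_diff_right: "psum N f (\<lambda>k. g k - g' k) k = psum N f g k - psum N f g' k"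
  by (simp add: psum_def bp_eq algebra_simps sum_subtractf)

text \<open>\<open>f g - f' g' = f (g - g') + (f - f') g'\<close>. The partial sums are bilinear,
  and the identity passes to the limits since bounds on \<open>g\<close> and \<open>f'\<close>
  follow from the assumed ones.\<close>

lemma product_lipschitz:
  assumes a: "a > 0" and b: "b \<le> a" "a + b > 0" "b \<noteq> 0"
  obtains C where "C > 0"
    "\<And>f g F G. bnd a F f \<Longrightarrow> bnd b G g \<Longrightarrow> bnd b (C * F * G) (dprod chi rho f g)"
    "\<And>f f' g g' F G' d e. bnd a F f \<Longrightarrow> bnd b G' g' \<Longrightarrow> bnd a d (\<lambda>k. f k - f' k) \<Longrightarrow> bnd b e (\<lambda>k. g k - g' k) \<Longrightarrow>
       bnd b (C * F * e + C * d * G') (\<lambda>k. dprod chi rho f g k - dprod chi rho f' g' k)"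
proof -
  obtain C where C: "C > 0"
    "\<And>f g F G. bnd a F f \<Longrightarrow> bnd b G g \<Longrightarrow>
        bnd b (C * F * G) (dprod chi rho f g) \<and> (\<forall>k. (\<lambda>N. psum N f g k) \<longlonglongrightarrow> dprod chi rho f g k)"
    by (rule product_bound[OF assms]) (rule that, assumption+)
  show ?thesis
  proof (rule that[OF C(1)])
    fix f f' g g' F G' d e
    assume f: "bnd a F f" and g': "bnd b G' g'" and df: "bnd a d (\<lambda>k. f k - f' k)"
      and dg: "bnd b e (\<lambda>k. g k - g' k)"
    have g: "bnd b (e + G') g" using bnd_add[OF dg g'] by simp
    have f': "bnd a (F + d) f'" using bnd_diff[OF f df] by simp
    have L: "(\<lambda>N. psum N f g k) \<longlonglongrightarrow> dprod chi rho f g k" if "bnd a F f" "bnd b G g" for F f G g k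
      using C(2)[OF that] by blast
    have 1: "dprod chi rho f (\<lambda>k. g k - g' k) k = dprod chi rho f g k - dprod chi rho f g' k" for k
      by (rule dprod_eq_lim) (unfold psum_diff_right, intro tendsto_diff L[OF f g] L[OF f g'])
    have 2: "dprod chi rho (\<lambda>k. f k - f' k) g' k = dprod chi rho f g' k - dprod chi rho f' g' k" for k
      by (rule dprod_eq_lim) (unfold psum_diff_left, intro tendsto_diff L[OF f g'] L[OF f' g'])
    have "bnd b (C * F * e + C * d * G')
       (\<lambda>k. dprod chi rho f (\<lambda>k. g k - g' k) k + dprod chi rho (\<lambda>k. f k - f' k) g' k)"
      using C(2)[OF f dg] C(2)[OF df g'] by (intro bnd_add) auto
    thus "bnd b (C * F * e + C * d * G') (\<lambda>k. dprod chi rho f g k - dprod chi rho f' g' k)"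
      by (simp add: 1 2)
  qed (use C(2) in blast)
qed

end

section \<open>The nonlinearity\<close>

context dyadic_heat
begin

lemma bnd_dconj_diff:
  assumes "bnd b F (\<lambda>k. f k - g k)"
  shows "bnd b (3 * CM * 2 powr \<bar>b\<bar> * F) (\<lambda>k. dconj f k - dconj g k)"
proof -
  have "dconj (\<lambda>k. f k - g k) = (\<lambda>k. dconj f k - dconj g k)" by (simp add: dconj_def fun_eq_iff)
  thus ?thesis using bnd_dconj[OF assms] by simp
qed

text \<open>Two regularities of the right factor occur in \<open>Psi_lipschitz\<close>:
  \<open>a\<close> inside the quadratic terms and \<open>- al\<close> for the outermost products.
  One constant for both makes the estimate of \<open>Psi\<close> mechanical.\<close>

lemma product_constants:
  assumes al: "0 < al" "al < a"
  obtains C where "C \<ge> 1"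
    "\<And>b f g F G. b = a \<or> b = - al \<Longrightarrow> bnd a F f \<Longrightarrow> bnd b G g \<Longrightarrow> bnd b (C * F * G) (dprod chi rho f g)"
    "\<And>b f f' g g' F G' d e. b = a \<or> b = - al \<Longrightarrow> bnd a F f \<Longrightarrow> bnd b G' g' \<Longrightarrow>
       bnd a d (\<lambda>k. f k - f' k) \<Longrightarrow> bnd b e (\<lambda>k. g k - g' k) \<Longrightarrow>
       bnd b (C * F * e + C * d * G') (\<lambda>k. dprod chi rho f g k - dprod chi rho f' g' k)"
    "\<And>b f F. b = a \<or> b = - al \<Longrightarrow> bnd b F f \<Longrightarrow> bnd b (C * F) (dconj f)"
    "\<And>b f g F. b = a \<or> b = - al \<Longrightarrow> bnd b F (\<lambda>k. f k - g k) \<Longrightarrow> bnd b (C * F) (\<lambda>k. dconj f k - dconj g k)"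
proof -
  have ex: "\<exists>C. (\<forall>f g F G. bnd a F f \<longrightarrow> bnd b G g \<longrightarrow> bnd b (C * F * G) (dprod chi rho f g)) \<and>
    (\<forall>f f' g g' F G' d e. bnd a F f \<longrightarrow> bnd b G' g' \<longrightarrow> bnd a d (\<lambda>k. f k - f' k) \<longrightarrow> bnd b e (\<lambda>k. g k - g' k) \<longrightarrow>
       bnd b (C * F * e + C * d * G') (\<lambda>k. dprod chi rho f g k - dprod chi rho f' g' k))"
    if "b = a \<or> b = - al" for b
  proof -
    have b: "a > 0" "b \<le> a" "a + b > 0" "b \<noteq> 0" using that al by auto
    show ?thesis by (rule product_lipschitz[OF b]) blast
  qed
  obtain C1 where C1: "\<And>f g F G. bnd a F f \<Longrightarrow> bnd a G g \<Longrightarrow> bnd a (C1 * F * G) (dprod chi rho f g)"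
    "\<And>f f' g g' F G' d e. bnd a F f \<Longrightarrow> bnd a G' g' \<Longrightarrow> bnd a d (\<lambda>k. f k - f' k) \<Longrightarrow> bnd a e (\<lambda>k. g k - g' k) \<Longrightarrow>
       bnd a (C1 * F * e + C1 * d * G') (\<lambda>k. dprod chi rho f g k - dprod chi rho f' g' k)"
    using ex[of a] by blast
  obtain C2 where C2: "\<And>f g F G. bnd a F f \<Longrightarrow> bnd (- al) G g \<Longrightarrow> bnd (- al) (C2 * F * G) (dprod chi rho f g)"
    "\<And>f f' g g' F G' d e. bnd a F f \<Longrightarrow> bnd (- al) G' g' \<Longrightarrow> bnd a d (\<lambda>k. f k - f' k) \<Longrightarrow> bnd (- al) e (\<lambda>k. g k - g' k) \<Longrightarrow>
       bnd (- al) (C2 * F * e + C2 * d * G') (\<lambda>k. dprod chi rho f g k - dprod chi rho f' g' k)"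
    using ex[of "- al"] by blast
  define C where "C = Max {1, C1, C2, 3 * CM * 2 powr \<bar>a\<bar>, 3 * CM * 2 powr \<bar>- al\<bar>}"
  have C: "1 \<le> C" "C1 \<le> C" "C2 \<le> C" "3 * CM * 2 powr \<bar>a\<bar> \<le> C" "3 * CM * 2 powr \<bar>- al\<bar> \<le> C"
    unfolding C_def by (rule Max_ge; simp)+
  show ?thesis
  proof (rule that[OF C(1)])
    fix b assume b: "b = a \<or> b = - al"
    show "bnd b (C * F * G) (dprod chi rho f g)" if f: "bnd a F f" and g: "bnd b G g" for f g F G
      using b
    proof
      assume b: "b = a"
      show ?thesis unfolding b
        by (rule bnd_mono[OF C1(1)[OF f g[unfolded b]]])
           (use C bnd_nonneg[OF f] bnd_nonneg[OF g] in \<open>auto intro!: mult_right_mono\<close>)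
    next
      assume b: "b = - al"
      show ?thesis unfolding b
        by (rule bnd_mono[OF C2(1)[OF f g[unfolded b]]])
           (use C bnd_nonneg[OF f] bnd_nonneg[OF g] in \<open>auto intro!: mult_right_mono\<close>)
    qed
    show "bnd b (C * F * e + C * d * G') (\<lambda>k. dprod chi rho f g k - dprod chi rho f' g' k)"
      if f: "bnd a F f" and g: "bnd b G' g'" and d: "bnd a d (\<lambda>k. f k - f' k)" and e: "bnd b e (\<lambda>k. g k - g' k)"
      for f f' g g' F G' d e
      using b
    proof
      assume b: "b = a"
      show ?thesis unfolding b
        by (rule bnd_mono[OF C1(2)[OF f g[unfolded b] d e[unfolded b]]])
           (use C bnd_nonneg[OF f] bnd_nonneg[OF g] bnd_nonneg[OF d] bnd_nonneg[OF e]
             in \<open>auto intro!: mult_right_mono add_mono\<close>)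
    next
      assume b: "b = - al"
      show ?thesis unfolding b
        by (rule bnd_mono[OF C2(2)[OF f g[unfolded b] d e[unfolded b]]])
           (use C bnd_nonneg[OF f] bnd_nonneg[OF g] bnd_nonneg[OF d] bnd_nonneg[OF e]
             in \<open>auto intro!: mult_right_mono add_mono\<close>)
    qed
    show "bnd b (C * F) (dconj f)" if f: "bnd b F f" for f F
      by (rule bnd_mono[OF bnd_dconj[OF f]])
         (use C b bnd_nonneg[OF f] in \<open>auto intro!: mult_right_mono\<close>)
    show "bnd b (C * F) (\<lambda>k. dconj f k - dconj g k)" if f: "bnd b F (\<lambda>k. f k - g k)" for f g F
      by (rule bnd_mono[OF bnd_dconj_diff[OF f]])
         (use C b bnd_nonneg[OF f] in \<open>auto intro!: mult_right_mono\<close>)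
  qed
qed

lemma dprod_zero_left: "dprod chi rho (\<lambda>_. 0) g k = 0"
  by (simp add: dprod_def block_prod_def limI)

lemma Psi_zero: "Psi chi rho \<nu> lam (\<lambda>_. 0) Z Z2 Zab Zab2 k = (1 + of_real lam) * Z k - \<nu> * Zab2 k"
proof -
  have "dconj (\<lambda>_. 0) = (\<lambda>_. 0)" by (simp add: dconj_def fun_eq_iff)
  moreover have "dprod chi rho (\<lambda>_. 0) g = (\<lambda>_. 0)" for g by (simp add: dprod_zero_left fun_eq_iff)
  ultimately show ?thesis by (simp add: Psi_def)
qed

text \<open>Counting \<open>Y\<close> and \<open>Z\<close> as size \<open>M\<close> and the
  quadratic components as \<open>M^2\<close>, every summand that contains \<open>Y\<close> has
  degree at most 3, so its difference is at most of order \<open>M^2 * d\<close>. The left factor of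
  each product has regularity \<open>a\<close>.\<close>

lemma Psi_lipschitz:
  assumes al: "0 < al" "al < a"
  obtains C where "C > 0"
    "\<And>M d Y Y' Z Z2 Zab Zab2. M \<ge> 1 \<Longrightarrow> bnd a M Y \<Longrightarrow> bnd a M Y' \<Longrightarrow> bnd (- al) M Z \<Longrightarrow>
       bnd (- al) (M^2) Z2 \<Longrightarrow> bnd (- al) (M^2) Zab \<Longrightarrow> bnd a d (\<lambda>k. Y k - Y' k) \<Longrightarrow>
       bnd (- al) (C * M^2 * d)
         (\<lambda>k. Psi chi rho \<nu> lam Y Z Z2 Zab Zab2 k - Psi chi rho \<nu> lam Y' Z Z2 Zab Zab2 k)"
proof -
  obtain C where C: "C \<ge> 1"
    and prod: "\<And>b f g F G. b = a \<or> b = - al \<Longrightarrow> bnd a F f \<Longrightarrow> bnd b G g \<Longrightarrow> bnd b (C * F * G) (dprod chi rho f g)"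
    and pdiff: "\<And>b f f' g g' F G' d e. b = a \<or> b = - al \<Longrightarrow> bnd a F f \<Longrightarrow> bnd b G' g' \<Longrightarrow>
       bnd a d (\<lambda>k. f k - f' k) \<Longrightarrow> bnd b e (\<lambda>k. g k - g' k) \<Longrightarrow>
       bnd b (C * F * e + C * d * G') (\<lambda>k. dprod chi rho f g k - dprod chi rho f' g' k)"
    and conj: "\<And>b f F. b = a \<or> b = - al \<Longrightarrow> bnd b F f \<Longrightarrow> bnd b (C * F) (dconj f)"
    and cdiff: "\<And>b f g F. b = a \<or> b = - al \<Longrightarrow> bnd b F (\<lambda>k. f k - g k) \<Longrightarrow> bnd b (C * F) (\<lambda>k. dconj f k - dconj g k)"
    by (rule product_constants[OF al]) (rule that, assumption+)
  define L where "L = norm (1 + of_real lam :: complex)"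
  define N where "N = norm \<nu>"
  show ?thesis
  \<comment> \<open>The five product differences add up to \<open>9 * C^3 + 2 * C + C^2\<close>, at
    most \<open>12 * C^3\<close>; the final 1 makes the constant positive.\<close>
  proof (rule that[of "L + N * (12 * C^3) + 1"])
    show "L + N * (12 * C^3) + 1 > 0" using C by (intro add_nonneg_pos add_nonneg_nonneg) (auto simp: L_def N_def)
    fix M d Y Y' Z Z2 Zab Zab2
    assume M: "M \<ge> 1" and Y: "bnd a M Y" and Y': "bnd a M Y'" and Z: "bnd (- al) M Z"
      and Z2: "bnd (- al) (M^2) Z2" and Zab: "bnd (- al) (M^2) Zab" and d: "bnd a d (\<lambda>k. Y k - Y' k)"
    define P where "P = dprod chi rho"
    note prod = prod[folded P_def] and pdiff = pdiff[folded P_def]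
    have d0: "d \<ge> 0" by (rule bnd_nonneg[OF d])
    have al_a: "- al \<le> a" using al by simp
    have z: "bnd (- al) 0 (\<lambda>k. g k - g k)" for g by (simp add: bnd_zero)
    have cY: "bnd a (C * M) (dconj Y)" "bnd a (C * M) (dconj Y')" using conj Y Y' by auto
    have cd: "bnd a (C * d) (\<lambda>k. dconj Y k - dconj Y' k)" using cdiff d by auto
    have A: "bnd a (C * M * (C * M)) (P Y (dconj Y))" using prod Y cY by auto
    have Ad: "bnd a (C * M * (C * d) + C * d * (C * M)) (\<lambda>k. P Y (dconj Y) k - P Y' (dconj Y') k)"
      using pdiff[OF disjI1[OF refl] Y cY(2) d cd] .
    have B: "bnd a (C * M * M) (P Y Y)" using prod Y by auto
    have Bd: "bnd a (C * M * d + C * d * M) (\<lambda>k. P Y Y k - P Y' Y' k)" using pdiff[OF disjI1[OF refl] Y Y' d d] .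
    have 1: "bnd (- al) (C * (C * M * (C * M)) * d + C * (C * M * (C * d) + C * d * (C * M)) * M)
       (\<lambda>k. P (P Y (dconj Y)) Y k - P (P Y' (dconj Y')) Y' k)"
      using pdiff[OF disjI2[OF refl] A bnd_weaken[OF Y' al_a] Ad bnd_weaken[OF d al_a]] .
    have 2: "bnd (- al) (norm (2::complex) * (C * (C * M * (C * M)) * 0 + C * (C * M * (C * d) + C * d * (C * M)) * M))
       (\<lambda>k. 2 * (P (P Y (dconj Y)) Z k - P (P Y' (dconj Y')) Z k))"
      using bnd_scale[OF pdiff[OF disjI2[OF refl] A Z Ad z]] .
    have 3: "bnd (- al) (C * (C * M * M) * 0 + C * (C * M * d + C * d * M) * (C * M))
       (\<lambda>k. P (P Y Y) (dconj Z) k - P (P Y' Y') (dconj Z) k)"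
      using pdiff[OF disjI2[OF refl] B conj[OF disjI2[OF refl] Z] Bd z] .
    have 4: "bnd (- al) (norm (2::complex) * (C * M * 0 + C * d * M^2)) (\<lambda>k. 2 * (P Y Zab k - P Y' Zab k))"
      using bnd_scale[OF pdiff[OF disjI2[OF refl] Y Zab d z]] .
    have 5: "bnd (- al) (C * (C * M) * 0 + C * (C * d) * M^2) (\<lambda>k. P (dconj Y) Z2 k - P (dconj Y') Z2 k)"
      using pdiff[OF disjI2[OF refl] cY(1) Z2 cd z] .
    have lin: "bnd (- al) (L * d) (\<lambda>k. (1 + of_real lam) * (Y k - Y' k))"
      unfolding L_def by (rule bnd_scale[OF bnd_weaken[OF d al_a]])
    define S where "S = C * (C * M * (C * M)) * d + C * (C * M * (C * d) + C * d * (C * M)) * M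
        + norm (2::complex) * (C * (C * M * (C * M)) * 0 + C * (C * M * (C * d) + C * d * (C * M)) * M)
        + (C * (C * M * M) * 0 + C * (C * M * d + C * d * M) * (C * M))
        + norm (2::complex) * (C * M * 0 + C * d * M^2)
        + (C * (C * M) * 0 + C * (C * d) * M^2)"
    have "bnd (- al) (L * d + N * S)
       (\<lambda>k. Psi chi rho \<nu> lam Y Z Z2 Zab Zab2 k - Psi chi rho \<nu> lam Y' Z Z2 Zab Zab2 k)"
    proof -
      have "(\<lambda>k. Psi chi rho \<nu> lam Y Z Z2 Zab Zab2 k - Psi chi rho \<nu> lam Y' Z Z2 Zab Zab2 k)
        = (\<lambda>k. (1 + of_real lam) * (Y k - Y' k) - \<nu> *
           ((P (P Y (dconj Y)) Y k - P (P Y' (dconj Y')) Y' k)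
            + 2 * (P (P Y (dconj Y)) Z k - P (P Y' (dconj Y')) Z k)
            + (P (P Y Y) (dconj Z) k - P (P Y' Y') (dconj Z) k)
            + 2 * (P Y Zab k - P Y' Zab k) + (P (dconj Y) Z2 k - P (dconj Y') Z2 k)))"
        by (simp add: fun_eq_iff Psi_def Let_def P_def[symmetric] algebra_simps)
      thus ?thesis unfolding N_def S_def
        using bnd_diff[OF lin bnd_scale[OF bnd_add[OF bnd_add[OF bnd_add[OF bnd_add[OF 1 2] 3] 4] 5]]] by simp
    qed
    moreover have "L * d + N * S \<le> (L + N * (12 * C^3) + 1) * M^2 * d"
    proof -
      have "S = (9 * C^3 + 2 * C + C^2) * (M^2 * d)"
        by (simp add: S_def power2_eq_square power3_eq_cube algebra_simps)
      also have "\<dots> \<le> (12 * C^3) * (M^2 * d)"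
      proof (intro mult_right_mono)
        have "C ^ 1 \<le> C ^ 3" "C ^ 2 \<le> C ^ 3" using C by (intro power_increasing; simp)+
        thus "9 * C^3 + 2 * C + C^2 \<le> 12 * C^3" by simp
      qed (use d0 in auto)
      finally have "N * S \<le> N * ((12 * C^3) * (M^2 * d))" by (intro mult_left_mono) (auto simp: N_def)
      moreover have "L * d \<le> L * (M^2 * d)"
        using M d0 one_le_power[OF M, of 2] mult_right_mono[of 1 "M^2" d]
        by (intro mult_left_mono) (auto simp: L_def)
      moreover have "0 \<le> M^2 * d" using d0 by simp
      ultimately show ?thesis by (simp add: algebra_simps)
    qed
    ultimately show "bnd (- al) ((L + N * (12 * C^3) + 1) * M^2 * d)
         (\<lambda>k. Psi chi rho \<nu> lam Y Z Z2 Zab Zab2 k - Psi chi rho \<nu> lam Y' Z Z2 Zab Zab2 k)"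
      by (rule bnd_mono)
  qed
qed

text \<open>Growth follows from the Lipschitz bound against the zero distribution, where only the
  linear \<open>Z\<close> term and \<open>Zab2\<close> survive.\<close>

lemma Psi_bounds:
  assumes al: "0 < al" "al < a"
  obtains C where "C > 0"
    "\<And>M Y Z Z2 Zab Zab2. M \<ge> 1 \<Longrightarrow> bnd a M Y \<Longrightarrow> bnd (- al) M Z \<Longrightarrow>
       bnd (- al) (M^2) Z2 \<Longrightarrow> bnd (- al) (M^2) Zab \<Longrightarrow> bnd (- al) (M^3) Zab2 \<Longrightarrow>
       bnd (- al) (C * M^3) (Psi chi rho \<nu> lam Y Z Z2 Zab Zab2)"
    "\<And>M d Y Y' Z Z2 Zab Zab2. M \<ge> 1 \<Longrightarrow> bnd a M Y \<Longrightarrow> bnd a M Y' \<Longrightarrow> bnd (- al) M Z \<Longrightarrow>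
       bnd (- al) (M^2) Z2 \<Longrightarrow> bnd (- al) (M^2) Zab \<Longrightarrow> bnd a d (\<lambda>k. Y k - Y' k) \<Longrightarrow>
       bnd (- al) (C * M^2 * d)
         (\<lambda>k. Psi chi rho \<nu> lam Y Z Z2 Zab Zab2 k - Psi chi rho \<nu> lam Y' Z Z2 Zab Zab2 k)"
proof -
  obtain C where C: "C > 0"
    and lip: "\<And>M d Y Y' Z Z2 Zab Zab2. M \<ge> 1 \<Longrightarrow> bnd a M Y \<Longrightarrow> bnd a M Y' \<Longrightarrow> bnd (- al) M Z \<Longrightarrow>
       bnd (- al) (M^2) Z2 \<Longrightarrow> bnd (- al) (M^2) Zab \<Longrightarrow> bnd a d (\<lambda>k. Y k - Y' k) \<Longrightarrow>
       bnd (- al) (C * M^2 * d)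
         (\<lambda>k. Psi chi rho \<nu> lam Y Z Z2 Zab Zab2 k - Psi chi rho \<nu> lam Y' Z Z2 Zab Zab2 k)"
    by (rule Psi_lipschitz[OF al]) (rule that, assumption+)
  define C' where "C' = C + norm (1 + of_real lam :: complex) + norm \<nu>"
  have C': "C \<le> C'" by (simp add: C'_def)
  show ?thesis
  proof (rule that[of C'])
    show "C' > 0" using C C' by simp
    fix M Y Z Z2 Zab Zab2
    assume M: "M \<ge> 1" and Y: "bnd a M Y" and Z: "bnd (- al) M Z"
      and Z2: "bnd (- al) (M^2) Z2" and Zab: "bnd (- al) (M^2) Zab" and Zab2: "bnd (- al) (M^3) Zab2"
    have "bnd (- al) (C * M^2 * M)
       (\<lambda>k. Psi chi rho \<nu> lam Y Z Z2 Zab Zab2 k - Psi chi rho \<nu> lam (\<lambda>_. 0) Z Z2 Zab Zab2 k)"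
      using lip[OF M Y _ Z Z2 Zab, of "\<lambda>_. 0" M Zab2] Y M by (simp add: bnd_zero)
    from bnd_add[OF this bnd_diff[OF bnd_scale[OF Z] bnd_scale[OF Zab2]], of "1 + of_real lam" \<nu>]
    have "bnd (- al) (C * M^2 * M + (norm (1 + of_real lam :: complex) * M + norm \<nu> * M^3))
       (Psi chi rho \<nu> lam Y Z Z2 Zab Zab2)"
      by (simp add: Psi_zero)
    thus "bnd (- al) (C' * M^3) (Psi chi rho \<nu> lam Y Z Z2 Zab Zab2)"
    proof (rule bnd_mono)
      have "M ^ 1 \<le> M ^ 3" using M by (intro power_increasing) auto
      hence "norm (1 + of_real lam :: complex) * M \<le> norm (1 + of_real lam :: complex) * M ^ 3"
        by (intro mult_left_mono) auto
      thus "C * M^2 * M + (norm (1 + of_real lam :: complex) * M + norm \<nu> * M^3) \<le> C' * M^3"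
        by (simp add: C'_def distrib_right power2_eq_square power3_eq_cube mult.assoc)
    qed
  next
    fix M d Y Y' Z Z2 Zab Zab2
    assume H: "M \<ge> 1" "bnd a M Y" "bnd a M Y'" "bnd (- al) M Z" "bnd (- al) (M^2) Z2" "bnd (- al) (M^2) Zab"
      and d: "bnd a d (\<lambda>k. Y k - Y' k)"
    show "bnd (- al) (C' * M^2 * d)
         (\<lambda>k. Psi chi rho \<nu> lam Y Z Z2 Zab Zab2 k - Psi chi rho \<nu> lam Y' Z Z2 Zab Zab2 k)"
      by (rule bnd_mono[OF lip[OF H d]]) (use C' bnd_nonneg[OF d] in \<open>auto intro!: mult_right_mono\<close>)
  qed
qed

section \<open>Measurability of the nonlinearity\<close>

lemma dprod_measurable:
  assumes "\<And>k. (\<lambda>t. f t k) \<in> borel_measurable M" "\<And>k. (\<lambda>t. g t k) \<in> borel_measurable M"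
  shows "(\<lambda>t. dprod chi rho (f t) (g t) k) \<in> borel_measurable M"
  \<comment> \<open>\<open>borel_measurable_lim_metric\<close> also covers the times at which the
    sequence diverges and \<open>lim\<close> takes its default value.\<close>
  unfolding dprod_def block_prod_def
  by (intro borel_measurable_lim_metric borel_measurable_sum borel_measurable_times
        borel_measurable_const assms)

lemma dconj_measurable:
  assumes "\<And>k. (\<lambda>t. f t k) \<in> borel_measurable M"
  shows "(\<lambda>t. dconj (f t) k) \<in> borel_measurable M"
  unfolding dconj_def
  by (intro borel_measurable_continuous_on[OF _ assms] continuous_intros)

lemma Psi_measurable:
  assumes "\<And>k. (\<lambda>t. Y t k) \<in> borel_measurable M" "\<And>k. (\<lambda>t. Z t k) \<in> borel_measurable M"
    "\<And>k. (\<lambda>t. Z2 t k) \<in> borel_measurable M" "\<And>k. (\<lambda>t. Zab t k) \<in> borel_measurable M"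
    "\<And>k. (\<lambda>t. Zab2 t k) \<in> borel_measurable M"
  shows "(\<lambda>t. Psi chi rho \<nu> lam (Y t) (Z t) (Z2 t) (Zab t) (Zab2 t) k) \<in> borel_measurable M"
  unfolding Psi_def Let_def
  by (intro borel_measurable_add borel_measurable_diff borel_measurable_times borel_measurable_const
        dprod_measurable dconj_measurable assms)

end

section \<open>Duhamel integrals and time continuity\<close>

text \<open>The antiderivative stays continuous at the singular endpoint because
  \<open>\<eta> < 1\<close>, so the fundamental theorem asks for derivatives in the interior
  only.\<close>

lemma powr_singular_integral:
  fixes a b \<eta> :: real
  assumes "a \<le> b" "\<eta> < 1"
  shows "((\<lambda>s. (s - a) powr (- \<eta>)) has_integral (b - a) powr (1 - \<eta>) / (1 - \<eta>)) {a..b}"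
    and "((\<lambda>s. (b - s) powr (- \<eta>)) has_integral (b - a) powr (1 - \<eta>) / (1 - \<eta>)) {a..b}"
proof -
  have "((\<lambda>s. (s - a) powr (- \<eta>)) has_integral
     ((b - a) powr (1 - \<eta>) / (1 - \<eta>) - (a - a) powr (1 - \<eta>) / (1 - \<eta>))) {a..b}"
  proof (rule fundamental_theorem_of_calculus_interior)
    show "continuous_on {a..b} (\<lambda>s. (s - a) powr (1 - \<eta>) / (1 - \<eta>))"
      using assms by (intro continuous_intros continuous_on_powr') auto
    fix s assume s: "s \<in> {a<..<b}"
    have "((\<lambda>s. (s - a) powr (1 - \<eta>)) has_real_derivative (1 - \<eta>) * (s - a) powr (1 - \<eta> - 1) * 1) (at s)"
      by (rule DERIV_chain2[OF has_real_derivative_powr]) (use s in \<open>auto intro!: derivative_eq_intros\<close>)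
    from DERIV_cdivide[OF this, of "1 - \<eta>"]
    have "((\<lambda>s. (s - a) powr (1 - \<eta>) / (1 - \<eta>)) has_real_derivative (s - a) powr (- \<eta>)) (at s)"
      using assms by simp
    thus "((\<lambda>s. (s - a) powr (1 - \<eta>) / (1 - \<eta>)) has_vector_derivative (s - a) powr (- \<eta>)) (at s)"
      by (simp add: has_real_derivative_iff_has_vector_derivative)
  qed fact
  thus "((\<lambda>s. (s - a) powr (- \<eta>)) has_integral (b - a) powr (1 - \<eta>) / (1 - \<eta>)) {a..b}" by simp
  have "((\<lambda>s. (b - s) powr (- \<eta>)) has_integral
     (- ((b - b) powr (1 - \<eta>) / (1 - \<eta>)) - - ((b - a) powr (1 - \<eta>) / (1 - \<eta>)))) {a..b}"
  proof (rule fundamental_theorem_of_calculus_interior)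
    show "continuous_on {a..b} (\<lambda>s. - ((b - s) powr (1 - \<eta>) / (1 - \<eta>)))"
      using assms by (intro continuous_intros continuous_on_powr') auto
    fix s assume s: "s \<in> {a<..<b}"
    have "((\<lambda>s. (b - s) powr (1 - \<eta>)) has_real_derivative (1 - \<eta>) * (b - s) powr (1 - \<eta> - 1) * (- 1)) (at s)"
      by (rule DERIV_chain2[OF has_real_derivative_powr]) (use s in \<open>auto intro!: derivative_eq_intros\<close>)
    from DERIV_minus[OF DERIV_cdivide[OF this, of "1 - \<eta>"]]
    have "((\<lambda>s. - ((b - s) powr (1 - \<eta>) / (1 - \<eta>))) has_real_derivative (b - s) powr (- \<eta>)) (at s)"
      using assms by simp
    thus "((\<lambda>s. - ((b - s) powr (1 - \<eta>) / (1 - \<eta>))) has_vector_derivative (b - s) powr (- \<eta>)) (at s)"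
      by (simp add: has_real_derivative_iff_has_vector_derivative)
  qed fact
  thus "((\<lambda>s. (b - s) powr (- \<eta>)) has_integral (b - a) powr (1 - \<eta>) / (1 - \<eta>)) {a..b}" by simp
qed

text \<open>Replaces the Beta integral: the larger of the two factors dominates.\<close>

lemma powr_product_le:
  fixes x y :: real
  assumes "x > 0" "y > 0" "\<theta> \<ge> 0" "\<kappa> \<ge> 0"
  shows "x powr (- \<theta>) * y powr (- \<kappa>) \<le> x powr (- (\<theta> + \<kappa>)) + y powr (- (\<theta> + \<kappa>))"
proof (cases "x \<le> y")
  case True
  hence "y powr (- \<kappa>) \<le> x powr (- \<kappa>)" using assms by (intro powr_mono2') auto
  hence "x powr (- \<theta>) * y powr (- \<kappa>) \<le> x powr (- \<theta>) * x powr (- \<kappa>)" by (intro mult_left_mono) auto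
  also have "\<dots> = x powr (- (\<theta> + \<kappa>))" by (simp flip: powr_add)
  finally show ?thesis by (simp add: add_increasing2)
next
  case False
  hence "x powr (- \<theta>) \<le> y powr (- \<theta>)" using assms by (intro powr_mono2') auto
  hence "x powr (- \<theta>) * y powr (- \<kappa>) \<le> y powr (- \<theta>) * y powr (- \<kappa>)" by (intro mult_right_mono) auto
  also have "\<dots> = y powr (- (\<theta> + \<kappa>))" by (simp flip: powr_add)
  finally show ?thesis by (simp add: add_increasing)
qed

lemma sg_symbol_diff: "sg_symbol \<mu> (t - s) k = sg_symbol \<mu> (t - r) k * sg_symbol \<mu> (r - s) k"
  unfolding sg_symbol_def exp_add[symmetric] by (rule arg_cong[of _ _ exp]) (simp add: algebra_simps)

lemma continuous_on_sg_symbol [continuous_intros]: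
  "continuous_on S f \<Longrightarrow> continuous_on S (\<lambda>t. sg_symbol \<mu> (f t) k)"
  unfolding sg_symbol_def by (intro continuous_intros)

context dyadic_heat
begin

text \<open>A block is a finite sum, so it commutes with the time integral;
  \<open>bnd_semigroup\<close> bounds the integrand by a product of two singular powers and
  \<open>powr_product_le\<close> splits it into two integrable ones, which doubles the 3 of
  \<open>bnd_semigroup\<close> to 6. The starting time \<open>t0\<close> is general so that
  uniqueness can restart there.\<close>

lemma duhamel_bound:
  assumes \<theta>: "0 \<le> \<theta>" "\<theta> + \<kappa> < 1" and \<kappa>: "0 \<le> \<kappa>" and t: "0 \<le> t0" "t0 < t" "t \<le> 1"
    and G: "\<And>s. t0 < s \<Longrightarrow> s < t \<Longrightarrow> bnd b (L * (s - t0) powr (- \<kappa>)) (G s)"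
    and z: "\<And>s k. 0 < s \<Longrightarrow> s \<le> t0 \<Longrightarrow> G s k = 0"
    and I: "\<And>k. ((\<lambda>s. sg_symbol \<mu> (t - s) k * G s k) has_integral I k) {0..t}"
  shows "bnd (b + 2 * \<theta>) (6 * CM * 2 powr \<bar>b\<bar> / (1 - (\<theta> + \<kappa>)) * L * (t - t0) powr (1 - (\<theta> + \<kappa>))) I"
  unfolding bnd_def
proof (intro allI)
  fix n x
  define \<eta> where "\<eta> = \<theta> + \<kappa>"
  have I0: "((\<lambda>s. sg_symbol \<mu> (t - s) k * G s k) has_integral I k) {t0<..<t}" for k
  proof -
    \<comment> \<open>\<open>z\<close> covers \<open>0 < s \<le> t0\<close>; the points that remain
      are 0 and \<open>t\<close>, a null set.\<close>
    have n1: "negligible {s \<in> {0..t} - {t0<..<t}. sg_symbol \<mu> (t - s) k * G s k \<noteq> 0}"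
    proof (rule negligible_subset[of "{0, t}"])
      show "{s \<in> {0..t} - {t0<..<t}. sg_symbol \<mu> (t - s) k * G s k \<noteq> 0} \<subseteq> {0, t}"
        using z[of _ k] by force
    qed auto
    have n2: "negligible {s \<in> {t0<..<t} - {0..t}. sg_symbol \<mu> (t - s) k * G s k \<noteq> 0}"
      by (rule negligible_subset[of "{}"]) (use t in auto)
    from has_integral_spike_set_eq[OF n1 n2] I[of k] show ?thesis by (rule iffD1)
  qed
  define f where "f s = blk n (\<lambda>k. sg_symbol \<mu> (t - s) k * G s k) x" for s
  have f: "(f has_integral blk n I x) {t0<..<t}"
    unfolding f_def blk_lp_box
    by (intro has_integral_sum has_integral_mult_left has_integral_mult_right I0) auto
  define c where "c = 3 * CM * 2 powr \<bar>b\<bar> * L * 2 powr (- ((b + 2 * \<theta>) * real n))"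
  define g where "g s = c * ((t - s) powr (- \<eta>) + (s - t0) powr (- \<eta>))" for s
  have g: "(g has_integral c * ((t - t0) powr (1 - \<eta>) / (1 - \<eta>) + (t - t0) powr (1 - \<eta>) / (1 - \<eta>))) {t0<..<t}"
    unfolding g_def has_integral_Icc_iff_Ioo[symmetric] using t \<theta>
    by (intro has_integral_mult_right has_integral_add powr_singular_integral) (auto simp: \<eta>_def)
  have "norm (integral {t0<..<t} f) \<le> integral {t0<..<t} g"
  proof (rule integral_norm_bound_integral)
    fix s assume s: "s \<in> {t0<..<t}"
    have "bnd (b + 2 * \<theta>) (3 * CM * 2 powr \<bar>b\<bar> * (L * (s - t0) powr (- \<kappa>)) * (t - s) powr (- \<theta>))
       (\<lambda>k. sg_symbol \<mu> (t - s) k * G s k)"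
      using s t \<theta> \<kappa> by (intro bnd_semigroup G) auto
    from bndD[OF this, of n x]
    have "norm (f s) \<le> c * ((t - s) powr (- \<theta>) * (s - t0) powr (- \<kappa>))"
      by (simp add: f_def c_def mult_ac)
    also have "c * ((t - s) powr (- \<theta>) * (s - t0) powr (- \<kappa>)) \<le> g s"
    proof -
      have "L * (s - t0) powr (- \<kappa>) \<ge> 0" using bnd_nonneg[OF G[of s]] s by simp
      hence "L \<ge> 0" using s by (simp add: zero_le_mult_iff)
      hence "c \<ge> 0" using CM by (simp add: c_def)
      thus ?thesis unfolding g_def \<eta>_def using s \<theta> \<kappa>
        by (intro mult_left_mono powr_product_le) auto
    qed
    finally show "norm (f s) \<le> g s" .
  qed (use f g in auto)
  hence "norm (blk n I x) \<le> c * ((t - t0) powr (1 - \<eta>) / (1 - \<eta>) + (t - t0) powr (1 - \<eta>) / (1 - \<eta>))"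
    using integral_unique[OF f] integral_unique[OF g] by simp
  thus "norm (blk n I x) \<le> 6 * CM * 2 powr \<bar>b\<bar> / (1 - (\<theta> + \<kappa>)) * L * (t - t0) powr (1 - (\<theta> + \<kappa>)) *
      2 powr (- ((b + 2 * \<theta>) * real n))"
    by (simp add: c_def \<eta>_def mult_ac)
qed

lemma duhamel_integrable:
  assumes \<kappa>: "\<kappa> < 1" and t: "0 \<le> t"
    and G: "\<And>s. 0 < s \<Longrightarrow> s < t \<Longrightarrow> bnd b (L * s powr (- \<kappa>)) (G s)"
    and m: "(\<lambda>s. G s k) \<in> borel_measurable (lebesgue_on {0<..<t})"
  shows "(\<lambda>s. sg_symbol \<mu> (t - s) k * G s k) integrable_on {0..t}"
proof -
  obtain B where B: "B \<ge> 0" "\<And>C f. bnd b C f \<Longrightarrow> norm (f k) \<le> B * C" using bnd_coeff by metis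
  have c: "continuous_on {0..t} (\<lambda>s. sg_symbol \<mu> (t - s) k)" by (intro continuous_intros)
  hence "bounded ((\<lambda>s. sg_symbol \<mu> (t - s) k) ` {0..t})"
    by (intro compact_imp_bounded compact_continuous_image) auto
  then obtain E where "\<forall>s\<in>{0..t}. norm (sg_symbol \<mu> (t - s) k) \<le> E" by (auto simp: bounded_iff)
  hence E: "\<And>s. s \<in> {0..t} \<Longrightarrow> norm (sg_symbol \<mu> (t - s) k) \<le> E" by blast
  have E0: "E \<ge> 0" using order.trans[OF norm_ge_zero E[of t]] t by simp
  have "(\<lambda>s. sg_symbol \<mu> (t - s) k * G s k) integrable_on {0<..<t}"
  proof (rule measurable_bounded_by_integrable_imp_integrable)
    have "(\<lambda>s. sg_symbol \<mu> (t - s) k) \<in> borel_measurable (lebesgue_on {0<..<t})"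
      by (intro continuous_imp_measurable_on_sets_lebesgue continuous_intros) auto
    thus "(\<lambda>s. sg_symbol \<mu> (t - s) k * G s k) \<in> borel_measurable (lebesgue_on {0<..<t})"
      by (intro borel_measurable_times m)
    have "((\<lambda>s. E * (B * (L * (s - 0) powr (- \<kappa>)))) has_integral
       E * (B * (L * ((t - 0) powr (1 - \<kappa>) / (1 - \<kappa>))))) {0..t}"
      using t \<kappa> by (intro has_integral_mult_right powr_singular_integral) auto
    thus "(\<lambda>s. E * (B * (L * s powr (- \<kappa>)))) integrable_on {0<..<t}"
      by (simp only: has_integral_Icc_iff_Ioo diff_0_right) (rule has_integral_integrable)
    fix s assume s: "s \<in> {0<..<t}"
    show "norm (sg_symbol \<mu> (t - s) k * G s k) \<le> E * (B * (L * s powr (- \<kappa>)))"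
      unfolding norm_mult using s B(2)[OF G[of s]] E[of s] E0 by (intro mult_mono) auto
  qed auto
  thus ?thesis by (simp add: integrable_on_Icc_iff_Ioo)
qed

text \<open>On a single coefficient the symbol makes sense at the negative time
  \<open>t - T\<close>; factoring it out leaves an indefinite integral of one fixed
  integrand.\<close>

lemma duhamel_continuous:
  assumes "(\<lambda>s. sg_symbol \<mu> (T - s) k * G s k) integrable_on {0..T}"
  shows "continuous_on {0..T} (\<lambda>t. integral {0..t} (\<lambda>s. sg_symbol \<mu> (t - s) k * G s k))"
proof -
  have "integral {0..t} (\<lambda>s. sg_symbol \<mu> (t - s) k * G s k)
     = sg_symbol \<mu> (t - T) k * integral {0..t} (\<lambda>s. sg_symbol \<mu> (T - s) k * G s k)" for t
    by (subst sg_symbol_diff[of _ _ _ _ T]) (simp add: mult.assoc)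
  thus ?thesis by (simp only:) (intro continuous_intros indefinite_integral_continuous_1 assms)
qed

end

section \<open>Continuity in time\<close>

context dyadic
begin

lemma cont_besov_coeff:
  assumes "cont_besov chi rho a S V"
  shows "continuous_on S (\<lambda>t. V t k)"
proof -
  obtain B where B: "B \<ge> 0" "\<And>C f. bnd a C f \<Longrightarrow> norm (f k) \<le> B * C" using bnd_coeff by metis
  have "\<exists>d>0. \<forall>s\<in>S. dist s t < d \<longrightarrow> dist (V s k) (V t k) < e" if t: "t \<in> S" and e: "e > 0" for t e
  proof -
    define \<epsilon> where "\<epsilon> = e / ((B + 1) * 2 powr a)"
    have \<epsilon>: "\<epsilon> > 0" using e B by (simp add: \<epsilon>_def)
    obtain d where d: "d > 0" "\<And>s. s \<in> S \<Longrightarrow> \<bar>s - t\<bar> < d \<Longrightarrow> besov_norm chi rho a (\<lambda>k. V s k - V t k) < \<epsilon>"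
      using assms t \<epsilon> unfolding cont_besov_def by metis
    have "dist (V s k) (V t k) < e" if s: "s \<in> S" "dist s t < d" for s
    proof -
      have ib: "in_besov chi rho a (V s)" "in_besov chi rho a (V t)"
        using assms s t by (auto simp: cont_besov_def)
      \<comment> \<open>For a function outside the space \<open>besov_norm\<close> is a junk
        supremum, so membership has to precede the use of its small value.\<close>
      have "in_besov chi rho a (\<lambda>k. V s k - V t k)"
        by (rule bnd_besov(1)[OF bnd_diff[OF besov_bnd[OF ib(1) order.refl] besov_bnd[OF ib(2) order.refl]]])
      hence "bnd a (2 powr a * \<epsilon>) (\<lambda>k. V s k - V t k)"
        using d(2)[of s] s by (intro besov_bnd) (auto simp: dist_real_def)
      hence "norm (V s k - V t k) \<le> B * (2 powr a * \<epsilon>)" by (rule B(2))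
      also have "\<dots> = e * (B / (B + 1))" by (simp add: \<epsilon>_def)
      also have "\<dots> < e * 1" using B(1) e by (intro mult_strict_left_mono) auto
      finally have "norm (V s k - V t k) < e" by simp
      thus ?thesis by (simp add: dist_norm)
    qed
    thus ?thesis using d(1) by blast
  qed
  thus ?thesis by (simp add: continuous_on_iff)
qed

text \<open>Interpolation: high frequencies are controlled by the slightly stronger norm, and the
  low frequencies involve only finitely many coefficients.\<close>

lemma cont_besovI:
  assumes a: "a < a'"
    and c: "\<And>k. continuous_on S (\<lambda>t. V t k)"
    and b: "\<And>t. t \<in> S \<Longrightarrow> \<exists>d>0. \<exists>C. \<forall>s\<in>S. \<bar>s - t\<bar> < d \<longrightarrow> bnd a' C (V s)"
  shows "cont_besov chi rho a S V"
  unfolding cont_besov_def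
proof (intro conjI ballI allI impI)
  fix t assume t: "t \<in> S"
  then obtain d C where d: "d > 0" and C: "\<And>s. s \<in> S \<Longrightarrow> \<bar>s - t\<bar> < d \<Longrightarrow> bnd a' C (V s)"
    using b by metis
  have Ct: "bnd a' C (V t)" using C[OF t] d by simp
  show "in_besov chi rho a (V t)" by (rule bnd_besov[OF bnd_weaken[OF Ct]]) (use a in simp)
  fix \<epsilon> :: real assume \<epsilon>: "\<epsilon> > 0"
  define e where "e = 2 powr a * \<epsilon> / 2"
  have e: "e > 0" using \<epsilon> by (simp add: e_def)
  define r where "r = 2 powr (- (a' - a))"
  have r: "0 < r" "r < 1" using a by (auto simp: r_def powr_less_one)
  have "(\<lambda>n. (C + C) * r ^ n) \<longlonglongrightarrow> (C + C) * 0"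
    using r by (intro tendsto_mult_left LIMSEQ_power_zero) auto
  hence "\<forall>\<^sub>F n in sequentially. (C + C) * r ^ n < e"
    using e by (intro order_tendstoD(2)) auto
  then obtain n0 where n0: "\<And>n. n \<ge> n0 \<Longrightarrow> (C + C) * r ^ n < e" by (auto simp: eventually_sequentially)
  have "\<forall>\<^sub>F s in at t within S. \<forall>n\<in>{..<n0}. (\<Sum>k\<in>lp_box (int n - 1). norm (V s k - V t k)) < e * 2 powr (- (a * real n))"
  proof (intro eventually_ball_finite ballI)
    fix n assume "n \<in> {..<n0}"
    have "((\<lambda>s. \<Sum>k\<in>lp_box (int n - 1). norm (V s k - V t k)) \<longlongrightarrow> (\<Sum>k\<in>lp_box (int n - 1). norm (V t k - V t k))) (at t within S)"
      using c t by (intro tendsto_intros) (auto simp: continuous_on_def)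
    thus "\<forall>\<^sub>F s in at t within S. (\<Sum>k\<in>lp_box (int n - 1). norm (V s k - V t k)) < e * 2 powr (- (a * real n))"
      using e by (intro order_tendstoD(2)) auto
  qed auto
  then obtain d' where d': "d' > 0" "\<And>s n. s \<in> S \<Longrightarrow> s \<noteq> t \<Longrightarrow> \<bar>s - t\<bar> < d' \<Longrightarrow> n < n0 \<Longrightarrow>
      (\<Sum>k\<in>lp_box (int n - 1). norm (V s k - V t k)) < e * 2 powr (- (a * real n))"
    unfolding eventually_at dist_real_def by blast
  show "\<exists>\<delta>>0. \<forall>s\<in>S. \<bar>s - t\<bar> < \<delta> \<longrightarrow> besov_norm chi rho a (\<lambda>k. V s k - V t k) < \<epsilon>"
  proof (intro exI[of _ "min d d'"] conjI ballI impI)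
    fix s assume s: "s \<in> S" "\<bar>s - t\<bar> < min d d'"
    have D: "bnd a' (C + C) (\<lambda>k. V s k - V t k)" using C[of s] s Ct by (intro bnd_diff) auto
    have "bnd a e (\<lambda>k. V s k - V t k)"
      unfolding bnd_def
    proof (intro allI)
      fix n x
      show "norm (blk n (\<lambda>k. V s k - V t k) x) \<le> e * 2 powr (- (a * real n))"
      proof (cases "n < n0")
        case True
        have "norm (blk n (\<lambda>k. V s k - V t k) x) \<le> (\<Sum>k\<in>lp_box (int n - 1). norm (V s k - V t k))"
          unfolding blk_lp_box
          by (intro sum_norm_le) (use wt_nonneg wt_le_1 in \<open>simp add: norm_mult mult_left_le_one_le\<close>)
        also have "\<dots> \<le> e * 2 powr (- (a * real n))"
          using d'(2)[of s n] s True e by (cases "s = t") auto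
        finally show ?thesis .
      next
        case False
        have "norm (blk n (\<lambda>k. V s k - V t k) x) \<le> (C + C) * 2 powr (- (a' * real n))" by (rule bndD[OF D])
        also have "\<dots> = (C + C) * r ^ n * 2 powr (- (a * real n))"
          unfolding r_def two_powr_nat[symmetric] mult.assoc powr_add[symmetric] by (simp add: algebra_simps)
        also have "\<dots> \<le> e * 2 powr (- (a * real n))"
          using n0[of n] False by (intro mult_right_mono) auto
        finally show ?thesis .
      qed
    qed
    from bnd_besov(2)[OF this] have "besov_norm chi rho a (\<lambda>k. V s k - V t k) \<le> \<epsilon> / 2"
      by (simp add: e_def powr_minus field_simps)
    thus "besov_norm chi rho a (\<lambda>k. V s k - V t k) < \<epsilon>" using \<epsilon> by simp
  qed (use d d' in auto)
qed

end

section \<open>Uniqueness\<close>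

context dyadic
begin

definition zbnd :: "real \<Rightarrow> real \<Rightarrow> (real \<Rightarrow> distr) \<Rightarrow> (real \<Rightarrow> distr) \<Rightarrow> (real \<Rightarrow> distr) \<Rightarrow> (real \<Rightarrow> distr) \<Rightarrow> real \<Rightarrow> bool" where
  "zbnd al R Z Z2 Zab Zab2 s \<longleftrightarrow> bnd (- al) R (Z s) \<and> bnd (- al) (R * s powr (- al)) (Z2 s) \<and>
     bnd (- al) (R * s powr (- al)) (Zab s) \<and> bnd (- al) (R * s powr (- al)) (Zab2 s)"

lemma besov_bnd_neg:
  assumes "in_besov chi rho (- al) f" "besov_norm chi rho (- al) f \<le> C" "al \<ge> 0"
  shows "bnd (- al) C f"
proof -
  have "0 \<le> C" using besov_norm_nonneg[OF assms(1)] assms(2) by linarith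
  moreover have "2 powr (- al) \<le> 2 powr 0" using assms(3) by (intro powr_mono) auto
  ultimately have "2 powr (- al) * C \<le> C" by (intro mult_left_le_one_le) auto
  with besov_bnd[OF assms(1,2)] show ?thesis by (rule bnd_mono)
qed

lemma in_Zset_zbnd:
  assumes Z: "in_Zset chi rho Z Z2 Zab Zab2" and al: "al > 0" and t: "t > 0"
    and R: "znorm chi rho al Z Z2 Zab Zab2 t \<le> R"
  shows "zbnd al R Z Z2 Zab Zab2 t"
proof -
  have c: "cont_besov chi rho (- al) {0..} Z" "cont_besov chi rho (- al) {0<..} Z2"
    "cont_besov chi rho (- al) {0<..} Zab" "cont_besov chi rho (- al) {0<..} Zab2"
    using Z al by (auto simp: in_Zset_def)
  have ib: "in_besov chi rho (- al) (Z t)" "in_besov chi rho (- al) (Z2 t)"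
    "in_besov chi rho (- al) (Zab t)" "in_besov chi rho (- al) (Zab2 t)"
    using c t unfolding cont_besov_def by auto
  have p: "b \<le> R * t powr (- al)" if "t powr al * b \<le> R" for b
    using that t by (simp add: powr_minus field_simps)
  show ?thesis
    unfolding zbnd_def using R ib al unfolding znorm_def
    by (auto intro!: besov_bnd_neg p)
qed

lemma in_Zset_measurable:
  assumes Z: "in_Zset chi rho Z Z2 Zab Zab2"
  shows "(\<lambda>t. Z t k) \<in> borel_measurable (lebesgue_on {0<..T})" "(\<lambda>t. Z2 t k) \<in> borel_measurable (lebesgue_on {0<..T})"
    "(\<lambda>t. Zab t k) \<in> borel_measurable (lebesgue_on {0<..T})" "(\<lambda>t. Zab2 t k) \<in> borel_measurable (lebesgue_on {0<..T})"
proof -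
  have c: "cont_besov chi rho (- 1) {0..} Z" "cont_besov chi rho (- 1) {0<..} Z2"
    "cont_besov chi rho (- 1) {0<..} Zab" "cont_besov chi rho (- 1) {0<..} Zab2"
    using Z by (auto simp: in_Zset_def)
  have m: "(\<lambda>t. V t k) \<in> borel_measurable (lebesgue_on {0<..T})"
    if "cont_besov chi rho (- 1) S V" "{0<..T} \<subseteq> S" for V S
    by (intro continuous_imp_measurable_on_sets_lebesgue
          continuous_on_subset[OF cont_besov_coeff[OF that(1)] that(2)]) auto
  show "(\<lambda>t. Z t k) \<in> borel_measurable (lebesgue_on {0<..T})" "(\<lambda>t. Z2 t k) \<in> borel_measurable (lebesgue_on {0<..T})"
    "(\<lambda>t. Zab t k) \<in> borel_measurable (lebesgue_on {0<..T})" "(\<lambda>t. Zab2 t k) \<in> borel_measurable (lebesgue_on {0<..T})"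
    by (rule m[OF c(1)], simp add: subset_iff, rule m[OF c(2)], simp add: subset_iff,
        rule m[OF c(3)], simp add: subset_iff, rule m[OF c(4)], simp add: subset_iff)
qed

lemma bnd_halving_imp_zero:
  assumes "\<And>i::nat. bnd a (c / 2 ^ i) f" shows "f k = 0"
proof (rule bnd_all_imp_zero)
  fix \<epsilon> :: real assume \<epsilon>: "\<epsilon> > 0"
  obtain i where "c / \<epsilon> < 2 ^ i" using real_arch_pow[of 2 "c / \<epsilon>"] by auto
  hence "c / 2 ^ i \<le> \<epsilon>" using \<epsilon> by (simp add: field_simps)
  thus "bnd a \<epsilon> f" by (rule bnd_mono[OF assms])
qed

end

text \<open>\<open>a\<close> is the regularity of the remainder, \<open>- al\<close> that of the
  noise and \<open>\<gamma>\<close> the time weight. \<open>al \<le> 2 * \<gamma>\<close> lets the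
  singularity of the noise components hide behind that of \<open>Y\<close> squared, and the last
  inequality leaves a positive power of time after the Duhamel integral.\<close>

locale mild_exponents = dyadic_heat +
  fixes \<nu> :: complex and lam a al \<gamma> CP :: real
  assumes exponents: "0 < al" "al < a" "0 < \<gamma>" "al \<le> 2 * \<gamma>" "(a + al) / 2 + 3 * \<gamma> < 1"
    and CP: "CP > 0"
    and Psi_growth: "\<And>R s y Z Z2 Zab Zab2. R \<ge> 1 \<Longrightarrow> 0 < s \<Longrightarrow> s \<le> 1 \<Longrightarrow> bnd a (R * s powr (- \<gamma>)) y \<Longrightarrow>
        zbnd al R Z Z2 Zab Zab2 s \<Longrightarrow>
        bnd (- al) (CP * R^3 * s powr (- (3 * \<gamma>))) (Psi chi rho \<nu> lam y (Z s) (Z2 s) (Zab s) (Zab2 s))"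
    and Psi_difference: "\<And>R U s y y' Z Z2 Zab Zab2. R \<ge> 1 \<Longrightarrow> 0 < s \<Longrightarrow> s \<le> 1 \<Longrightarrow>
        bnd a (R * s powr (- \<gamma>)) y \<Longrightarrow> bnd a (R * s powr (- \<gamma>)) y' \<Longrightarrow> zbnd al R Z Z2 Zab Zab2 s \<Longrightarrow>
        bnd a (U * s powr (- \<gamma>)) (\<lambda>k. y k - y' k) \<Longrightarrow>
        bnd (- al) (CP * R^2 * U * s powr (- (3 * \<gamma>)))
          (\<lambda>k. Psi chi rho \<nu> lam y (Z s) (Z2 s) (Zab s) (Zab2 s) k
             - Psi chi rho \<nu> lam y' (Z s) (Z2 s) (Zab s) (Zab2 s) k)"

text \<open>\<open>Psi_bounds\<close> is applied with \<open>M = R * s powr (- \<gamma>)\<close>,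
  which is at least 1 for \<open>s \<le> 1\<close>. Then \<open>M^2\<close> and \<open>M^3\<close>
  dominate \<open>R * s powr (- al)\<close> because \<open>al \<le> 2 * \<gamma>\<close>, and
  \<open>M^3\<close> gives the exponent \<open>3 * \<gamma>\<close>.\<close>

lemma (in dyadic_heat) mild_exponents_exists:
  assumes e: "0 < al" "al < a" "0 < \<gamma>" "al \<le> 2 * \<gamma>" "(a + al) / 2 + 3 * \<gamma> < 1"
  obtains CP where "mild_exponents chi rho \<mu> CM \<nu> lam a al \<gamma> CP"
proof -
  obtain C where C: "C > 0"
    "\<And>M Y Z Z2 Zab Zab2. M \<ge> 1 \<Longrightarrow> bnd a M Y \<Longrightarrow> bnd (- al) M Z \<Longrightarrow>
       bnd (- al) (M^2) Z2 \<Longrightarrow> bnd (- al) (M^2) Zab \<Longrightarrow> bnd (- al) (M^3) Zab2 \<Longrightarrow>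
       bnd (- al) (C * M^3) (Psi chi rho \<nu> lam Y Z Z2 Zab Zab2)"
    "\<And>M d Y Y' Z Z2 Zab Zab2. M \<ge> 1 \<Longrightarrow> bnd a M Y \<Longrightarrow> bnd a M Y' \<Longrightarrow> bnd (- al) M Z \<Longrightarrow>
       bnd (- al) (M^2) Z2 \<Longrightarrow> bnd (- al) (M^2) Zab \<Longrightarrow> bnd a d (\<lambda>k. Y k - Y' k) \<Longrightarrow>
       bnd (- al) (C * M^2 * d)
         (\<lambda>k. Psi chi rho \<nu> lam Y Z Z2 Zab Zab2 k - Psi chi rho \<nu> lam Y' Z Z2 Zab Zab2 k)"
    by (rule Psi_bounds[OF e(1,2)]) (rule that, assumption+)
  have pw: "(s powr (- \<gamma>)) ^ n = s powr (- (real n * \<gamma>))" if "0 < s" for s and n :: nat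
    using that by (simp add: powr_realpow[symmetric] powr_powr mult_ac)
  have pw2: "(R * s powr (- \<gamma>)) ^ 2 = R ^ 2 * s powr (- (2 * \<gamma>))" and
    pw3: "(R * s powr (- \<gamma>)) ^ 3 = R ^ 3 * s powr (- (3 * \<gamma>))" if "0 < s" for R s
    using pw[OF that, of 2] pw[OF that, of 3] by (simp_all add: power_mult_distrib)
  have M: "R * s powr (- \<gamma>) \<ge> 1" "bnd (- al) (R * s powr (- \<gamma>)) (Z s)"
    "bnd (- al) ((R * s powr (- \<gamma>))^2) (Z2 s)" "bnd (- al) ((R * s powr (- \<gamma>))^2) (Zab s)"
    "bnd (- al) ((R * s powr (- \<gamma>))^3) (Zab2 s)"
    if R: "R \<ge> 1" and s: "0 < s" "s \<le> 1" and z: "zbnd al R Z Z2 Zab Zab2 s" for R s Z Z2 Zab Zab2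
  proof -
    have m: "s powr (- p) \<le> s powr (- q)" if "p \<le> q" for p q
      using s that by (intro powr_mono') auto
    have r: "R \<le> R ^ 2" "R \<le> R ^ 3" using R self_le_power[of R 2] self_le_power[of R 3] by auto
    have "1 * s powr (- 0) \<le> R * s powr (- \<gamma>)" using R e by (intro mult_mono m) auto
    thus "R * s powr (- \<gamma>) \<ge> 1" using s by simp
    have "R * s powr (- 0) \<le> R * s powr (- \<gamma>)" using R e by (intro mult_mono m) auto
    thus "bnd (- al) (R * s powr (- \<gamma>)) (Z s)" using z s unfolding zbnd_def by (auto intro: bnd_mono)
    have 2: "R * s powr (- al) \<le> (R * s powr (- \<gamma>))^2"
      unfolding pw2[OF s(1)] using R r e by (intro mult_mono m) auto
    have 3: "R * s powr (- al) \<le> (R * s powr (- \<gamma>))^3"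
      unfolding pw3[OF s(1)] using R r e by (intro mult_mono m) auto
    show "bnd (- al) ((R * s powr (- \<gamma>))^2) (Z2 s)" "bnd (- al) ((R * s powr (- \<gamma>))^2) (Zab s)"
      "bnd (- al) ((R * s powr (- \<gamma>))^3) (Zab2 s)"
      using z 2 3 unfolding zbnd_def by (auto intro: bnd_mono)
  qed
  have "mild_exponents chi rho \<mu> CM \<nu> lam a al \<gamma> C"
  proof (unfold_locales, goal_cases)
    case (7 R s y Z Z2 Zab Zab2)
    note M = M[OF 7(1,2,3,5)]
    from C(2)[OF M(1) 7(4) M(2-5)] show ?case unfolding pw3[OF 7(2)] by (simp only: mult.assoc)
  next
    case (8 R U s y y' Z Z2 Zab Zab2)
    note M = M[OF 8(1,2,3,6)]
    have "s powr (- (2 * \<gamma>)) * s powr (- \<gamma>) = s powr (- (3 * \<gamma>))"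
      by (simp flip: powr_add)
    hence "C * (R * s powr (- \<gamma>))^2 * (U * s powr (- \<gamma>)) = C * R^2 * U * s powr (- (3 * \<gamma>))"
      unfolding pw2[OF 8(2)] by (simp add: mult_ac)
    with C(3)[OF M(1) 8(4,5) M(2-4) 8(7), of "Zab2 s"] show ?case by simp
  qed (use e C(1) in auto)
  thus ?thesis by (rule that)
qed

section \<open>Gain of the Duhamel integral and length of the time step\<close>

context mild_exponents
begin

definition \<eta> :: real where "\<eta> = (a + al) / 2 + 3 * \<gamma>"

definition KD :: real where "KD = 6 * CM * 2 powr \<bar>- al\<bar> / (1 - \<eta>)"

lemma KD_pos: "KD > 0"
  using CM exponents by (simp add: KD_def \<eta>_def)

text \<open>The case \<open>\<theta> = (a + al) / 2\<close>, which lifts \<open>- al\<close> to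
  \<open>a\<close>. The singularity at 0 is replaced by the larger one at \<open>t0\<close>, so the
  gain depends on \<open>t - t0\<close> alone.\<close>

lemma duhamel_gain:
  assumes t: "0 \<le> t0" "t0 < t" "t \<le> 1" and L: "L \<ge> 0"
    and G: "\<And>s. t0 < s \<Longrightarrow> s < t \<Longrightarrow> bnd (- al) (L * s powr (- (3 * \<gamma>))) (G s)"
    and z: "\<And>s k. 0 < s \<Longrightarrow> s \<le> t0 \<Longrightarrow> G s k = 0"
    and I: "\<And>k. ((\<lambda>s. sg_symbol \<mu> (t - s) k * G s k) has_integral I k) {0..t}"
  shows "bnd a (KD * L * (t - t0) powr (1 - \<eta>)) I"
proof -
  have G': "bnd (- al) (L * (s - t0) powr (- (3 * \<gamma>))) (G s)" if s: "t0 < s" "s < t" for s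
  proof (rule bnd_mono[OF G[OF s]])
    show "L * s powr (- (3 * \<gamma>)) \<le> L * (s - t0) powr (- (3 * \<gamma>))"
      using s t L exponents by (intro mult_left_mono powr_mono2') auto
  qed
  have "bnd (- al + 2 * ((a + al) / 2)) (6 * CM * 2 powr \<bar>- al\<bar> / (1 - ((a + al) / 2 + 3 * \<gamma>)) * L *
      (t - t0) powr (1 - ((a + al) / 2 + 3 * \<gamma>))) I"
    by (rule duhamel_bound[where G = G]) (use exponents t G' z I in auto)
  moreover have "- al + 2 * ((a + al) / 2) = a" by (simp add: field_simps)
  ultimately show ?thesis by (simp only: KD_def \<eta>_def)
qed

lemma contraction_time:
  assumes "R \<ge> 1"
  obtains \<delta> where "\<delta> > 0" "\<delta> \<le> 1" "\<And>t. 0 \<le> t \<Longrightarrow> t \<le> \<delta> \<Longrightarrow> KD * CP * R^2 * t powr (1 - \<eta>) \<le> 1/2"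
proof -
  define q where "q = KD * CP * R^2"
  have q: "q \<ge> 0" using KD_pos CP by (simp add: q_def)
  have e: "\<eta> < 1" using exponents by (simp add: \<eta>_def)
  \<comment> \<open>Chosen so that \<open>\<delta> powr (1 - \<eta>) = 1 / (2 * (q + 1))\<close>;
    the shift to \<open>q + 1\<close> keeps the denominator positive.\<close>
  define \<delta> where "\<delta> = (1 / (2 * (q + 1))) powr (1 / (1 - \<eta>))"
  show ?thesis
  proof (rule that[of "min 1 \<delta>"])
    show "min 1 \<delta> > 0" using q by (simp add: \<delta>_def)
    fix t assume t: "0 \<le> t" "t \<le> min 1 \<delta>"
    have "t powr (1 - \<eta>) \<le> \<delta> powr (1 - \<eta>)" using t e by (intro powr_mono2) auto
    also have "\<dots> = 1 / (2 * (q + 1))" using e q by (simp add: \<delta>_def powr_powr)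
    finally have "q * t powr (1 - \<eta>) \<le> q * (1 / (2 * (q + 1)))" using q by (intro mult_left_mono)
    also have "\<dots> \<le> 1/2" using q by (simp add: field_simps)
    finally show "KD * CP * R^2 * t powr (1 - \<eta>) \<le> 1/2" by (simp add: q_def)
  qed simp
qed

lemma powr_neg_ge_1: "0 < t \<Longrightarrow> t \<le> 1 \<Longrightarrow> 1 \<le> t powr (- \<gamma>)"
  using powr_mono'[of "- \<gamma>" 0 t] exponents by simp

text \<open>One step of the continuation argument: since the length \<open>\<delta>\<close> of the step does not depend
  on the starting time, finitely many steps exhaust the interval.\<close>

lemma uniqueness_step:
  assumes R: "R \<ge> 1" and T: "T \<le> 1"
    and \<delta>: "\<And>t. 0 \<le> t \<Longrightarrow> t \<le> \<delta> \<Longrightarrow> KD * CP * R^2 * t powr (1 - \<eta>) \<le> 1/2"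
    and Y: "\<And>s. 0 < s \<Longrightarrow> s \<le> T \<Longrightarrow> bnd a (R * s powr (- \<gamma>)) (Y s)"
    and Y': "\<And>s. 0 < s \<Longrightarrow> s \<le> T \<Longrightarrow> bnd a (R * s powr (- \<gamma>)) (Y' s)"
    and Z: "\<And>s. 0 < s \<Longrightarrow> s \<le> T \<Longrightarrow> zbnd al R Z Z2 Zab Zab2 s"
    and I: "\<And>t k. 0 < t \<Longrightarrow> t \<le> T \<Longrightarrow> ((\<lambda>s. sg_symbol \<mu> (t - s) k *
        (Psi chi rho \<nu> lam (Y s) (Z s) (Z2 s) (Zab s) (Zab2 s) k
         - Psi chi rho \<nu> lam (Y' s) (Z s) (Z2 s) (Zab s) (Zab2 s) k)) has_integral (Y t k - Y' t k)) {0..t}"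
    and t0: "0 \<le> t0" and eq: "\<And>s. 0 < s \<Longrightarrow> s \<le> t0 \<Longrightarrow> Y s = Y' s"
    and t: "0 < t" "t \<le> T" "t \<le> t0 + \<delta>"
  shows "Y t = Y' t"
proof -
  define G where "G s k = Psi chi rho \<nu> lam (Y s) (Z s) (Z2 s) (Zab s) (Zab2 s) k
         - Psi chi rho \<nu> lam (Y' s) (Z s) (Z2 s) (Zab s) (Zab2 s) k" for s k
  \<comment> \<open>The difference is bounded by \<open>2 * R\<close> from the start, and each pass
    through the equation halves the bound; this replaces a supremum over the paths.\<close>
  have halving: "\<And>t. 0 < t \<Longrightarrow> t \<le> T \<Longrightarrow> t \<le> t0 + \<delta> \<Longrightarrow> bnd a (2 * R / 2 ^ i * t powr (- \<gamma>)) (\<lambda>k. Y t k - Y' t k)" for i :: nat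
  proof (induction i)
    case (0 t)
    have "2 * R / 2 ^ 0 * t powr (- \<gamma>) = R * t powr (- \<gamma>) + R * t powr (- \<gamma>)" by simp
    thus ?case using bnd_diff[OF Y[OF 0(1,2)] Y'[OF 0(1,2)]] by (simp only:)
  next
    case (Suc i t)
    define U where "U = 2 * R / 2 ^ i"
    have U: "U \<ge> 0" using R by (simp add: U_def)
    show ?case
    proof (cases "t \<le> t0")
      case True
      thus ?thesis using eq[of t] Suc.prems R by (simp add: bnd_zero)
    next
      case False
      have "bnd a (KD * (CP * R^2 * U) * (t - t0) powr (1 - \<eta>)) (\<lambda>k. Y t k - Y' t k)"
      proof (rule duhamel_gain[of t0 t _ G])
        fix s assume s: "t0 < s" "s < t"
        hence s': "0 < s" "s \<le> T" "s \<le> t0 + \<delta>" using t0 Suc.prems by auto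
        show "bnd (- al) (CP * R^2 * U * s powr (- (3 * \<gamma>))) (G s)"
          unfolding G_def using Suc.IH[OF s'] T s' R Y[OF s'(1,2)] Y'[OF s'(1,2)] Z[OF s'(1,2)]
          by (intro Psi_difference) (auto simp: U_def)
      qed (use Suc.prems False t0 T U CP eq I[of t, folded G_def] in \<open>auto simp: G_def\<close>)
      thus ?thesis
      proof (rule bnd_mono)
        have "KD * (CP * R^2 * U) * (t - t0) powr (1 - \<eta>) = (KD * CP * R^2 * (t - t0) powr (1 - \<eta>)) * U"
          by (simp add: mult_ac)
        also have "\<dots> \<le> 1/2 * U" using Suc.prems False U by (intro mult_right_mono \<delta>) auto
        also have "\<dots> * 1 \<le> 1/2 * U * t powr (- \<gamma>)"
          using U Suc.prems T by (intro mult_left_mono powr_neg_ge_1) auto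
        finally show "KD * (CP * R^2 * U) * (t - t0) powr (1 - \<eta>) \<le> 2 * R / 2 ^ Suc i * t powr (- \<gamma>)"
          by (simp add: U_def)
      qed
    qed
  qed
  have "Y t k - Y' t k = 0" for k
  proof (rule bnd_halving_imp_zero[where c = "2 * R * t powr (- \<gamma>)"])
    fix i :: nat
    show "bnd a (2 * R * t powr (- \<gamma>) / 2 ^ i) (\<lambda>k. Y t k - Y' t k)" using halving[OF t, of i] by simp
  qed
  thus ?thesis by (simp add: fun_eq_iff)
qed

lemma uniqueness:
  assumes R: "R \<ge> 1" and T: "T \<le> 1"
    and Y: "\<And>s. 0 < s \<Longrightarrow> s \<le> T \<Longrightarrow> bnd a (R * s powr (- \<gamma>)) (Y s)"
    and Y': "\<And>s. 0 < s \<Longrightarrow> s \<le> T \<Longrightarrow> bnd a (R * s powr (- \<gamma>)) (Y' s)"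
    and Z: "\<And>s. 0 < s \<Longrightarrow> s \<le> T \<Longrightarrow> zbnd al R Z Z2 Zab Zab2 s"
    and I: "\<And>t k. 0 < t \<Longrightarrow> t \<le> T \<Longrightarrow> ((\<lambda>s. sg_symbol \<mu> (t - s) k *
        (Psi chi rho \<nu> lam (Y s) (Z s) (Z2 s) (Zab s) (Zab2 s) k
         - Psi chi rho \<nu> lam (Y' s) (Z s) (Z2 s) (Zab s) (Zab2 s) k)) has_integral (Y t k - Y' t k)) {0..t}"
    and t: "0 < t" "t \<le> T"
  shows "Y t = Y' t"
proof -
  obtain \<delta> where \<delta>: "\<delta> > 0" "\<delta> \<le> 1" "\<And>t. 0 \<le> t \<Longrightarrow> t \<le> \<delta> \<Longrightarrow> KD * CP * R^2 * t powr (1 - \<eta>) \<le> 1/2"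
    by (rule contraction_time[OF R]) (rule that, assumption+)
  have steps: "\<And>t. 0 < t \<Longrightarrow> t \<le> T \<Longrightarrow> t \<le> real n * \<delta> \<Longrightarrow> Y t = Y' t" for n :: nat
  proof (induction n)
    case (Suc n t)
    show ?case
    proof (cases "real n * \<delta> \<le> T")
      case True
      show ?thesis
      proof (rule uniqueness_step[where ?t0.0 = "real n * \<delta>" and \<delta> = \<delta> and Y = Y and Y' = Y' and t = t
            and Z = Z and ?Z2.0 = Z2 and Zab = Zab and ?Zab2.0 = Zab2, OF R T])
        show "KD * CP * R^2 * t powr (1 - \<eta>) \<le> 1/2" if "0 \<le> t" "t \<le> \<delta>" for t
          by (rule \<delta>(3)[OF that])
        show "bnd a (R * s powr (- \<gamma>)) (Y s)" "bnd a (R * s powr (- \<gamma>)) (Y' s)" "zbnd al R Z Z2 Zab Zab2 s"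
          if "0 < s" "s \<le> T" for s
          using Y Y' Z that by auto
        show "((\<lambda>s. sg_symbol \<mu> (t - s) k *
          (Psi chi rho \<nu> lam (Y s) (Z s) (Z2 s) (Zab s) (Zab2 s) k
         - Psi chi rho \<nu> lam (Y' s) (Z s) (Z2 s) (Zab s) (Zab2 s) k)) has_integral (Y t k - Y' t k)) {0..t}"
          if "0 < t" "t \<le> T" for t k
          by (rule I[OF that])
        show "Y s = Y' s" if "0 < s" "s \<le> real n * \<delta>" for s
          using Suc.IH[of s] that True by auto
      qed (use Suc.prems \<delta>(1) in \<open>auto simp: algebra_simps\<close>)
    qed (use Suc in auto)
  qed auto
  obtain n :: nat where "1 / \<delta> < real n" using reals_Archimedean2 by blast
  hence "t \<le> real n * \<delta>" using t T \<delta>(1) by (simp add: field_simps)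
  thus ?thesis using steps t by blast
qed

end

section \<open>Existence\<close>

lemma (in mild_exponents) gamma_less: "\<gamma> < 1/3"
proof -
  have "a + al + 6 * \<gamma> < 2" using exponents(5) by (simp add: field_simps)
  hence "6 * \<gamma> < 2" using exponents(1,2) by simp
  thus ?thesis by simp
qed

text \<open>The iteration stays in the ball \<open>R * t powr (- \<gamma>)\<close>:
  \<open>linear_part\<close> takes up half of the radius, and \<open>small\<close> leaves the other
  half for the Duhamel term and also makes the map a contraction by \<open>1/2\<close>.\<close>

locale picard = mild_exponents +
  fixes R T :: real and Y0 :: distr and Z Z2 Zab Zab2 :: "real \<Rightarrow> distr"
  assumes R: "R \<ge> 1" and T: "0 < T" "T \<le> 1"
    and small: "\<And>t. 0 \<le> t \<Longrightarrow> t \<le> T \<Longrightarrow> KD * CP * R^2 * t powr (1 - \<eta>) \<le> 1/2"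
    and linear_part: "\<And>t. 0 < t \<Longrightarrow> t \<le> T \<Longrightarrow> bnd a (R / 2 * t powr (- \<gamma>)) (\<lambda>k. sg_symbol \<mu> t k * Y0 k)"
    and Z: "in_Zset chi rho Z Z2 Zab Zab2" "\<And>s. 0 < s \<Longrightarrow> s \<le> T \<Longrightarrow> zbnd al R Z Z2 Zab Zab2 s"
begin

abbreviation forcing :: "(real \<Rightarrow> distr) \<Rightarrow> real \<Rightarrow> distr" where
  "forcing V s \<equiv> Psi chi rho \<nu> lam (V s) (Z s) (Z2 s) (Zab s) (Zab2 s)"

definition mild_map :: "(real \<Rightarrow> distr) \<Rightarrow> real \<Rightarrow> distr" where
  "mild_map V t k = sg_symbol \<mu> t k * Y0 k + integral {0..t} (\<lambda>s. sg_symbol \<mu> (t - s) k * forcing V s k)"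

text \<open>Measurability is carried along because integrability in \<open>mild_map\<close> comes
  from domination by an integrable power; without integrability \<open>integral\<close> would be a
  default value.\<close>

definition admissible :: "(real \<Rightarrow> distr) \<Rightarrow> bool" where
  "admissible V \<longleftrightarrow> (\<forall>t. 0 < t \<longrightarrow> t \<le> T \<longrightarrow> bnd a (R * t powr (- \<gamma>)) (V t)) \<and>
     (\<forall>k. (\<lambda>t. V t k) \<in> borel_measurable (lebesgue_on {0<..T}))"

lemma admissible_bnd: "admissible V \<Longrightarrow> 0 < t \<Longrightarrow> t \<le> T \<Longrightarrow> bnd a (R * t powr (- \<gamma>)) (V t)"
  by (simp add: admissible_def)

lemma forcing_bnd:
  assumes "admissible V" "0 < s" "s \<le> T"
  shows "bnd (- al) (CP * R^3 * s powr (- (3 * \<gamma>))) (forcing V s)"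
  using assms T R Z(2)[of s] by (intro Psi_growth) (auto simp: admissible_def)

lemma mild_integrable:
  assumes V: "admissible V" and t: "0 < t" "t \<le> T"
  shows "(\<lambda>s. sg_symbol \<mu> (t - s) k * forcing V s k) integrable_on {0..t}"
proof (rule duhamel_integrable)
  show "3 * \<gamma> < 1" using gamma_less by simp
  show "bnd (- al) (CP * R^3 * s powr (- (3 * \<gamma>))) (forcing V s)" if "0 < s" "s < t" for s
    using forcing_bnd[OF V] that t by simp
  have "(\<lambda>s. forcing V s k) \<in> borel_measurable (lebesgue_on {0<..T})"
    using V in_Zset_measurable[OF Z(1)] by (intro Psi_measurable) (auto simp: admissible_def)
  thus "(\<lambda>s. forcing V s k) \<in> borel_measurable (lebesgue_on {0<..<t})"
    by (rule measurable_restrict_mono) (use t in auto)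
qed (use t in auto)

lemma mild_map_continuous:
  assumes "admissible V"
  shows "continuous_on {0<..T} (\<lambda>t. mild_map V t k)"
  unfolding mild_map_def
  by (intro continuous_intros continuous_on_subset[OF duhamel_continuous[OF mild_integrable[OF assms]]])
     (use T in auto)

lemma mild_map_bnd:
  assumes V: "admissible V" and t: "0 < t" "t \<le> T"
  shows "bnd a (R * t powr (- \<gamma>)) (mild_map V t)"
proof -
  have "bnd a (KD * (CP * R^3) * (t - 0) powr (1 - \<eta>)) (\<lambda>k. integral {0..t} (\<lambda>s. sg_symbol \<mu> (t - s) k * forcing V s k))"
    by (rule duhamel_gain[where G = "forcing V"])
       (use t T R CP forcing_bnd[OF V] integrable_integral[OF mild_integrable[OF V t]] in auto)
  moreover have "KD * (CP * R^3) * (t - 0) powr (1 - \<eta>) \<le> R / 2 * t powr (- \<gamma>)"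
  proof -
    have "KD * (CP * R^3) * (t - 0) powr (1 - \<eta>) = KD * CP * R^2 * t powr (1 - \<eta>) * R"
      by (simp add: power2_eq_square power3_eq_cube)
    also have "\<dots> \<le> 1/2 * R" using small[of t] t R by (intro mult_right_mono) auto
    also have "\<dots> = R / 2 * 1" by simp
    also have "\<dots> \<le> R / 2 * t powr (- \<gamma>)" using t T R by (intro mult_left_mono powr_neg_ge_1) auto
    finally show ?thesis .
  qed
  ultimately have "bnd a (R / 2 * t powr (- \<gamma>)) (\<lambda>k. integral {0..t} (\<lambda>s. sg_symbol \<mu> (t - s) k * forcing V s k))"
    by (rule bnd_mono)
  from bnd_add[OF linear_part[OF t] this] show ?thesis by (simp add: mild_map_def[abs_def] flip: distrib_right)
qed

text \<open>\<open>U\<close> is any common bound rather than a distance, so no complete metric space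
  of paths has to be set up.\<close>

lemma mild_map_contraction:
  assumes V: "admissible V" "admissible V'" and U: "U \<ge> 0"
    and d: "\<And>s. 0 < s \<Longrightarrow> s \<le> T \<Longrightarrow> bnd a (U * s powr (- \<gamma>)) (\<lambda>k. V s k - V' s k)"
    and t: "0 < t" "t \<le> T"
  shows "bnd a (U / 2 * t powr (- \<gamma>)) (\<lambda>k. mild_map V t k - mild_map V' t k)"
proof -
  have "bnd a (KD * (CP * R^2 * U) * (t - 0) powr (1 - \<eta>)) (\<lambda>k. mild_map V t k - mild_map V' t k)"
  proof (rule duhamel_gain[where G = "\<lambda>s k. forcing V s k - forcing V' s k"])
    show "bnd (- al) (CP * R^2 * U * s powr (- (3 * \<gamma>))) (\<lambda>k. forcing V s k - forcing V' s k)"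
      if "0 < s" "s < t" for s
      using that t T R d[of s] Z(2)[of s] V by (intro Psi_difference admissible_bnd) auto
    show "((\<lambda>s. sg_symbol \<mu> (t - s) k * (forcing V s k - forcing V' s k)) has_integral
       mild_map V t k - mild_map V' t k) {0..t}" for k
      using has_integral_diff[OF integrable_integral[OF mild_integrable[OF V(1) t]]
          integrable_integral[OF mild_integrable[OF V(2) t]], of k k]
      by (simp add: mild_map_def right_diff_distrib)
  qed (use t T CP U in auto)
  thus ?thesis
  proof (rule bnd_mono)
    have "KD * (CP * R^2 * U) * (t - 0) powr (1 - \<eta>) = KD * CP * R^2 * t powr (1 - \<eta>) * U"
      by (simp add: mult_ac)
    also have "\<dots> \<le> 1/2 * U" using small[of t] t U by (intro mult_right_mono) auto
    also have "\<dots> = U / 2 * 1" by simp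
    also have "\<dots> \<le> U / 2 * t powr (- \<gamma>)" using t T U by (intro mult_left_mono powr_neg_ge_1) auto
    finally show "KD * (CP * R^2 * U) * (t - 0) powr (1 - \<eta>) \<le> U / 2 * t powr (- \<gamma>)" .
  qed
qed

text \<open>Set to zero outside \<open>(0, T]\<close>, as \<open>sol_set\<close> prescribes for its
  members.\<close>

primrec iterate :: "nat \<Rightarrow> real \<Rightarrow> distr" where
  "iterate 0 = (\<lambda>t k. 0)"
| "iterate (Suc i) = (\<lambda>t k. if t \<in> {0<..T} then mild_map (iterate i) t k else 0)"

lemma iterate_Suc_inside: "0 < t \<Longrightarrow> t \<le> T \<Longrightarrow> iterate (Suc i) t = mild_map (iterate i) t"
  by (simp add: fun_eq_iff)

lemma iterate_outside: "t \<notin> {0<..T} \<Longrightarrow> iterate i t k = 0"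
  by (cases i) auto

lemma iterate_admissible: "admissible (iterate i)"
proof (induction i)
  case 0
  show ?case using R by (simp add: admissible_def bnd_zero)
next
  case (Suc i)
  have "(\<lambda>t. iterate (Suc i) t k) \<in> borel_measurable (lebesgue_on {0<..T})" for k
    by (intro continuous_imp_measurable_on_sets_lebesgue
          continuous_on_eq[OF mild_map_continuous[OF Suc, of k]]) auto
  moreover have "bnd a (R * t powr (- \<gamma>)) (iterate (Suc i) t)" if "0 < t" "t \<le> T" for t
    unfolding iterate_Suc_inside[OF that] by (rule mild_map_bnd[OF Suc that])
  ultimately show ?case unfolding admissible_def by blast
qed

lemma iterate_step:
  "0 < t \<Longrightarrow> t \<le> T \<Longrightarrow> bnd a (R / 2 ^ i * t powr (- \<gamma>)) (\<lambda>k. iterate (Suc i) t k - iterate i t k)"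
proof (induction i arbitrary: t)
  case 0
  thus ?case using admissible_bnd[OF iterate_admissible[of 1] 0] by simp
next
  case (Suc i)
  have "bnd a (R / 2 ^ i / 2 * t powr (- \<gamma>))
     (\<lambda>k. mild_map (iterate (Suc i)) t k - mild_map (iterate i) t k)"
    by (rule mild_map_contraction[OF iterate_admissible iterate_admissible])
       (use Suc R in auto)
  thus ?case unfolding iterate_Suc_inside[OF Suc.prems] by (simp add: mult.commute)
qed

lemma iterate_tail:
  assumes "0 < t" "t \<le> T"
  shows "bnd a (2 * R / 2 ^ i * t powr (- \<gamma>)) (\<lambda>k. iterate (i + j) t k - iterate i t k)"
proof -
  \<comment> \<open>The stronger factor \<open>1 - 1 / 2 ^ j\<close> is the partial geometric sum,
    for which the induction is exact.\<close>
  have "bnd a (2 * R / 2 ^ i * (1 - 1 / 2 ^ j) * t powr (- \<gamma>)) (\<lambda>k. iterate (i + j) t k - iterate i t k)"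
  proof (induction j)
    case 0
    show ?case by (simp add: bnd_zero)
  next
    case (Suc j)
    have "2 * R / 2 ^ i * (1 - 1 / 2 ^ Suc j) * t powr (- \<gamma>)
       = R / 2 ^ (i + j) * t powr (- \<gamma>) + 2 * R / 2 ^ i * (1 - 1 / 2 ^ j) * t powr (- \<gamma>)"
      by (simp add: power_add field_simps)
    thus ?case using bnd_add[OF iterate_step[OF assms, of "i + j"] Suc] by simp
  qed
  thus ?thesis
    by (rule bnd_mono) (use R in \<open>intro mult_right_mono, auto simp: field_simps\<close>)
qed

section \<open>The limit of the iteration\<close>

definition solution :: "real \<Rightarrow> distr" where
  "solution t k = lim (\<lambda>i. iterate i t k)"

lemma iterate_tendsto: "(\<lambda>i. iterate i t k) \<longlonglongrightarrow> solution t k"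
proof (cases "t \<in> {0<..T}")
  case True
  hence t: "0 < t" "t \<le> T" by auto
  obtain B where B: "B \<ge> 0" "\<And>C f. bnd a C f \<Longrightarrow> norm (f k) \<le> B * C" using bnd_coeff by metis
  have "summable (\<lambda>i. iterate (Suc i) t k - iterate i t k)"
  proof (rule summable_comparison_test')
    show "summable (\<lambda>i. B * (R * t powr (- \<gamma>)) * (1 / 2) ^ i)"
      by (intro summable_mult summable_geometric) simp
    fix i :: nat
    show "norm (iterate (Suc i) t k - iterate i t k) \<le> B * (R * t powr (- \<gamma>)) * (1 / 2) ^ i"
      using B(2)[OF iterate_step[OF t, of i]] by (simp add: power_divide)
  qed
  hence "(\<lambda>n. \<Sum>i<n. iterate (Suc i) t k - iterate i t k) \<longlonglongrightarrow> (\<Sum>i. iterate (Suc i) t k - iterate i t k)"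
    by (rule summable_LIMSEQ)
  hence "(\<lambda>n. iterate n t k) \<longlonglongrightarrow> (\<Sum>i. iterate (Suc i) t k - iterate i t k)"
    unfolding sum_lessThan_telescope[of "\<lambda>i. iterate i t k"] iterate.simps(1) diff_0_right .
  thus ?thesis unfolding solution_def by (simp only: limI)
next
  case False
  thus ?thesis by (simp add: iterate_outside solution_def limI)
qed

lemma solution_outside: "t \<notin> {0<..T} \<Longrightarrow> solution t = (\<lambda>_. 0)"
  by (simp add: fun_eq_iff solution_def iterate_outside limI)

lemma solution_admissible: "admissible solution"
proof -
  have "bnd a (R * t powr (- \<gamma>)) (solution t)" if "0 < t" "t \<le> T" for t
    by (rule bnd_limit[where f = "\<lambda>i. iterate i t"])
       (use iterate_tendsto admissible_bnd[OF iterate_admissible that] in auto)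
  moreover have "(\<lambda>t. solution t k) \<in> borel_measurable (lebesgue_on {0<..T})" for k
    by (rule borel_measurable_LIMSEQ_metric[OF _ iterate_tendsto])
       (use iterate_admissible in \<open>unfold admissible_def, blast\<close>)
  ultimately show ?thesis by (simp add: admissible_def)
qed

lemma solution_iterate_diff:
  assumes "0 < t" "t \<le> T"
  shows "bnd a (2 * R / 2 ^ i * t powr (- \<gamma>)) (\<lambda>k. solution t k - iterate i t k)"
proof (rule bnd_limit)
  show "(\<lambda>j. iterate (i + j) t k - iterate i t k) \<longlonglongrightarrow> solution t k - iterate i t k" for k
    using LIMSEQ_ignore_initial_segment[OF iterate_tendsto[of t k], of i]
    by (intro tendsto_intros) (simp add: add.commute)
qed (rule iterate_tail[OF assms])

text \<open>Both sides are within \<open>R / 2 ^ i\<close> times the weight of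
  \<open>iterate (Suc i)\<close>: one as a tail of the iteration, the other by the
  contraction.\<close>

lemma solution_fixed_point:
  assumes t: "0 < t" "t \<le> T"
  shows "solution t k = mild_map solution t k"
proof -
  have "solution t k - mild_map solution t k = 0"
  proof (rule bnd_halving_imp_zero[where c = "2 * R * t powr (- \<gamma>)"])
    fix i :: nat
    have "bnd a (2 * R / 2 ^ i / 2 * t powr (- \<gamma>)) (\<lambda>k. mild_map solution t k - mild_map (iterate i) t k)"
      by (rule mild_map_contraction[OF solution_admissible iterate_admissible _ solution_iterate_diff t])
         (use R in auto)
    from bnd_diff[OF solution_iterate_diff[OF t, of "Suc i"] this]
    show "bnd a (2 * R * t powr (- \<gamma>) / 2 ^ i) (\<lambda>k. solution t k - mild_map solution t k)"
      unfolding iterate_Suc_inside[OF t] by (simp add: field_simps)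
  qed
  thus ?thesis by simp
qed

lemma solution_integral:
  assumes "0 < t" "t \<le> T"
  shows "((\<lambda>s. sg_symbol \<mu> (t - s) k * forcing solution s k) has_integral
           solution t k - sg_symbol \<mu> t k * Y0 k) {0..t}"
  using integrable_integral[OF mild_integrable[OF solution_admissible assms, of k]]
  by (simp add: solution_fixed_point[OF assms] mild_map_def)

text \<open>Half of the margin \<open>1 - \<eta>\<close> is spent on extra regularity: away from
  time 0 the path is bounded in regularity \<open>a + 2 * e\<close>, and since its coefficients are
  continuous \<open>cont_besovI\<close> applies. The exponent \<open>a - 2 * \<gamma>\<close> is
  that of the initial datum.\<close>

lemma solution_continuous:
  assumes Y0: "bnd (a - 2 * \<gamma>) K Y0"
  shows "cont_besov chi rho a {0<..T} solution"
proof -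
  define e where "e = (1 - \<eta>) / 2"
  define \<theta> where "\<theta> = (a + al) / 2 + e"
  have \<eta>: "\<eta> < 1" "0 < \<eta>" using exponents by (simp_all add: \<eta>_def add_pos_pos)
  have "\<theta> + 3 * \<gamma> = (1 + \<eta>) / 2" by (simp add: \<theta>_def e_def \<eta>_def field_simps)
  hence e: "0 < e" "e < 1/2" "\<theta> + 3 * \<gamma> < 1" using \<eta> by (simp_all add: e_def)
  have "0 \<le> \<theta>" using e exponents by (simp add: \<theta>_def)
  note e = e this gamma_less
  define a' where "a' = a + 2 * e"
  define C1 where "C1 = 3 * CM * 2 powr \<bar>a - 2 * \<gamma>\<bar> * K"
  define C2 where "C2 = 6 * CM * 2 powr \<bar>- al\<bar> / (1 - (\<theta> + 3 * \<gamma>)) * (CP * R^3)"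
  have nonneg: "C1 \<ge> 0" "C2 \<ge> 0" using bnd_nonneg[OF Y0] CM CP R e by (auto simp: C1_def C2_def)
  have b: "bnd a' (C1 * s powr (- (\<gamma> + e)) + C2) (solution s)" if s: "0 < s" "s \<le> T" for s
  proof -
    have "bnd (a - 2 * \<gamma> + 2 * (\<gamma> + e)) (C1 * s powr (- (\<gamma> + e))) (\<lambda>k. sg_symbol \<mu> s k * Y0 k)"
      unfolding C1_def using Y0 s T e exponents by (intro bnd_semigroup) auto
    moreover have "a - 2 * \<gamma> + 2 * (\<gamma> + e) = a'" by (simp add: a'_def)
    ultimately have 1: "bnd a' (C1 * s powr (- (\<gamma> + e))) (\<lambda>k. sg_symbol \<mu> s k * Y0 k)" by simp
    have "bnd (- al + 2 * \<theta>) (6 * CM * 2 powr \<bar>- al\<bar> / (1 - (\<theta> + 3 * \<gamma>)) * (CP * R^3) * (s - 0) powr (1 - (\<theta> + 3 * \<gamma>)))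
       (\<lambda>k. integral {0..s} (\<lambda>r. sg_symbol \<mu> (s - r) k * forcing solution r k))"
      by (rule duhamel_bound[where G = "forcing solution"])
         (use s T e exponents forcing_bnd[OF solution_admissible]
            integrable_integral[OF mild_integrable[OF solution_admissible s]] in auto)
    moreover have "- al + 2 * \<theta> = a'" by (simp add: a'_def \<theta>_def field_simps)
    ultimately have "bnd a' (C2 * s powr (1 - (\<theta> + 3 * \<gamma>)))
       (\<lambda>k. integral {0..s} (\<lambda>r. sg_symbol \<mu> (s - r) k * forcing solution r k))"
      by (simp add: C2_def)
    moreover have "C2 * s powr (1 - (\<theta> + 3 * \<gamma>)) \<le> C2 * 1"
      using nonneg s T e by (intro mult_left_mono powr_le1) auto
    ultimately have 2: "bnd a' C2 (\<lambda>k. integral {0..s} (\<lambda>r. sg_symbol \<mu> (s - r) k * forcing solution r k))"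
      by (auto intro: bnd_mono)
    show ?thesis
      using bnd_add[OF 1 2] unfolding mild_map_def[symmetric] solution_fixed_point[OF s, symmetric] .
  qed
  show ?thesis
  proof (rule cont_besovI)
    show "a < a'" using e by (simp add: a'_def)
    show "continuous_on {0<..T} (\<lambda>t. solution t k)" for k
      by (rule continuous_on_eq[OF mild_map_continuous[OF solution_admissible, of k]])
         (simp add: solution_fixed_point)
    fix t assume t: "t \<in> {0<..T}"
    have "bnd a' (C1 * (t / 2) powr (- (\<gamma> + e)) + C2) (solution s)" if s: "s \<in> {0<..T}" "\<bar>s - t\<bar> < t / 2" for s
    proof (rule bnd_mono[OF b])
      have "t / 2 \<le> s" using s t unfolding abs_less_iff by auto
      thus "C1 * s powr (- (\<gamma> + e)) + C2 \<le> C1 * (t / 2) powr (- (\<gamma> + e)) + C2"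
        using nonneg t e exponents by (intro add_right_mono mult_left_mono powr_mono2') auto
    qed (use s in auto)
    moreover have "t / 2 > 0" using t by simp
    ultimately show "\<exists>d>0. \<exists>C. \<forall>s\<in>{0<..T}. \<bar>s - t\<bar> < d \<longrightarrow> bnd a' C (solution s)"
      by blast
  qed
qed

lemma solution_is_solution:
  assumes Y0: "bnd (a - 2 * \<gamma>) K Y0"
  shows "is_solution chi rho \<mu> \<nu> lam T Y0 Z Z2 Zab Zab2 solution"
proof -
  have "t powr \<gamma> * besov_norm chi rho a (solution t) \<le> 2 powr (- a) * R" if t: "0 < t" "t \<le> T" for t
  proof -
    have "besov_norm chi rho a (solution t) \<le> 2 powr (- a) * (R * t powr (- \<gamma>))"
      by (rule bnd_besov[OF admissible_bnd[OF solution_admissible t]])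
    hence "t powr \<gamma> * besov_norm chi rho a (solution t) \<le> t powr \<gamma> * (2 powr (- a) * (R * t powr (- \<gamma>)))"
      by (intro mult_left_mono) auto
    also have "\<dots> = 2 powr (- a) * R" using t by (simp add: powr_minus field_simps)
    finally show ?thesis .
  qed
  hence "bdd_above ((\<lambda>t. t powr \<gamma> * besov_norm chi rho a (solution t)) ` {0<..T})"
    by (intro bdd_aboveI2) auto
  moreover have "0 < \<gamma>" "\<gamma> < 1/3" "0 < a" using exponents gamma_less by auto
  ultimately have "\<exists>\<alpha>1>0. \<exists>g. 0 < g \<and> g < 1/3 \<and> cont_besov chi rho \<alpha>1 {0<..T} solution \<and>
      bdd_above ((\<lambda>t. t powr g * besov_norm chi rho \<alpha>1 (solution t)) ` {0<..T})"
    using solution_continuous[OF Y0] by blast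
  thus ?thesis unfolding is_solution_def using solution_integral by auto
qed

end

text \<open>The two solutions come with their own exponents, so the weaker ones are taken, and
  \<open>a\<close> is lowered further to \<open>(1 - 3 * \<gamma>) / 2\<close> to have
  \<open>a + 3 * \<gamma> < 1\<close>. The \<open>al\<close> here is fitted to these and may differ
  from that of the theorem; \<open>in_Zset\<close> bounds the noise for every exponent.
  \<open>R\<close> is not controlled by \<open>K\<close>, which is why the interval is exhausted in
  steps.\<close>

lemma (in dyadic_heat) solutions_unique:
  assumes Z: "in_Zset chi rho Z Z2 Zab Zab2" and T: "0 < T" "T \<le> 1"
    and Y: "is_solution chi rho \<mu> \<nu> lam T Y0 Z Z2 Zab Zab2 Y"
    and Y': "is_solution chi rho \<mu> \<nu> lam T Y0 Z Z2 Zab Zab2 Y'"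
    and t: "0 < t" "t \<le> T"
  shows "Y t = Y' t"
proof -
  have ex: "\<exists>a \<gamma> B. 0 < a \<and> 0 < \<gamma> \<and> \<gamma> < 1/3 \<and> (\<forall>s. 0 < s \<longrightarrow> s \<le> T \<longrightarrow> bnd a (B * s powr (- \<gamma>)) (V s))"
    if V: "is_solution chi rho \<mu> \<nu> lam T Y0 Z Z2 Zab Zab2 V" for V
  proof -
    obtain a \<gamma> where a: "0 < a" "0 < \<gamma>" "\<gamma> < 1/3" and c: "cont_besov chi rho a {0<..T} V"
      and b: "bdd_above ((\<lambda>t. t powr \<gamma> * besov_norm chi rho a (V t)) ` {0<..T})"
      using V unfolding is_solution_def by blast
    obtain B where B: "\<And>s. 0 < s \<Longrightarrow> s \<le> T \<Longrightarrow> s powr \<gamma> * besov_norm chi rho a (V s) \<le> B"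
      using b unfolding bdd_above_def by fastforce
    have "bnd a (2 powr a * B * s powr (- \<gamma>)) (V s)" if s: "0 < s" "s \<le> T" for s
    proof -
      have "in_besov chi rho a (V s)" using c s by (simp add: cont_besov_def)
      moreover have "besov_norm chi rho a (V s) \<le> B * s powr (- \<gamma>)"
        using B[OF s] s by (simp add: powr_minus field_simps)
      ultimately show ?thesis using besov_bnd by (simp add: mult.assoc)
    qed
    thus ?thesis using a by blast
  qed
  obtain a1 \<gamma>1 B1 where 1: "0 < a1" "0 < \<gamma>1" "\<gamma>1 < 1/3"
    "\<And>s. 0 < s \<Longrightarrow> s \<le> T \<Longrightarrow> bnd a1 (B1 * s powr (- \<gamma>1)) (Y s)" using ex[OF Y] by blast
  obtain a2 \<gamma>2 B2 where 2: "0 < a2" "0 < \<gamma>2" "\<gamma>2 < 1/3"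
    "\<And>s. 0 < s \<Longrightarrow> s \<le> T \<Longrightarrow> bnd a2 (B2 * s powr (- \<gamma>2)) (Y' s)" using ex[OF Y'] by blast
  define \<gamma> where "\<gamma> = max \<gamma>1 \<gamma>2"
  define a where "a = min (min a1 a2) ((1 - 3 * \<gamma>) / 2)"
  define al where "al = min (a / 2) (2 * \<gamma>)"
  have \<gamma>: "0 < \<gamma>" "\<gamma> < 1/3" using 1 2 by (auto simp: \<gamma>_def)
  have a: "0 < a" "a \<le> a1" "a \<le> a2" using 1 2 \<gamma> by (auto simp: a_def)
  have a4: "a \<le> (1 - 3 * \<gamma>) / 2" unfolding a_def by (rule min.cobounded2)
  have al: "0 < al" "al < a" "al \<le> 2 * \<gamma>" using a \<gamma> by (auto simp: al_def)
  have "(a + al) / 2 < a" using al by simp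
  moreover have "a + 3 * \<gamma> < 1" using a4 \<gamma> by (simp add: field_simps)
  ultimately have \<eta>: "(a + al) / 2 + 3 * \<gamma> < 1" by (rule less_trans[OF add_strict_right_mono])
  obtain CP where "mild_exponents chi rho \<mu> CM \<nu> lam a al \<gamma> CP"
    by (rule mild_exponents_exists[OF al(1,2) \<gamma>(1) al(3) \<eta>]) (rule that, assumption+)
  then interpret M: mild_exponents chi rho \<mu> CM \<nu> lam a al \<gamma> CP .
  obtain BZ where BZ: "\<And>s. 0 < s \<Longrightarrow> s \<le> T \<Longrightarrow> znorm chi rho al Z Z2 Zab Zab2 s \<le> BZ"
    using Z T al unfolding in_Zset_def bdd_above_def by fastforce
  define R where "R = Max {1, B1, B2, BZ}"
  have R: "1 \<le> R" "B1 \<le> R" "B2 \<le> R" "BZ \<le> R" unfolding R_def by (rule Max_ge; simp)+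
  have mono: "bnd a (R * s powr (- \<gamma>)) f"
    if f: "bnd a' (B * s powr (- \<gamma>')) f" and s: "0 < s" "s \<le> T" and le: "a \<le> a'" "B \<le> R" "\<gamma>' \<le> \<gamma>" for a' B \<gamma>' f s
  proof (rule bnd_mono[OF bnd_weaken[OF f le(1)]])
    have "B * s powr (- \<gamma>') \<le> R * s powr (- \<gamma>')" using le by (intro mult_right_mono) auto
    also have "\<dots> \<le> R * s powr (- \<gamma>)" using R s T le by (intro mult_left_mono powr_mono') auto
    finally show "B * s powr (- \<gamma>') \<le> R * s powr (- \<gamma>)" .
  qed
  show ?thesis
  proof (rule M.uniqueness[OF R(1) T(2), where Y = Y and Y' = Y' and t = t
        and Z = Z and ?Z2.0 = Z2 and Zab = Zab and ?Zab2.0 = Zab2])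
    show "bnd a (R * s powr (- \<gamma>)) (Y s)" if "0 < s" "s \<le> T" for s
      by (rule mono[OF 1(4)[OF that] that a(2) R(2)]) (simp add: \<gamma>_def)
    show "bnd a (R * s powr (- \<gamma>)) (Y' s)" if "0 < s" "s \<le> T" for s
      by (rule mono[OF 2(4)[OF that] that a(3) R(3)]) (simp add: \<gamma>_def)
    show "zbnd al R Z Z2 Zab Zab2 s" if "0 < s" "s \<le> T" for s
      by (rule in_Zset_zbnd[OF Z al(1) that(1) order.trans[OF BZ[OF that] R(4)]])
    show "((\<lambda>s. sg_symbol \<mu> (t - s) k *
        (Psi chi rho \<nu> lam (Y s) (Z s) (Z2 s) (Zab s) (Zab2 s) k
         - Psi chi rho \<nu> lam (Y' s) (Z s) (Z2 s) (Zab s) (Zab2 s) k)) has_integral (Y t k - Y' t k)) {0..t}"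
      if "0 < t" "t \<le> T" for t k
    proof -
      have "((\<lambda>s. sg_symbol \<mu> (t - s) k * Psi chi rho \<nu> lam (V s) (Z s) (Z2 s) (Zab s) (Zab2 s) k)
           has_integral (V t k - sg_symbol \<mu> t k * Y0 k)) {0..t}"
        if "is_solution chi rho \<mu> \<nu> lam T Y0 Z Z2 Zab Zab2 V" for V
      proof -
        have "t \<in> {0<..T}" using \<open>0 < t\<close> \<open>t \<le> T\<close> by simp
        thus ?thesis using that unfolding is_solution_def by blast
      qed
      from has_integral_diff[OF this[OF Y] this[OF Y']] show ?thesis
        by (simp add: right_diff_distrib)
    qed
  qed (use t in auto)
qed

theorem theorem3p2:
  fixes chi rho :: "real \<times> real \<Rightarrow> real" and \<mu> :: real and \<nu> :: complex and lam :: real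
  assumes "dyadic_partition chi rho" and "\<mu> > 0" and "Re \<nu> > 0"
  shows "\<forall>\<alpha>0. 0 < \<alpha>0 \<and> \<alpha>0 < 2/3 \<longrightarrow>
           (\<exists>\<alpha>>0. \<forall>K\<ge>1. \<exists>Tst>0. \<forall>Y0 Z Z2 Zab Zab2.
              in_besov chi rho (-\<alpha>0) Y0 \<and> in_Zset chi rho Z Z2 Zab Zab2 \<and>
              besov_norm chi rho (-\<alpha>0) Y0 + (SUP t\<in>{0<..Tst}. znorm chi rho \<alpha> Z Z2 Zab Zab2 t) \<le> K
              \<longrightarrow> is_singleton (sol_set chi rho \<mu> \<nu> lam Tst Y0 Z Z2 Zab Zab2))"
proof (intro allI impI)
  interpret dyadic chi rho by unfold_locales (rule assms(1))
  obtain CM where "CM > 0"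
    "\<And>n t c D H x. 0 \<le> t \<Longrightarrow> t \<le> 1 \<Longrightarrow> (\<And>x. norm (\<Sum>k\<in>fbox D. c k * ch k x) \<le> H) \<Longrightarrow>
       norm (\<Sum>k\<in>fbox D. of_real (wt n k) * sg_symbol \<mu> t k * c k * ch k x) \<le> CM / (1 + t * 4 ^ n) * H"
    by (rule multiplier_semigroup[OF assms(2)]) (rule that, assumption, blast)
  then interpret dyadic_heat chi rho \<mu> CM by unfold_locales (assumption, blast)
  fix \<alpha>0 :: real assume \<alpha>0: "0 < \<alpha>0 \<and> \<alpha>0 < 2/3"
  \<comment> \<open>With these values \<open>- \<alpha>0 + 2 * \<gamma> = a\<close> and
    \<open>(a + al) / 2 + 3 * \<gamma> = 3/4 + 3/8 * \<alpha>0\<close>, so \<open>a > 0\<close>,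
    \<open>\<gamma> < 1/3\<close> and the integrability condition all amount to
    \<open>\<alpha>0 < 2/3\<close>.\<close>
  define a where "a = 1/3 - \<alpha>0 / 2"
  define al where "al = a / 2"
  define \<gamma> where "\<gamma> = (\<alpha>0 + a) / 2"
  have e: "0 < al" "al < a" "0 < \<gamma>" "al \<le> 2 * \<gamma>" "(a + al) / 2 + 3 * \<gamma> < 1" "\<gamma> \<le> 1"
    using \<alpha>0 by (auto simp: a_def al_def \<gamma>_def field_simps)
  obtain CP where "mild_exponents chi rho \<mu> CM \<nu> lam a al \<gamma> CP"
    by (rule mild_exponents_exists[OF e(1-5)]) (rule that, assumption+)
  then interpret mild_exponents chi rho \<mu> CM \<nu> lam a al \<gamma> CP .
  show "\<exists>\<alpha>>0. \<forall>K\<ge>1. \<exists>Tst>0. \<forall>Y0 Z Z2 Zab Zab2.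
              in_besov chi rho (-\<alpha>0) Y0 \<and> in_Zset chi rho Z Z2 Zab Zab2 \<and>
              besov_norm chi rho (-\<alpha>0) Y0 + (SUP t\<in>{0<..Tst}. znorm chi rho \<alpha> Z Z2 Zab Zab2 t) \<le> K
              \<longrightarrow> is_singleton (sol_set chi rho \<mu> \<nu> lam Tst Y0 Z Z2 Zab Zab2)"
  proof (rule exI[of _ al], intro conjI e(1) allI impI)
    fix K :: real assume K: "1 \<le> K"
    define C1 where "C1 = 3 * CM * 2 powr \<bar>- \<alpha>0\<bar>"
    have C1: "C1 > 0" using CM by (simp add: C1_def)
    \<comment> \<open>\<open>R / 2 \<ge> C1 * K\<close> serves the linear flow and
      \<open>R \<ge> K\<close> the noise; \<open>R\<close>, and hence \<open>T\<close>, depends on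
      the data only through \<open>K\<close>.\<close>
    define R where "R = 2 * C1 * K + K"
    have R: "1 \<le> R" "K \<le> R" using C1 K by (auto simp: R_def add_increasing)
    obtain T where T: "T > 0" "T \<le> 1" "\<And>t. 0 \<le> t \<Longrightarrow> t \<le> T \<Longrightarrow> KD * CP * R^2 * t powr (1 - \<eta>) \<le> 1/2"
      by (rule contraction_time[OF R(1)]) (rule that, assumption+)
    have "is_singleton (sol_set chi rho \<mu> \<nu> lam T Y0 Z Z2 Zab Zab2)"
      if Y0: "in_besov chi rho (-\<alpha>0) Y0" and Z: "in_Zset chi rho Z Z2 Zab Zab2"
        and le: "besov_norm chi rho (-\<alpha>0) Y0 + (SUP t\<in>{0<..T}. znorm chi rho al Z Z2 Zab Zab2 t) \<le> K"
      for Y0 Z Z2 Zab Zab2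
    proof -
      have zn: "znorm chi rho al Z Z2 Zab Zab2 t \<le> (SUP t\<in>{0<..T}. znorm chi rho al Z Z2 Zab Zab2 t)"
        if "0 < t" "t \<le> T" for t
        using that Z T(1) e(1) unfolding in_Zset_def by (intro cSUP_upper) auto
      \<comment> \<open>Nonnegativity of \<open>znorm\<close> at one time makes the supremum
        nonnegative, so that \<open>K\<close> bounds the initial datum by itself.\<close>
      have "in_besov chi rho (- al) (Z T)"
        using Z T(1) e(1) unfolding in_Zset_def cont_besov_def by auto
      hence "0 \<le> znorm chi rho al Z Z2 Zab Zab2 T"
        unfolding znorm_def using besov_norm_nonneg by (auto simp: le_max_iff_disj)
      with zn[of T] T(1) have "besov_norm chi rho (-\<alpha>0) Y0 \<le> K" using le by simp
      hence Y0b: "bnd (- \<alpha>0) K Y0" using Y0 \<alpha>0 by (intro besov_bnd_neg) auto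
      have znK: "znorm chi rho al Z Z2 Zab Zab2 t \<le> R" if "0 < t" "t \<le> T" for t
        using zn[OF that] besov_norm_nonneg[OF Y0] le R(2) by linarith
      have lin: "bnd a (R / 2 * t powr (- \<gamma>)) (\<lambda>k. sg_symbol \<mu> t k * Y0 k)" if "0 < t" "t \<le> T" for t
      proof -
        have "bnd (- \<alpha>0 + 2 * \<gamma>) (C1 * K * t powr (- \<gamma>)) (\<lambda>k. sg_symbol \<mu> t k * Y0 k)"
          unfolding C1_def using that T e by (intro bnd_semigroup Y0b) auto
        moreover have "- \<alpha>0 + 2 * \<gamma> = a" by (simp add: \<gamma>_def add_divide_distrib)
        moreover have "C1 * K * t powr (- \<gamma>) \<le> R / 2 * t powr (- \<gamma>)"
          using K by (intro mult_right_mono) (auto simp: R_def)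
        ultimately show ?thesis by (metis bnd_mono)
      qed
      interpret picard chi rho \<mu> CM \<nu> lam a al \<gamma> CP R T Y0 Z Z2 Zab Zab2
        by unfold_locales (use R T lin Z znK in_Zset_zbnd[OF Z e(1)] in auto)
      have "bnd (a - 2 * \<gamma>) K Y0" using Y0b by (simp add: \<gamma>_def add_divide_distrib)
      hence sol: "is_solution chi rho \<mu> \<nu> lam T Y0 Z Z2 Zab Zab2 solution"
        by (rule solution_is_solution)
      have "V = solution" if V: "V \<in> sol_set chi rho \<mu> \<nu> lam T Y0 Z Z2 Zab Zab2" for V
      proof
        fix t
        show "V t = solution t"
        proof (cases "t \<in> {0<..T}")
          case True
          thus ?thesis using V sol by (intro solutions_unique[OF Z(1) T(1,2)]) (auto simp: sol_set_def)
        next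
          case False
          thus ?thesis using V by (simp add: sol_set_def solution_outside)
        qed
      qed
      moreover have "solution \<in> sol_set chi rho \<mu> \<nu> lam T Y0 Z Z2 Zab Zab2"
        using sol solution_outside by (simp add: sol_set_def)
      ultimately show ?thesis unfolding is_singleton_def by blast
    qed
    thus "\<exists>Tst>0. \<forall>Y0 Z Z2 Zab Zab2.
              in_besov chi rho (-\<alpha>0) Y0 \<and> in_Zset chi rho Z Z2 Zab Zab2 \<and>
              besov_norm chi rho (-\<alpha>0) Y0 + (SUP t\<in>{0<..Tst}. znorm chi rho al Z Z2 Zab Zab2 t) \<le> K
              \<longrightarrow> is_singleton (sol_set chi rho \<mu> \<nu> lam Tst Y0 Z Z2 Zab Zab2)"
      using T(1) by blast
  qed
qed

end
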